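(* Let $r\ge1$, let $N$ be a non-negative integer, and let $a,b_1,\dots,b_r,x_1,\dots,x_r$ be generic nonzero complex parameters. Then $$\sum_{\substack{k_1,\dots,k_r\ge0\\ |\mathbf k|\le N}}\frac{\Delta(\mathbf xq^{2\mathbf k};p)}{\Delta(\mathbf x;p)}q^{|\mathbf k|-e_2(\mathbf k)}\frac{(a^2q;q^2,p)_{|\mathbf k|}\,(q^{N+1},q^{-N};q,p)_{|\mathbf k|}}{\prod_{i=1}^r(ax_iq^{N+2},ax_iq^{1-N};q^2,p)_{k_i}}$$ $$\times\prod_{1\le i<j\le r}\frac1{(x_ix_j;q^2,p)_{k_i+k_j}}\prod_{i,j=1}^r\frac{(b_jx_i,x_i/b_j;q^2,p)_{k_i}}{(q^2x_i/x_j;q^2,p)_{k_i}}$$ $$\times\prod_{i=1}^r\left(\frac{\theta(ax_iq^{2k_i+|\mathbf k|};p)}{\theta(ax_i;p)}\frac{(ax_i;q,p)_{|\mathbf k|}\,(aq/x_i;q,p)_{|\mathbf k|-k_i}}{(aq/b_i,ab_iq;q,p)_{|\mathbf k|}\,(q^{k_i-|\mathbf k|}x_i/a;q,p)_{k_i}}\right)$$ equals $$\prod_{i=1}^r\frac{(ax_iq^2,aq^2/x_i,b_iq/a,q/ab_i;q^2,p)_m}{(q/ax_i,x_iq/a,aq^2/b_i,ab_iq^2;q^2,p)_m}\quad\text{if }N=2m,$$ and $$\prod_{i=1}^r\frac{(ax_iq,aq/x_i,b_i/a,1/ab_i;q^2,p)_m}{(1/ax_i,x_i/a,aq/b_i,ab_iq;q^2,p)_m}\quad\text{if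 }N=2m-1.$$
   Context: $p,q$ are complex numbers with $|p|<1$, $q\ne0$, and $q^k\notin p^{\mathbb Z}$ for all integers $k>0$ (if $p=0$: $q^k\ne1$). For $x\ne0$, $\theta(x;p)=\prod_{j=0}^\infty(1-p^jx)(1-p^{j+1}/x)$. Elliptic shifted factorials: $(a;q,p)_k=\prod_{j=0}^{k-1}\theta(aq^j;p)$ for $k\in\mathbb Z_{\ge0}$ (similarly with base $q^2$), and $(a_1,\dots,a_m;q,p)_k=(a_1;q,p)_k\cdots(a_m;q,p)_k$. For $\mathbf k=(k_1,\dots,k_r)$, $|\mathbf k|=k_1+\cdots+k_r$ and $e_2(\mathbf k)=\sum_{1\le i<j\le r}k_ik_j$. For $\mathbf x=(x_1,\dots,x_r)$, $\Delta(\mathbf x;p)=\prod_{1\le i<j\le r}x_j\theta(x_i/x_j;p)$, and $\mathbf xq^{2\mathbf k}=(x_1q^{2k_1},\dots,x_rq^{2k_r})$. In expressions such as $q/ab_i$, everything after the slash is in the denominator. All parameters are assumed generic so that no denominator vanishes. *)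

theory Defs
  imports "HOL-Analysis.Analysis"
begin

text \<open>
  Vectors and multi-indices of length \<open>r\<close> are functions on \<open>{1..r}\<close>, so that \<open>r\<close> may be an
  arbitrary natural number.
\<close>

definition theta :: "complex \<Rightarrow> complex \<Rightarrow> complex" where
  "theta p x = (\<Prod>j. (1 - p ^ j * x) * (1 - p ^ (j + 1) / x))"

text \<open>
  \<open>q ^ k\<close> avoids \<open>p\<close> to any integer power, for all \<open>k > 0\<close>. Since \<open>0 powi 0 = 1\<close> and
  \<open>0 powi n = 0\<close> for \<open>n \<noteq> 0\<close>, for \<open>p = 0\<close> and \<open>q \<noteq> 0\<close> this says precisely
  that \<open>q ^ k \<noteq> 1\<close>.
\<close>

definition admissible_nome_base :: "complex \<Rightarrow> complex \<Rightarrow> bool" where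
  "admissible_nome_base p q \<longleftrightarrow>
     norm p < 1 \<and> q \<noteq> 0 \<and> (\<forall>k::nat. k > 0 \<longrightarrow> (\<forall>n::int. q ^ k \<noteq> p powi n))"

text \<open>\<open>efac q p [a\<^sub>1, \<dots>, a\<^sub>m] k\<close> is $(a_1,\dots,a_m;q,p)_k$.\<close>

definition efac :: "complex \<Rightarrow> complex \<Rightarrow> complex list \<Rightarrow> nat \<Rightarrow> complex" where
  "efac q p as k = (\<Prod>a\<leftarrow>as. \<Prod>j<k. theta p (a * q ^ j))"

definition Delta :: "complex \<Rightarrow> nat \<Rightarrow> (nat \<Rightarrow> complex) \<Rightarrow> complex" where
  "Delta p r x = (\<Prod>i=1..r. \<Prod>j\<in>{i<..r}. x j * theta p (x i / x j))"

definition weight :: "nat \<Rightarrow> (nat \<Rightarrow> nat) \<Rightarrow> nat" where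
  "weight r k = (\<Sum>i=1..r. k i)"

definition e2 :: "nat \<Rightarrow> (nat \<Rightarrow> nat) \<Rightarrow> nat" where
  "e2 r k = (\<Sum>i=1..r. \<Sum>j\<in>{i<..r}. k i * k j)"

text \<open>Extensional functions, so that each tuple is represented exactly once.\<close>

definition multi_indices :: "nat \<Rightarrow> nat \<Rightarrow> (nat \<Rightarrow> nat) set" where
  "multi_indices r N = {k \<in> {1..r} \<rightarrow>\<^sub>E UNIV. weight r k \<le> N}"

lemma finite_multi_indices: "finite (multi_indices r N)"
proof (rule finite_subset)
  show "multi_indices r N \<subseteq> {1..r} \<rightarrow>\<^sub>E {..N}"
  proof
    fix k assume k: "k \<in> multi_indices r N"
    have "k i \<le> N" if "i \<in> {1..r}" for i
      using k member_le_sum[OF that, of k] by (simp add: multi_indices_def weight_def)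
    with k show "k \<in> {1..r} \<rightarrow>\<^sub>E {..N}"
      by (auto simp: multi_indices_def PiE_iff)
  qed
qed (simp add: finite_PiE)

end

theory Submission
  imports Defs
begin

text \<open>
  With \<open>\<sigma>(w) = exp (- w) \<theta> (exp (2 w))\<close>, an odd function, put \<open>[u, v] = \<sigma> (u + v) \<sigma> (u - v)\<close> and write
  \<open>q = exp (2 \<eta>)\<close>, \<open>a = exp (2 \<alpha>)\<close>, \<open>x\<^sub>i = exp (2 \<xi>\<^sub>i)\<close>, \<open>b\<^sub>j = exp (2 \<beta>\<^sub>j)\<close>. The three-term
  relation for \<open>[u, v]\<close> yields two Lagrange interpolation formulas, of types A and C. After
  multiplication by the denominators containing the \<open>b\<^sub>j\<close>, the right-hand side is proportional to the
  product over \<open>j\<close> and \<open>s < N\<close> of \<open>[\<alpha> + (1 - N + 2 s) \<eta>, \<beta>\<^sub>j]\<close>. In passing from \<open>(N, a q)\<close>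
  to \<open>(N + 1, a)\<close> it acquires the factors \<open>[\<alpha> - N \<eta>, \<beta>\<^sub>j]\<close>. For each \<open>k\<close>, type C interpolation at
  \<open>a q\<^bsup>|k|+1\<^esup>\<close> and \<open>x\<^sub>i q\<^bsup>2k\<^sub>i\<^esup>\<close> expands their product so that only the functions of \<open>b\<close> belonging to
  \<open>k\<close> and to the \<open>k + e\<^sub>i\<close> at level \<open>N + 1\<close> appear. The resulting recurrence for the coefficients is a
  type A interpolation. This proves the identity for generic \<open>a\<close>; continuity in \<open>a\<close> removes the
  restriction.
\<close>

section \<open>The theta function\<close>

text \<open>The three-term relation comes from the Jacobi triple product: expanded in bilateral
  series, \<open>\<sigma> (u + v) * \<sigma> (u - v)\<close> is a sum of two products of a function
  of \<open>u\<close> and a function of \<open>v\<close>, and an alternating form of rank two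
  satisfies the Pluecker relation. The nome 0 is computed directly. The logarithmic variables avoid
  choosing the square roots that an odd normalisation of theta requires. They also gather the powers
  of q, a, x_i, b_j lost in this normalisation into one exponent, which is shown to vanish. The
  obstacle to a direct induction is that raising N also shifts a, so the lower levels have
  denominators about which the hypotheses say nothing; hence the detour through generic a. The
  conditions on the x_i involve no a, and those at level N cover all lower levels. The constant of
  proportionality can be read off at b = x: there only the summand k = 0 survives, since for k_i > 0
  the factorial of x_i / b_i vanishes.\<close>

definition gauss_term :: "complex \<Rightarrow> complex \<Rightarrow> int \<Rightarrow> complex" where
  "gauss_term p x i = p powi (i * (i - 1) div 2) * x powi i"

lemma gauss_term_Suc:
  assumes "p \<noteq> 0" "x \<noteq> 0"
  shows "gauss_term p x (i + 1) = p powi i * x * gauss_term p x i"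
proof -
  have "(i + 1) * (i + 1 - 1) div 2 = i * (i - 1) div 2 + i"
  proof -
    have "(i + 1) * (i + 1 - 1) = i * (i - 1) + i * 2" by (simp add: algebra_simps)
    then show ?thesis by simp
  qed
  then show ?thesis
    using assms by (simp add: gauss_term_def power_int_add)
qed

lemma gauss_term_0 [simp]: "gauss_term p x 0 = 1"
  by (simp add: gauss_term_def)

lemma gauss_term_neg_Suc:
  assumes "p \<noteq> 0" "x \<noteq> 0"
  shows "gauss_term p x (- int (Suc n)) = p ^ Suc n / x * gauss_term p x (- int n)"
proof -
  have "gauss_term p x (- int n) = p powi (- int (Suc n)) * x * gauss_term p x (- int (Suc n))"
    using gauss_term_Suc[OF assms, of "- int (Suc n)"] by simp
  moreover have "p powi (- int (Suc n)) = inverse (p ^ Suc n)"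
    by (simp only: power_int_minus power_int_of_nat)
  ultimately show ?thesis using assms by (simp add: field_simps del: power_Suc)
qed

text \<open>The ratio of consecutive terms is \<open>p ^ n\<close> times a constant in both
  directions, with constant \<open>x\<close> upwards and \<open>p / x\<close> downwards. It tends to
  0, so the ratio test applies to each half of the integers.\<close>

lemma gauss_term_summable:
  assumes p: "p \<noteq> 0" "norm p < 1" and x: "x \<noteq> 0"
  shows "(\<lambda>i. norm (gauss_term p x i)) summable_on UNIV"
proof -
  have ratio: "summable (\<lambda>n. norm (f n))"
    if "\<And>n. f (Suc n) = p ^ n * z * f n" for f :: "nat \<Rightarrow> complex" and z
  proof -
    have "(\<lambda>n. norm (p ^ n * z)) \<longlonglongrightarrow> 0"
      using tendsto_mult_left_zero[OF tendsto_norm_zero[OF LIMSEQ_power_zero[OF p(2)]], of "norm z"]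
      by (simp add: norm_mult)
    then have "eventually (\<lambda>n. norm (p ^ n * z) < 1/2) sequentially"
      by (rule order_tendstoD) simp
    then obtain M where M: "\<And>n. n \<ge> M \<Longrightarrow> norm (p ^ n * z) < 1/2"
      by (auto simp: eventually_sequentially)
    show ?thesis
    proof (rule summable_ratio_test[where c = "1/2" and N = M])
      fix n assume "n \<ge> M"
      have "norm (f (Suc n)) = norm (p ^ n * z) * norm (f n)"
        by (simp add: that norm_mult)
      also have "\<dots> \<le> 1/2 * norm (f n)"
        using M[OF \<open>n \<ge> M\<close>] by (intro mult_right_mono) auto
      finally show "norm (norm (f (Suc n))) \<le> 1/2 * norm (norm (f n))" by simp
    qed simp
  qed
  have 1: "summable (\<lambda>n. norm (gauss_term p x (int n)))"
    by (rule ratio[of _ x]) (use gauss_term_Suc[OF p(1) x, of "int n" for n] in \<open>simp add: add.commute\<close>)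
  have 2: "summable (\<lambda>n. norm (gauss_term p x (- int n)))"
    by (rule ratio[of _ "p / x"]) (subst gauss_term_neg_Suc[OF p(1) x], simp)
  have 2: "summable (\<lambda>n. norm (gauss_term p x (- int (Suc n))))"
    using 2 by (subst summable_Suc_iff)
  have 3: "(\<lambda>i. norm (gauss_term p x i)) summable_on range int"
    by (subst summable_on_reindex)
      (auto simp: o_def inj_on_def intro!: norm_summable_imp_summable_on 1)
  have 4: "(\<lambda>i. norm (gauss_term p x i)) summable_on range (\<lambda>n. - int (Suc n))"
    by (subst summable_on_reindex)
      (use 2 in \<open>auto simp: o_def inj_on_def intro!: norm_summable_imp_summable_on\<close>)
  have "range int \<union> range (\<lambda>n. - int (Suc n)) = UNIV"
    by (metis (no_types, lifting) UNIV_eq_I UnCI int_cases rangeI)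
  moreover have "range int \<inter> range (\<lambda>n. - int (Suc n)) = {}" by auto
  ultimately show ?thesis
    using summable_on_Un_disjoint[OF 3 4] by simp
qed

section \<open>Gaussian binomial coefficients and the Jacobi triple product\<close>

definition qfact :: "complex \<Rightarrow> nat \<Rightarrow> complex" where
  "qfact p n = (\<Prod>j<n. 1 - p ^ Suc j)"

lemma power_Suc_neq_1:
  assumes "norm (p :: complex) < 1"
  shows "p ^ Suc j \<noteq> 1"
proof
  assume "p ^ Suc j = 1"
  then have "norm p ^ Suc j = 1" by (metis norm_one norm_power)
  with assms show False
    using power_less_one_iff[of "norm p" "Suc j"] by auto
qed

lemma qfact_nonzero: "norm p < 1 \<Longrightarrow> qfact p n \<noteq> 0"
  using power_Suc_neq_1 by (auto simp: qfact_def simp del: power_Suc)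

text \<open>Induction on \<open>m\<close> by the Pascal rule for Gaussian binomial coefficients in
  base \<open>p\<close>; \<open>qfact p n\<close> is (p; p)_n.\<close>

lemma qbinomial_theorem:
  assumes p: "norm p < 1"
  shows "(\<Prod>j<m. 1 + p ^ j * z) =
    (\<Sum>k\<le>m. p ^ (k choose 2) * (qfact p m / (qfact p k * qfact p (m - k))) * z ^ k)"
proof (induction m)
  case 0
  then show ?case by (simp add: qfact_def numeral_2_eq_2)
next
  case (Suc m)
  \<comment> \<open>The value 0 beyond \<open>m\<close> lets the Pascal rule below include
    \<open>k = m\<close>.\<close>
  define c where "c m k = (if k \<le> m then qfact p m / (qfact p k * qfact p (m - k)) else 0)" for m k
  have Q [simp]: "qfact p k \<noteq> 0" for k by (rule qfact_nonzero[OF p])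
  have Q_Suc: "qfact p (Suc k) = (1 - p ^ Suc k) * qfact p k" for k
    by (simp add: qfact_def)
  have c0: "c m 0 = 1" for m using Q by (simp add: c_def qfact_def[of p 0] del: of_nat_Suc)
  \<comment> \<open>The usual rule has \<open>p ^ (m - k)\<close> in front of the last coefficient.
    It is multiplied by \<open>p ^ k\<close>, a factor that is at hand because
    \<open>Suc k choose 2\<close> exceeds \<open>k choose 2\<close> by \<open>k\<close>.\<close>
  have pascal: "p ^ k * c (Suc m) (Suc k) = p ^ k * c m (Suc k) + p ^ m * c m k" if "k \<le> m" for k
  proof (cases "k = m")
    case True
    have "c m m = 1" for m using Q by (simp add: c_def qfact_def del: Q)
    moreover have "c m (Suc m) = 0" by (simp add: c_def)
    ultimately show ?thesis using True by simp
  next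
    case False
    define d where "d = m - Suc k"
    have m: "m = Suc (k + d)" using False that by (simp add: d_def)
    show ?thesis
      using power_Suc_neq_1[OF p, of k] power_Suc_neq_1[OF p, of d]
      by (simp add: c_def m Q_Suc power_add divide_simps del: power_Suc)
         (simp add: algebra_simps power_add)
  qed
  have ch: "Suc k choose 2 = (k choose 2) + k" for k by (simp add: numeral_2_eq_2)
  have "(\<Prod>j<Suc m. 1 + p ^ j * z) = (\<Sum>k\<le>m. p ^ (k choose 2) * c m k * z ^ k) * (1 + p ^ m * z)"
    using Suc.IH by (simp add: c_def)
  also have "\<dots> = (\<Sum>k\<le>Suc m. p ^ (k choose 2) * c m k * z ^ k)
      + (\<Sum>k\<le>m. p ^ (k choose 2) * c m k * z ^ k * (p ^ m * z))"
    by (simp add: ring_distribs sum_distrib_right c_def)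
  also have "\<dots> = 1 + (\<Sum>k\<le>m. p ^ (k choose 2) * (p ^ k * c m (Suc k) + p ^ m * c m k) * z ^ Suc k)"
    by (subst sum.atMost_Suc_shift)
      (simp add: c0 ch power_add sum.distrib algebra_simps numeral_2_eq_2)
  also have "\<dots> = 1 + (\<Sum>k\<le>m. p ^ (k choose 2) * (p ^ k * c (Suc m) (Suc k)) * z ^ Suc k)"
    by (intro arg_cong2[of _ _ _ _ "(+)"] sum.cong refl) (use pascal in simp)
  also have "\<dots> = (\<Sum>k\<le>Suc m. p ^ (k choose 2) * c (Suc m) k * z ^ k)"
    by (subst sum.atMost_Suc_shift)
      (simp add: c0 ch power_add algebra_simps numeral_2_eq_2)
  also have "\<dots> = (\<Sum>k\<le>Suc m. p ^ (k choose 2) * (qfact p (Suc m) / (qfact p k * qfact p (Suc m - k))) * z ^ k)"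
    by (simp add: c_def)
  finally show ?case .
qed

text \<open>The q-binomial theorem with \<open>2 * n\<close> factors at \<open>x / p ^ n\<close>, so
  that the powers of \<open>p\<close> next to \<open>x\<close> run from -n to n - 1. The factors
  with negative power are inverted by pulling out the monomial
  \<open>gauss_term p x (- int n)\<close>.\<close>

lemma finite_triple_product:
  assumes p: "p \<noteq> 0" "norm p < 1" and x: "x \<noteq> 0"
  shows "(\<Prod>j<n. (1 + p ^ j * x) * (1 + p ^ Suc j / x)) =
    (\<Sum>k\<le>2 * n. qfact p (2 * n) / (qfact p k * qfact p (2 * n - k)) * gauss_term p x (int k - int n))"
proof -
  define z where "z = x / p ^ n"
  have neg: "(\<Prod>j<n. 1 + p ^ Suc j / x) = gauss_term p x (- int n) * (\<Prod>j<n. 1 + x / p ^ Suc j)" for n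
  proof (induction n)
    case (Suc n)
    show ?case
      using Suc.IH p x by (simp only: prod.lessThan_Suc gauss_term_neg_Suc[OF p(1) x]) (simp add: field_simps)
  qed simp
  have trm: "gauss_term p x (- int n) * (p ^ (k choose 2) * z ^ k) = gauss_term p x (int k - int n)" for k
  proof (induction k)
    case (Suc k)
    have ch: "Suc k choose 2 = (k choose 2) + k" by (simp add: numeral_2_eq_2)
    have "gauss_term p x (int (Suc k) - int n) = p powi (int k - int n) * x * gauss_term p x (int k - int n)"
      using gauss_term_Suc[OF p(1) x, of "int k - int n"] by (simp add: algebra_simps)
    also have "\<dots> = p ^ k * z * gauss_term p x (int k - int n)"
      using p by (simp add: power_int_diff z_def)
    finally show ?case by (simp add: Suc.IH[symmetric] ch power_add)
  qed (simp add: numeral_2_eq_2)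
  have "(\<Prod>j<2*n. 1 + p ^ j * z) = (\<Prod>j<n. 1 + p ^ j * z) * (\<Prod>j<n. 1 + p ^ (j + n) * z)"
  proof -
    have "(\<Prod>j<n+m. 1 + p ^ j * z) = (\<Prod>j<n. 1 + p ^ j * z) * (\<Prod>j<m. 1 + p ^ (j + n) * z)" for m
      by (induction m) (simp_all add: add.commute mult_ac)
    then show ?thesis by (simp add: mult_2)
  qed
  also have "(\<Prod>j<n. 1 + p ^ j * z) = (\<Prod>j<n. 1 + x / p ^ Suc j)"
  proof (rule prod.reindex_bij_witness[where i = "\<lambda>j. n - Suc j" and j = "\<lambda>j. n - Suc j"])
    fix j assume "j \<in> {..<n}"
    then have "p ^ n = p ^ j * p ^ Suc (n - Suc j)" by (simp flip: power_add power_Suc)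
    then show "1 + x / p ^ Suc (n - Suc j) = 1 + p ^ j * z"
      using p by (simp add: z_def)
  qed auto
  also have "(\<Prod>j<n. 1 + p ^ (j + n) * z) = (\<Prod>j<n. 1 + p ^ j * x)"
    using p by (intro prod.cong) (simp_all add: z_def power_add)
  finally have "(\<Prod>j<n. (1 + p ^ j * x) * (1 + p ^ Suc j / x)) = gauss_term p x (- int n) * (\<Prod>j<2*n. 1 + p ^ j * z)"
    by (simp only: prod.distrib neg mult_ac)
  also have "\<dots> = (\<Sum>k\<le>2*n. qfact p (2 * n) / (qfact p k * qfact p (2 * n - k)) *
      (gauss_term p x (- int n) * (p ^ (k choose 2) * z ^ k)))"
    unfolding qbinomial_theorem[OF p(2)] sum_distrib_left by (intro sum.cong refl) (simp only: mult_ac)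
  finally show ?thesis by (simp only: trm)
qed

lemma theta_factor_bound:
  fixes p x :: complex
  assumes "norm p < 1"
  shows "norm ((1 - p ^ j * x) * (1 - p ^ (j + 1) / x) - 1) \<le> (norm x + norm (p / x) + norm p) * norm p ^ j"
proof -
  \<comment> \<open>At \<open>x = 0\<close> the quotient \<open>p ^ (j + 1) / x\<close> is 0, so the
    cross term of the expanded product must disappear; \<open>e\<close> switches it off.\<close>
  define e where "e = (if x = 0 then 0 else p ^ j)"
  have "(1 - p ^ j * x) * (1 - p ^ (j + 1) / x) - 1 = - x * p ^ j - p / x * p ^ j + (p * e) * p ^ j"
    by (cases "x = 0") (simp_all add: e_def field_simps power2_eq_square)
  also have "norm \<dots> \<le> norm x * norm p ^ j + norm (p / x) * norm p ^ j + norm p * norm p ^ j"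
  proof (intro norm_triangle_mono)
    show "norm (- x * p ^ j - p / x * p ^ j) \<le> norm x * norm p ^ j + norm (p / x) * norm p ^ j"
      by (rule norm_triangle_le_diff) (simp add: norm_mult norm_power norm_divide)
    have "norm e \<le> 1" using assms by (simp add: e_def norm_power power_le_one)
    then have "norm p * norm e * norm (p ^ j) \<le> norm p * 1 * norm (p ^ j)"
      by (intro mult_right_mono mult_left_mono) auto
    then show "norm (p * e * p ^ j) \<le> norm p * norm p ^ j"
      by (simp add: norm_mult norm_power)
  qed
  finally show ?thesis by (simp add: algebra_simps)
qed

lemma theta_factors_summable:
  fixes p x :: complex
  assumes "norm p < 1"
  shows "summable (\<lambda>j. norm ((1 - p ^ j * x) * (1 - p ^ (j + 1) / x) - 1))"
proof (rule summable_comparison_test'[where N = 0])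
  show "summable (\<lambda>j. (norm x + norm (p / x) + norm p) * norm p ^ j)"
    using assms by (intro summable_mult summable_geometric) auto
qed (use theta_factor_bound[OF assms] in simp)

lemma theta_convergent:
  fixes p x :: complex
  assumes "norm p < 1"
  shows "convergent_prod (\<lambda>j. (1 - p ^ j * x) * (1 - p ^ (j + 1) / x))"
  by (rule abs_convergent_prod_imp_convergent_prod[OF summable_imp_abs_convergent_prod[OF
      theta_factors_summable[OF assms]]])

lemma theta_LIMSEQ:
  assumes "norm p < 1"
  shows "(\<lambda>n. \<Prod>j<n. (1 - p ^ j * x) * (1 - p ^ (j + 1) / x)) \<longlonglongrightarrow> theta p x"
  using convergent_prod_LIMSEQ[OF theta_convergent[OF assms, of x]]
  by (subst (asm) lessThan_Suc_atMost[symmetric], subst (asm) filterlim_sequentially_Suc)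
    (simp add: theta_def)

lemma qfact_LIMSEQ:
  assumes "norm p < 1"
  obtains L where "qfact p \<longlonglongrightarrow> L" "L \<noteq> 0"
proof -
  have "summable (\<lambda>j. norm ((1 - p ^ Suc j) - 1))"
    using assms by (simp add: norm_mult norm_power summable_mult summable_geometric)
  then have c: "convergent_prod (\<lambda>j. 1 - p ^ Suc j)"
    by (intro abs_convergent_prod_imp_convergent_prod summable_imp_abs_convergent_prod)
  have "(\<lambda>n. qfact p (Suc n)) \<longlonglongrightarrow> (\<Prod>j. 1 - p ^ Suc j)"
    using convergent_prod_LIMSEQ[OF c] by (simp add: qfact_def lessThan_Suc_atMost)
  then have "qfact p \<longlonglongrightarrow> (\<Prod>j. 1 - p ^ Suc j)"
    by (subst (asm) filterlim_sequentially_Suc)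
  moreover have "(\<Prod>j. 1 - p ^ Suc j) \<noteq> 0"
    by (rule prodinf_nonzero[OF c]) (use power_Suc_neq_1[OF assms] in \<open>metis eq_iff_diff_eq_0\<close>)
  ultimately show ?thesis using that by blast
qed

definition gauss_sum :: "complex \<Rightarrow> complex \<Rightarrow> complex" where
  "gauss_sum p x = (\<Sum>\<^sub>\<infinity>i. gauss_term p x i)"

text \<open>The limit of \<open>finite_triple_product\<close>: each coefficient tends to
  \<open>1 / L\<close>, where \<open>L\<close> is the limit of (p; p)_n, and all coefficients share
  one bound, so Tannery's theorem permits the termwise limit.\<close>

lemma jacobi_triple_product:
  assumes p: "p \<noteq> 0" "norm p < 1"
  shows "\<exists>c. \<forall>x. x \<noteq> 0 \<longrightarrow> theta p x = c * gauss_sum p (- x)"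
proof -
  obtain L where L: "qfact p \<longlonglongrightarrow> L" "L \<noteq> 0" using qfact_LIMSEQ[OF p(2)] .
  have Q: "qfact p k \<noteq> 0" for k by (rule qfact_nonzero[OF p(2)])
  obtain A where A: "\<And>n. norm (qfact p n) \<le> A"
    using convergent_imp_bounded[OF L(1)] by (auto simp: bounded_iff)
  have "(\<lambda>n. inverse (qfact p n)) \<longlonglongrightarrow> inverse L" using L by (intro tendsto_inverse)
  from convergent_imp_bounded[OF this] obtain B where B: "\<And>n. norm (inverse (qfact p n)) \<le> B"
    by (auto simp: bounded_iff)
  have A0: "0 \<le> A" "0 \<le> B" using A[of 0] B[of 0] norm_ge_zero order_trans by blast+
  \<comment> \<open>The coefficient of the \<open>i\<close>-th monomial in the finite product,
    extended by 0 so that all finite sums become series over the same index set.\<close>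
  define c where "c n i = (if \<bar>i\<bar> \<le> int n
    then qfact p (2 * n) / (qfact p (nat (int n + i)) * qfact p (nat (int n - i))) else 0)" for n i
  have c_bound: "norm (c n i) \<le> A * (B * B)" for n i
  proof (cases "\<bar>i\<bar> \<le> int n")
    case True
    have "norm (c n i) = norm (qfact p (2 * n)) * (norm (inverse (qfact p (nat (int n + i)))) *
        norm (inverse (qfact p (nat (int n - i)))))"
      using True by (simp add: c_def norm_mult norm_divide norm_inverse divide_inverse)
    also have "\<dots> \<le> A * (B * B)"
      by (intro mult_mono A B mult_nonneg_nonneg) (use A0 in auto)
    finally show ?thesis .
  qed (use A0 in \<open>auto simp: c_def\<close>)
  have c_lim: "(\<lambda>n. c n i) \<longlonglongrightarrow> inverse L" for i
  proof -
    have 1: "(\<lambda>n. qfact p (nat (int n + i))) \<longlonglongrightarrow> L" "(\<lambda>n. qfact p (nat (int n - i))) \<longlonglongrightarrow> L"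
      "(\<lambda>n. qfact p (2 * n)) \<longlonglongrightarrow> L"
      by (rule filterlim_compose[OF L(1)], unfold filterlim_at_top eventually_sequentially,
        rule allI, rule_tac x = "Z + nat \<bar>i\<bar>" in exI, force)+
    have "(\<lambda>n. qfact p (2 * n) / (qfact p (nat (int n + i)) * qfact p (nat (int n - i)))) \<longlonglongrightarrow> L / (L * L)"
      using L(2) by (intro tendsto_intros 1) auto
    then have "(\<lambda>n. qfact p (2 * n) / (qfact p (nat (int n + i)) * qfact p (nat (int n - i)))) \<longlonglongrightarrow> inverse L"
      using L(2) by (simp add: field_simps)
    moreover have "eventually (\<lambda>n. qfact p (2 * n) / (qfact p (nat (int n + i)) * qfact p (nat (int n - i))) = c n i) sequentially"
      using eventually_ge_at_top[of "nat \<bar>i\<bar>"] by eventually_elim (auto simp: c_def)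
    ultimately show ?thesis by (rule Lim_transform_eventually)
  qed
  have "theta p x = inverse L * gauss_sum p (- x)" if x: "x \<noteq> 0" for x
  proof -
    let ?T = "gauss_term p (- x)"
    \<comment> \<open>Tannery's theorem concerns series over the naturals, hence this enumeration of
      the integers.\<close>
    have bij: "bij_betw int_decode UNIV UNIV" by (rule bij_int_decode)
    have sT: "(\<lambda>i. norm (?T i)) summable_on UNIV" by (rule gauss_term_summable) (use p x in auto)
    have sT': "summable (\<lambda>k. norm (?T (int_decode k)))"
      using sT unfolding summable_on_reindex_bij_betw[OF bij, symmetric]
      by (rule summable_on_imp_summable)
    have fin: "(\<Sum>k. ?T (int_decode k) * c n (int_decode k)) =
        (\<Prod>j<n. (1 - p ^ j * x) * (1 - p ^ (j + 1) / x))" for n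
    proof -
      have "(\<Sum>k. ?T (int_decode k) * c n (int_decode k)) =
          (\<Sum>k\<in>int_decode -` {- int n..int n}. ?T (int_decode k) * c n (int_decode k))"
        by (rule suminf_finite) (auto simp: c_def intro!: finite_vimageI inj_int_decode)
      also have "\<dots> = (\<Sum>i\<in>{- int n..int n}. ?T i * c n i)"
        by (rule sum.reindex_bij_betw[where h = int_decode])
          (auto simp: bij_betw_def inj_int_decode intro!: inj_on_subset[OF inj_int_decode] surj_image_vimage_eq simp: surj_int_decode)
      also have "\<dots> = (\<Sum>k\<le>2 * n. ?T (int k - int n) * c n (int k - int n))"
        by (rule sum.reindex_bij_witness[where j = "\<lambda>i. nat (i + int n)" and i = "\<lambda>k. int k - int n"]) auto
      also have "\<dots> = (\<Sum>k\<le>2 * n. qfact p (2 * n) / (qfact p k * qfact p (2 * n - k)) * ?T (int k - int n))"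
      proof (intro sum.cong refl)
        fix k assume "k \<in> {..2 * n}"
        then have "\<bar>int k - int n\<bar> \<le> int n" "nat (int n + (int k - int n)) = k" "nat (int n - (int k - int n)) = 2 * n - k"
          by auto
        then show "?T (int k - int n) * c n (int k - int n) =
            qfact p (2 * n) / (qfact p k * qfact p (2 * n - k)) * ?T (int k - int n)"
          by (simp only: c_def if_True mult.commute)
      qed
      also have "\<dots> = (\<Prod>j<n. (1 + p ^ j * (- x)) * (1 + p ^ Suc j / (- x)))"
        by (rule finite_triple_product[symmetric]) (use p x in auto)
      finally show ?thesis by simp
    qed
    have "(\<lambda>n. \<Sum>k. ?T (int_decode k) * c n (int_decode k)) \<longlonglongrightarrow> (\<Sum>k. ?T (int_decode k) * inverse L)"
    proof (rule tannerys_theorem[THEN conjunct2, THEN conjunct2])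
      show "summable (\<lambda>k. norm (?T (int_decode k)) * (A * (B * B)))"
        by (rule summable_mult2[OF sT'])
      show "\<forall>\<^sub>F (k, n) in sequentially \<times>\<^sub>F sequentially.
          norm (?T (int_decode k) * c n (int_decode k)) \<le> norm (?T (int_decode k)) * (A * (B * B))"
        by (auto simp: norm_mult intro!: always_eventually mult_left_mono c_bound)
    qed (auto intro!: tendsto_intros c_lim)
    then have "theta p x = (\<Sum>k. ?T (int_decode k) * inverse L)"
      unfolding fin using theta_LIMSEQ[OF p(2)] LIMSEQ_unique by blast
    also have "\<dots> = (\<Sum>k. ?T (int_decode k)) * inverse L"
      by (rule suminf_mult2[symmetric]) (rule summable_norm_cancel[OF sT'])
    also have "(\<Sum>k. ?T (int_decode k)) = (\<Sum>\<^sub>\<infinity>k. ?T (int_decode k))"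
      by (rule infsumI[symmetric], rule norm_summable_imp_has_sum[OF sT' summable_sums[OF summable_norm_cancel[OF sT']]])
    also have "\<dots> = gauss_sum p (- x)"
      unfolding gauss_sum_def by (rule infsum_reindex_bij_betw[OF bij])
    finally show ?thesis by simp
  qed
  then show ?thesis by blast
qed

text \<open>The right-hand side has rank two: it splits the double sum over \<open>(m, n)\<close> by the parity
  of \<open>m + n\<close>, substituting \<open>m + n = 2 s\<close> or \<open>2 s + 1\<close>.\<close>

lemma gauss_sum_mult:
  assumes p: "p \<noteq> 0" "norm p < 1" and x: "x \<noteq> 0" and y: "y \<noteq> 0"
  shows "gauss_sum p (- x * y) * gauss_sum p (- x / y) =
    gauss_sum (p^2) (x^2) * gauss_sum (p^2) (p * y^2)
    - x * gauss_sum (p^2) (p * x^2) * (y * gauss_sum (p^2) (p^2 * y^2))"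
proof -
  let ?T = gauss_term and ?A = "range (\<lambda>(s :: int, d). (s + d, s - d))" and ?B = "range (\<lambda>(s :: int, d). (s + d + 1, s - d))"
  have p2: "p^2 \<noteq> 0" "norm (p^2) < 1" using p by (simp_all add: norm_power power_less_one_iff)
  have powi_pair: "u powi (s + d) * v powi (s - d) = (u * v) powi s * (u / v) powi d"
    if "u \<noteq> 0" "v \<noteq> 0" for u v :: complex and s d
    using that by (simp add: power_int_add power_int_diff power_int_mult_distrib power_int_divide_distrib)
  have p_split1: "p powi (2 * A + 2 * B + d) = (p^2) powi A * (p^2) powi B * p powi d" for A B d
    using p by (simp add: power_int_add power_int_mult)
  have p_split2: "p powi (2 * A + s + 2 * B + 2 * d) = (p^2) powi A * p powi s * (p^2) powi B * (p^2) powi d" for A B s d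
    using p by (simp add: power_int_add power_int_mult)
  have prod_sum: "(\<lambda>z. norm (case z of (m, n) \<Rightarrow> ?T r u m * ?T r v n)) summable_on UNIV"
      "(\<Sum>\<^sub>\<infinity>(m, n). ?T r u m * ?T r v n) = gauss_sum r u * gauss_sum r v"
    if r: "r \<noteq> 0" "norm r < 1" "u \<noteq> 0" "v \<noteq> 0" for r u v
  proof -
    have s: "(\<lambda>i. norm (?T r u i)) summable_on UNIV" "(\<lambda>i. norm (?T r v i)) summable_on UNIV"
      using gauss_term_summable r by auto
    have "(\<lambda>z. norm (case z of (m, n) \<Rightarrow> ?T r u m * ?T r v n)) summable_on UNIV \<times> UNIV"
      by (rule Infinite_Sum.abs_summable_on_Sigma_iff[THEN iffD2])
        (simp add: norm_mult s summable_on_cmult_right summable_on_cmult_left infsum_cmult_right' abs_mult infsum_nonneg)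
    then show a: "(\<lambda>z. norm (case z of (m, n) \<Rightarrow> ?T r u m * ?T r v n)) summable_on UNIV" by simp
    have "(\<Sum>\<^sub>\<infinity>(m, n)\<in>UNIV \<times> UNIV. ?T r u m * ?T r v n) = (\<Sum>\<^sub>\<infinity>m. \<Sum>\<^sub>\<infinity>n. ?T r u m * ?T r v n)"
      by (subst infsum_Sigma_banach[symmetric]) (use abs_summable_summable[OF a] in auto)
    also have "\<dots> = gauss_sum r u * gauss_sum r v"
      by (simp add: infsum_cmult_right' infsum_cmult_left' gauss_sum_def)
    finally show "(\<Sum>\<^sub>\<infinity>(m, n). ?T r u m * ?T r v n) = gauss_sum r u * gauss_sum r v" by simp
  qed
  let ?F = "\<lambda>(m, n). ?T p (- x * y) m * ?T p (- x / y) n"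
  have sF: "?F summable_on UNIV"
    by (rule abs_summable_summable, rule prod_sum) (use p x y in auto)
  have AB: "?A \<union> ?B = UNIV" "?A \<inter> ?B = {}"
  proof -
    have "(m, n) \<in> ?A \<union> ?B" for m n :: int
    proof (cases "even (m + n)")
      case True
      then obtain s where s: "m + n = 2 * s" by (elim evenE)
      have "(m, n) = (\<lambda>(s, d). (s + d, s - d)) (s, m - s)" using s by auto
      then show ?thesis by blast
    next
      case False
      then obtain s where s: "m + n = 2 * s + 1" by (elim oddE)
      have "(m, n) = (\<lambda>(s, d). (s + d + 1, s - d)) (s, m - s - 1)" using s by auto
      then show ?thesis by blast
    qed
    then have "\<forall>z. z \<in> ?A \<union> ?B" by (simp only: split_paired_All simp_thms)
    then show "?A \<union> ?B = UNIV" by (intro UNIV_eq_I[symmetric]) (erule spec)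
    have "even (fst z + snd z)" if "z \<in> ?A" for z using that by auto
    moreover have "odd (fst z + snd z)" if "z \<in> ?B" for z using that by auto
    ultimately show "?A \<inter> ?B = {}" by blast
  qed
  have "gauss_sum p (- x * y) * gauss_sum p (- x / y) = infsum ?F UNIV"
    using prod_sum(2)[OF p, of "- x * y" "- x / y"] x y by simp
  also have "\<dots> = infsum ?F ?A + infsum ?F ?B"
  proof -
    have "infsum ?F (?A \<union> ?B) = infsum ?F ?A + infsum ?F ?B"
      by (rule infsum_Un_disjoint[OF _ _ AB(2)]) (rule summable_on_subset_banach[OF sF subset_UNIV])+
    then show ?thesis unfolding AB(1) .
  qed
  also have "infsum ?F ?A = (\<Sum>\<^sub>\<infinity>(s, d). ?T (p^2) (x^2) s * ?T (p^2) (p * y^2) d)"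
  proof (subst infsum_reindex)
    show "inj (\<lambda>(s::int, d). (s + d, s - d))" by (auto simp: inj_on_def)
    have "?T p (- x * y) (s + d) * ?T p (- x / y) (s - d) = ?T (p^2) (x^2) s * ?T (p^2) (p * y^2) d" for s d
    proof -
      have e: "(s + d) * (s + d - 1) div 2 + (s - d) * (s - d - 1) div 2 = 2 * (s * (s - 1) div 2) + 2 * (d * (d - 1) div 2) + d"
      proof -
        \<comment> \<open>Doubling the equation removes the integer divisions, since each
          \<open>i * (i - 1)\<close> is even.\<close>
        have ev: "even (i * (i - 1))" for i :: int by simp
        have "2 * ((s + d) * (s + d - 1) div 2 + (s - d) * (s - d - 1) div 2) = 2 * (2 * (s * (s - 1) div 2) + 2 * (d * (d - 1) div 2) + d)"
          unfolding distrib_left by (simp only: dvd_mult_div_cancel ev) (simp add: algebra_simps)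
        then show ?thesis by simp
      qed
      have "?T p (- x * y) (s + d) * ?T p (- x / y) (s - d) =
        p powi ((s + d) * (s + d - 1) div 2 + (s - d) * (s - d - 1) div 2) * ((- x * y) powi (s + d) * (- x / y) powi (s - d))"
        using p by (simp add: gauss_term_def power_int_add)
      also have "(- x * y) powi (s + d) * (- x / y) powi (s - d) = (x^2) powi s * (y^2) powi d"
      proof -
        have "(- x * y) powi (s + d) * (- x / y) powi (s - d) = ((- x * y) * (- x / y)) powi s * ((- x * y) / (- x / y)) powi d"
          using powi_pair[of "- x * y" "- x / y" s d] x y by simp
        moreover have "(- x * y) * (- x / y) = x^2" "(- x * y) / (- x / y) = y^2"
          using x y by (simp_all add: power2_eq_square)
        ultimately show ?thesis by (simp only:)
      qed
      finally show ?thesis unfolding e p_split1 gauss_term_def power_int_mult_distrib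
        by (simp only: mult_ac)
    qed
    then show "infsum (?F \<circ> (\<lambda>(s, d). (s + d, s - d))) UNIV = (\<Sum>\<^sub>\<infinity>(s, d). ?T (p^2) (x^2) s * ?T (p^2) (p * y^2) d)"
      by (intro infsum_cong) auto
  qed
  also have "\<dots> = gauss_sum (p^2) (x^2) * gauss_sum (p^2) (p * y^2)"
    by (rule prod_sum) (use p p2 x y in auto)
  also have "infsum ?F ?B = (\<Sum>\<^sub>\<infinity>(s, d). - (x * y) * (case (s, d) of (s, d) \<Rightarrow> ?T (p^2) (p * x^2) s * ?T (p^2) (p^2 * y^2) d))"
  proof (subst infsum_reindex)
    show "inj (\<lambda>(s::int, d). (s + d + 1, s - d))" by (auto simp: inj_on_def)
    have "?T p (- x * y) (s + d + 1) * ?T p (- x / y) (s - d) = - (x * y) * (?T (p^2) (p * x^2) s * ?T (p^2) (p^2 * y^2) d)" for s d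
    proof -
      have e: "(s + d + 1) * (s + d + 1 - 1) div 2 + (s - d) * (s - d - 1) div 2 = 2 * (s * (s - 1) div 2) + s + 2 * (d * (d - 1) div 2) + 2 * d"
      proof -
        have ev: "even (i * (i - 1))" for i :: int by simp
        have "2 * ((s + d + 1) * (s + d + 1 - 1) div 2 + (s - d) * (s - d - 1) div 2) = 2 * (2 * (s * (s - 1) div 2) + s + 2 * (d * (d - 1) div 2) + 2 * d)"
          unfolding distrib_left by (simp only: dvd_mult_div_cancel ev) (simp add: algebra_simps)
        then show ?thesis by simp
      qed
      have "?T p (- x * y) (s + d + 1) * ?T p (- x / y) (s - d) =
        p powi ((s + d + 1) * (s + d + 1 - 1) div 2 + (s - d) * (s - d - 1) div 2) * ((- x * y) powi (s + d + 1) * (- x / y) powi (s - d))"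
        using p by (simp add: gauss_term_def power_int_add)
      also have "(- x * y) powi (s + d + 1) * (- x / y) powi (s - d) = - (x * y) * ((x^2) powi s * (y^2) powi d)"
      proof -
        have "(- x * y) powi (s + d + 1) * (- x / y) powi (s - d) = (- x * y) * (((- x * y) * (- x / y)) powi s * ((- x * y) / (- x / y)) powi d)"
          using powi_pair[of "- x * y" "- x / y" s d] x y by (simp add: power_int_add mult_ac)
        moreover have "(- x * y) * (- x / y) = x^2" "(- x * y) / (- x / y) = y^2"
          using x y by (simp_all add: power2_eq_square)
        ultimately show ?thesis by (simp only: mult_minus_left)
      qed
      finally show ?thesis unfolding e p_split2 gauss_term_def power_int_mult_distrib
        by (simp only: mult_ac mult_minus_left mult_minus_right)
    qed
    then show "infsum (?F \<circ> (\<lambda>(s, d). (s + d + 1, s - d))) UNIV =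
      (\<Sum>\<^sub>\<infinity>(s, d). - (x * y) * (case (s, d) of (s, d) \<Rightarrow> ?T (p^2) (p * x^2) s * ?T (p^2) (p^2 * y^2) d))"
      by (intro infsum_cong) auto
  qed
  also have "\<dots> = - (x * y) * (\<Sum>\<^sub>\<infinity>(s, d). ?T (p^2) (p * x^2) s * ?T (p^2) (p^2 * y^2) d)"
    by (subst infsum_cmult_right'[symmetric]) (simp add: case_prod_unfold)
  also have "(\<Sum>\<^sub>\<infinity>(s, d). ?T (p^2) (p * x^2) s * ?T (p^2) (p^2 * y^2) d) = gauss_sum (p^2) (p * x^2) * gauss_sum (p^2) (p^2 * y^2)"
    by (rule prod_sum) (use p p2 x y in auto)
  finally show ?thesis by (simp add: algebra_simps)
qed

section \<open>Inversion, zeros and continuity of theta\<close>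

lemma theta_inverse:
  assumes p: "norm p < 1" and x: "x \<noteq> 0"
  shows "theta p (1 / x) = - theta p x / x"
proof -
  let ?P = "\<lambda>n x. \<Prod>j<n. (1 - p ^ j * x) * (1 - p ^ (j + 1) / x)"
  \<comment> \<open>Inverting \<open>x\<close> shifts the index of half of the factors by one, so
    the two partial products differ only by their end factors; these have the limits
    \<open>x\<close> and 1.\<close>
  have "?P n (1 / x) * (x - p ^ n) = - ?P n x * (1 - p ^ n * x)" for n
  proof (induction n)
    case (Suc n)
    have "?P (Suc n) (1 / x) * (x - p ^ Suc n) = (?P n (1 / x) * (x - p ^ n)) * ((1 - p ^ Suc n * x) * (1 - p ^ Suc n / x))"
      using x by (simp add: field_simps)
    also have "\<dots> = - ?P (Suc n) x * (1 - p ^ Suc n * x)"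
      unfolding Suc.IH by (simp add: mult_ac)
    finally show ?case .
  qed (use x in \<open>simp add: field_simps\<close>)
  then have eq: "(\<lambda>n. ?P n (1 / x) * (x - p ^ n)) = (\<lambda>n. - ?P n x * (1 - p ^ n * x))" by simp
  have pn: "(\<lambda>n. p ^ n) \<longlonglongrightarrow> 0" by (rule LIMSEQ_power_zero[OF p])
  have "(\<lambda>n. ?P n (1 / x) * (x - p ^ n)) \<longlonglongrightarrow> theta p (1 / x) * (x - 0)"
    by (intro tendsto_intros theta_LIMSEQ p pn)
  moreover have "(\<lambda>n. - ?P n x * (1 - p ^ n * x)) \<longlonglongrightarrow> - theta p x * (1 - 0 * x)"
    by (intro tendsto_intros theta_LIMSEQ p pn)
  ultimately have "theta p (1 / x) * (x - 0) = - theta p x * (1 - 0 * x)"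
    unfolding eq by (rule LIMSEQ_unique)
  then show ?thesis using x by (simp add: field_simps)
qed

text \<open>A convergent infinite product vanishes only if one of its factors does.\<close>

lemma theta_zero_imp:
  assumes p: "norm p < 1" and x: "x \<noteq> 0" and 0: "theta p x = 0"
  shows "\<exists>n::int. x = p powi n"
proof -
  have "\<exists>j. (1 - p ^ j * x) * (1 - p ^ (j + 1) / x) = 0"
    using prodinf_nonzero[OF theta_convergent[OF p, of x]] 0 by (auto simp: theta_def)
  then obtain j where "1 - p ^ j * x = 0 \<or> 1 - p ^ (j + 1) / x = 0" by auto
  then have "p ^ j * x = 1 \<or> p ^ (j + 1) = x" using x by (auto simp: field_simps)
  then show ?thesis
  proof
    assume "p ^ j * x = 1"
    moreover from this have "p ^ j \<noteq> 0" by (metis mult_zero_left zero_neq_one)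
    ultimately have "x = inverse (p ^ j)" by (simp add: field_simps del: power_eq_0_iff)
    then have "x = p powi (- int j)" by (simp add: power_int_minus)
    then show ?thesis ..
  next
    assume "p ^ (j + 1) = x"
    then have "x = p powi int (j + 1)" unfolding power_int_of_nat by simp
    then show ?thesis ..
  qed
qed

text \<open>The ball of radius |x| / 2 about \<open>x\<close> stays away from 0. There
  \<open>theta_factor_bound\<close> yields one geometric majorant for all points, so the partial
  products converge uniformly.\<close>

lemma isCont_theta:
  assumes p: "norm p < 1" and x: "x \<noteq> 0"
  shows "isCont (theta p) x"
proof -
  define e where "e = norm x / 2"
  have e: "e > 0" using x by (simp add: e_def)
  have nz: "norm y \<ge> e" if "y \<in> cball x e" for y
    using that norm_triangle_ineq2[of x y] by (simp add: e_def dist_norm)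
  then have nz': "y \<noteq> 0" if "y \<in> cball x e" for y using that e by fastforce
  have x_e: "\<not> norm x \<le> e" using x by (simp add: e_def)
  let ?f = "\<lambda>j y. (1 - p ^ j * y) * (1 - p ^ (j + 1) / y)"
  have "uniformly_convergent_on (cball x e) (\<lambda>N y. \<Prod>j<N. ?f j y)"
  proof (rule uniformly_convergent_on_prod')
    show "uniformly_convergent_on (cball x e) (\<lambda>N y. \<Sum>j<N. norm (?f j y - 1))"
    proof (rule Weierstrass_m_test'_ev)
      define M where "M = norm x + e + norm p / e + norm p"
      show "summable (\<lambda>j. M * norm p ^ j)"
        using p by (intro summable_mult summable_geometric) auto
      show "\<forall>\<^sub>F j in sequentially. \<forall>y\<in>cball x e. norm (norm (?f j y - 1)) \<le> M * norm p ^ j"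
      proof (intro always_eventually allI ballI)
        fix j y assume y: "y \<in> cball x e"
        have ny: "norm y \<le> norm x + e" using y norm_triangle_ineq2[of y x] by (simp add: dist_norm norm_minus_commute)
        have "norm (?f j y - 1) \<le> (norm y + norm (p / y) + norm p) * norm p ^ j"
          by (rule theta_factor_bound[OF p])
        also have "\<dots> \<le> M * norm p ^ j"
          unfolding M_def norm_divide using ny nz[OF y] e
          by (intro mult_right_mono add_mono divide_left_mono mult_pos_pos) (auto intro: less_le_trans)
        finally show "norm (norm (?f j y - 1)) \<le> M * norm p ^ j" by simp
      qed
    qed
  qed (use nz' x_e in \<open>auto intro!: continuous_intros\<close>)
  then have "uniform_limit (cball x e) (\<lambda>N y. \<Prod>j<N. ?f j y) (\<lambda>y. lim (\<lambda>N. \<Prod>j<N. ?f j y)) sequentially"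
    by (simp add: uniformly_convergent_uniform_limit_iff)
  moreover have "lim (\<lambda>N. \<Prod>j<N. ?f j y) = theta p y" for y
    using theta_LIMSEQ[OF p] by (rule limI)
  ultimately have "uniform_limit (cball x e) (\<lambda>N y. \<Prod>j<N. ?f j y) (theta p) sequentially" by simp
  then have "continuous_on (cball x e) (theta p)"
    by (rule uniform_limit_theorem[rotated])
      (use nz' x_e in \<open>auto intro!: always_eventually continuous_intros\<close>)
  then show ?thesis
    using e by (metis centre_in_ball continuous_on_interior interior_cball)
qed

section \<open>The odd theta function and its three-term relation\<close>

definition odd_theta :: "complex \<Rightarrow> complex \<Rightarrow> complex" where
  "odd_theta p w = exp (- w) * theta p (exp (2 * w))"

text \<open>The prefactor \<open>exp (- w)\<close> is a square root of
  \<open>1 / exp (2 * w)\<close>; it absorbs the factor \<open>1 / x\<close> of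
  \<open>theta_inverse\<close> and leaves the sign.\<close>

lemma odd_theta_minus:
  assumes "norm p < 1"
  shows "odd_theta p (- w) = - odd_theta p w"
proof -
  have e: "exp (2 * w) = exp w * exp w" by (simp only: mult_2 exp_add)
  have "exp (2 * (- w)) = 1 / exp (2 * w)"
    by (simp only: mult_minus_right exp_minus inverse_eq_divide)
  then have "theta p (exp (2 * (- w))) = - theta p (exp (2 * w)) / exp (2 * w)"
    using theta_inverse[OF assms, of "exp (2 * w)"] by simp
  then show ?thesis
    unfolding odd_theta_def minus_minus exp_minus[of w] by (simp only: e) (simp add: field_simps)
qed

lemma theta_zero_nome [simp]: "theta 0 x = 1 - x"
proof -
  have "(\<lambda>n. \<Prod>j<Suc n. (1 - 0 ^ j * x) * (1 - 0 ^ (j + 1) / x)) \<longlonglongrightarrow> theta 0 x"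
    using theta_LIMSEQ[of 0 x] by (subst filterlim_sequentially_Suc) simp
  moreover have "(\<Prod>j<Suc n. (1 - 0 ^ j * x) * (1 - 0 ^ (j + 1) / x)) = 1 - x" for n
    by (subst prod.lessThan_Suc_shift) simp
  ultimately have "(\<lambda>n. 1 - x) \<longlonglongrightarrow> theta 0 x" by simp
  from LIMSEQ_unique[OF this tendsto_const] show ?thesis by simp
qed

text \<open>For nonzero \<open>p\<close> this is \<open>gauss_sum_mult\<close> in exponential
  variables. For \<open>p = 0\<close> the function is -2 sinh, and the product-to-sum formula
  separates \<open>u\<close> from \<open>v\<close>.\<close>

lemma odd_theta_rank_two:
  assumes p: "norm p < 1"
  shows "\<exists>A B C D. \<forall>u v. odd_theta p (u + v) * odd_theta p (u - v) = A u * B v + C u * D v"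
proof (cases "p = 0")
  case True
  have "odd_theta 0 (u + v) * odd_theta 0 (u - v) = (exp (- 2 * u) + exp (2 * u)) * 1 + (- 1) * (exp (- 2 * v) + exp (2 * v))" for u v
  proof -
    have "odd_theta 0 w = exp (- w) - exp w" for w
      by (simp add: odd_theta_def right_diff_distrib mult_exp_exp)
    moreover have "- (u + v) + - (u - v) = - 2 * u" "- (u + v) + (u - v) = - 2 * v"
      "u + v + - (u - v) = 2 * v" "u + v + (u - v) = 2 * u" by simp_all
    ultimately show ?thesis by (simp only: left_diff_distrib right_diff_distrib mult_exp_exp) simp
  qed
  then show ?thesis
    by (intro exI[of _ "\<lambda>u. exp (- 2 * u) + exp (2 * u)"] exI[of _ "\<lambda>_. 1"] exI[of _ "\<lambda>_. - 1"]
      exI[of _ "\<lambda>v. exp (- 2 * v) + exp (2 * v)"] allI) (simp add: True)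
next
  case False
  obtain c where c: "\<And>x. x \<noteq> 0 \<Longrightarrow> theta p x = c * gauss_sum p (- x)"
    using jacobi_triple_product[OF False p] by auto
  define A B C D where "A u = c^2 * exp (- 2 * u) * gauss_sum (p^2) ((exp (2 * u))^2)"
    and "B v = gauss_sum (p^2) (p * (exp (2 * v))^2)"
    and "C u = - (c^2) * gauss_sum (p^2) (p * (exp (2 * u))^2)"
    and "D v = exp (2 * v) * gauss_sum (p^2) (p^2 * (exp (2 * v))^2)" for u v
  have "odd_theta p (u + v) * odd_theta p (u - v) = A u * B v + C u * D v" for u v
  proof -
    have e: "exp (2 * (u + v)) = exp (2 * u) * exp (2 * v)" "exp (2 * (u - v)) = exp (2 * u) / exp (2 * v)"
      "exp (- (u + v)) * exp (- (u - v)) = exp (- 2 * u)" "exp (- 2 * u) * exp (2 * u) = 1"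
      by (simp_all add: distrib_left right_diff_distrib flip: exp_add exp_diff)
    have ring: "(d * k) * (g1 * g2 - e * g3 * (h * g4)) = (k * d * g1) * g2 + (d * e) * (- k * g3) * (h * g4)"
      for d k g1 g2 e g3 h g4 :: complex by (simp add: algebra_simps)
    have "odd_theta p (u + v) * odd_theta p (u - v) = exp (- (u + v)) * exp (- (u - v)) *
        (theta p (exp (2 * (u + v))) * theta p (exp (2 * (u - v))))"
      by (simp only: odd_theta_def mult_ac)
    also have "\<dots> = (exp (- 2 * u) * c^2) *
        (gauss_sum p (- exp (2 * u) * exp (2 * v)) * gauss_sum p (- exp (2 * u) / exp (2 * v)))"
      unfolding e by (simp add: c power2_eq_square)
    also have "\<dots> = A u * B v + C u * D v"
      unfolding gauss_sum_mult[OF False p exp_not_eq_zero exp_not_eq_zero] ring e A_def B_def C_def D_def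
      by simp
    finally show ?thesis .
  qed
  then show ?thesis by (intro exI allI)
qed

text \<open>An alternating form of rank two is decomposable: every \<open>3 \<times> 3\<close> minor of its Gram matrix
  at four points is an entry times the Pfaffian, so the Pfaffian vanishes.\<close>

lemma odd_theta_addition:
  assumes p: "norm p < 1"
  shows "odd_theta p (x + y) * odd_theta p (x - y) * (odd_theta p (u + v) * odd_theta p (u - v))
    + odd_theta p (x + u) * odd_theta p (x - u) * (odd_theta p (v + y) * odd_theta p (v - y))
    + odd_theta p (x + v) * odd_theta p (x - v) * (odd_theta p (y + u) * odd_theta p (y - u)) = 0"
proof -
  define f where "f u v = odd_theta p (u + v) * odd_theta p (u - v)" for u v
  obtain A B C D where "\<forall>u v. odd_theta p (u + v) * odd_theta p (u - v) = A u * B v + C u * D v"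
    using odd_theta_rank_two[OF p] by (elim exE)
  then have f: "f u v = A u * B v + C u * D v" for u v by (simp only: f_def)
  have anti: "f v u = - f u v" for u v
    using odd_theta_minus[OF p, of "u - v"] by (simp add: f_def add.commute)
  have alt: "f u u = 0" for u
  proof -
    have "f u u + f u u = 0" using anti[of u u] by (metis add.right_inverse)
    then show ?thesis by (simp flip: mult_2)
  qed
  define pf where "pf = f x y * f u v + f x u * f v y + f x v * f y u"
  have minor: "f a b * (f a b * f c d + f a c * f d b + f a d * f b c) = 0" for a b c d
  proof -
    have "f a a * (f b b * f c d - f b d * f c b) - f a b * (f b a * f c d - f b d * f c a)
        + f a d * (f b a * f c b - f b b * f c a) = 0"
      unfolding f by (simp add: algebra_simps)
    then show ?thesis
      unfolding alt anti[of a b] anti[of a c] anti[of d b] anti[of b c] by (simp add: algebra_simps)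
  qed
  \<comment> \<open>Cyclic rotation of \<open>y\<close>, \<open>u\<close>, \<open>v\<close> leaves
    \<open>pf\<close> unchanged, so the minors annihilate it against all three entries with first
    argument \<open>x\<close>. Each term of \<open>pf\<close> contains such an entry, hence its
    square is 0.\<close>
  have "f x y * pf = 0" "f x u * pf = 0" "f x v * pf = 0"
    using minor[of x y u v] minor[of x u v y] minor[of x v y u]
    by (simp_all add: pf_def algebra_simps)
  moreover have "pf * pf = (f x y * pf) * f u v + (f x u * pf) * f v y + (f x v * pf) * f y u"
    unfolding pf_def by (simp only: distrib_right mult_ac)
  ultimately have "pf * pf = 0" by (simp only: mult_zero_left add_0)
  then have "pf = 0" by simp
  then show ?thesis unfolding pf_def f_def .
qed

lemma odd_theta_eq_0_iff: "odd_theta p w = 0 \<longleftrightarrow> theta p (exp (2 * w)) = 0"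
  by (simp add: odd_theta_def)

lemma isCont_odd_theta:
  assumes "norm p < 1"
  shows "isCont (odd_theta p) w"
proof -
  have "isCont (\<lambda>w. theta p (exp (2 * w))) w"
    by (rule isCont_o2[where f = "\<lambda>w. exp (2 * w)" and g = "theta p"])
      (intro continuous_intros isCont_theta[OF assms exp_not_eq_zero])+
  then show ?thesis
    unfolding odd_theta_def[abs_def] by (intro continuous_intros)
qed

lemma countable_exp_eq: "countable {w :: complex. exp w = z}"
proof (cases "z = 0")
  case False
  have "{w. exp w = z} \<subseteq> range (\<lambda>n::int. Ln z + of_int (2 * n) * of_real pi * \<i>)"
  proof
    fix w assume "w \<in> {w. exp w = z}"
    then have "exp w = exp (Ln z)" using False by simp
    then show "w \<in> range (\<lambda>n::int. Ln z + of_int (2 * n) * of_real pi * \<i>)"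
      by (auto simp: exp_eq)
  qed
  then show ?thesis by (rule countable_subset) auto
qed simp

text \<open>Prepares the removal of genericity: countably many exceptional values of the logarithm
  of a cannot fill any ball.\<close>

lemma countable_odd_theta_zeros:
  assumes "norm p < 1"
  shows "countable {w. odd_theta p w = 0}"
proof (rule countable_subset)
  show "{w. odd_theta p w = 0} \<subseteq> (\<Union>n::int. (\<lambda>w. w / 2) ` {w. exp w = p powi n})"
  proof
    fix w assume "w \<in> {w. odd_theta p w = 0}"
    then obtain n :: int where "exp (2 * w) = p powi n"
      using theta_zero_imp[OF assms, of "exp (2 * w)"] by (auto simp: odd_theta_eq_0_iff)
    then have "w \<in> (\<lambda>w. w / 2) ` {w. exp w = p powi n}"
      by (intro image_eqI[of _ _ "2 * w"]) auto
    then show "w \<in> (\<Union>n::int. (\<lambda>w. w / 2) ` {w. exp w = p powi n})"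
      by (rule UN_I[OF UNIV_I])
  qed
  show "countable (\<Union>n::int. (\<lambda>w. w / 2) ` {w. exp w = p powi n})"
    by (intro countable_UN countable_image countable_exp_eq) auto
qed

section \<open>Interpolation\<close>

text \<open>The induction step shared by both interpolation formulas: an expansion over the nodes
  \<open>y 0\<close>, ..., \<open>y n\<close> is multiplied by a further factor \<open>g\<close>. By
  \<open>step\<close>, each term splits into a part containing \<open>D t Y\<close> and a part
  containing \<open>D t (y i)\<close>. The latter parts add up, by the old expansion at the new node
  \<open>Y\<close>, to the single term belonging to \<open>Y\<close>.\<close>

lemma lagrange_step:
  fixes y :: "nat \<Rightarrow> 'a" and D :: "'a \<Rightarrow> 'a \<Rightarrow> 'b :: field" and n :: nat
  defines "Y \<equiv> y (Suc n)"
  assumes p: "\<And>t. p t = (\<Sum>i\<le>n. c i * f t i * (\<Prod>l\<in>{..n} - {i}. D t (y l) / D (y i) (y l)))"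
    and nz: "\<And>i. i \<le> n \<Longrightarrow> D Y (y i) \<noteq> 0"
    and step: "\<And>i. i \<le> n \<Longrightarrow> f t i * g = a i * (D t Y / D (y i) Y) + f Y i * b * (D t (y i) / D Y (y i))"
  shows "p t * g = (\<Sum>i\<le>n. c i * a i * (\<Prod>l\<in>{..Suc n} - {i}. D t (y l) / D (y i) (y l)))
    + p Y * b * (\<Prod>l\<in>{..Suc n} - {Suc n}. D t (y l) / D Y (y l))"
proof -
  define w where "w i t = (\<Prod>l\<in>{..n} - {i}. D t (y l) / D (y i) (y l))" for i t
  have last: "{..Suc n} - {Suc n} = {..n}" by auto
  have full: "w i Y * (\<Prod>l\<le>n. D t (y l) / D Y (y l)) = w i t * (D t (y i) / D Y (y i))" if i: "i \<le> n" for i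
  proof -
    have 1: "w i Y * (\<Prod>l\<in>{..n} - {i}. D t (y l) / D Y (y l)) = w i t"
      unfolding w_def prod.distrib[symmetric] using nz by (intro prod.cong) auto
    have 2: "(\<Prod>l\<le>n. D t (y l) / D Y (y l)) = D t (y i) / D Y (y i) * (\<Prod>l\<in>{..n} - {i}. D t (y l) / D Y (y l))"
      using i by (intro prod.remove) auto
    show ?thesis unfolding 2 1[symmetric] by (simp only: mult_ac)
  qed
  have rest: "(\<Prod>l\<in>{..Suc n} - {i}. D t (y l) / D (y i) (y l)) = w i t * (D t Y / D (y i) Y)" if i: "i \<le> n" for i
  proof -
    have "{..Suc n} - {i} = insert (Suc n) ({..n} - {i})" using i by auto
    then show ?thesis by (simp add: w_def Y_def)
  qed
  have "p t * g = (\<Sum>i\<le>n. c i * w i t * (f t i * g))"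
    unfolding p[of t] w_def sum_distrib_right by (intro sum.cong refl) (simp only: mult_ac)
  also have "\<dots> = (\<Sum>i\<le>n. c i * a i * (w i t * (D t Y / D (y i) Y)) + c i * f Y i * b * (w i t * (D t (y i) / D Y (y i))))"
    by (intro sum.cong refl) (simp only: step atMost_iff, simp only: distrib_left mult_ac)
  also have "\<dots> = (\<Sum>i\<le>n. c i * a i * (w i t * (D t Y / D (y i) Y)))
      + (\<Sum>i\<le>n. c i * f Y i * w i Y) * b * (\<Prod>l\<le>n. D t (y l) / D Y (y l))"
    unfolding sum.distrib sum_distrib_right
    by (intro arg_cong2[of _ _ _ _ "(+)"] sum.cong refl) (simp only: full[symmetric] atMost_iff mult_ac)
  finally show ?thesis unfolding last p[of Y] w_def[symmetric] by (simp add: rest)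
qed

text \<open>Oddness and the addition formula are all that the algebra takes from the theta function,
  apart from conditions that certain values do not vanish.\<close>

locale three_term =
  fixes \<sigma> :: "'a :: field_char_0 \<Rightarrow> 'b :: field_char_0"
  assumes odd: "\<sigma> (- u) = - \<sigma> u"
    and addition: "\<sigma> (x + y) * \<sigma> (x - y) * (\<sigma> (u + v) * \<sigma> (u - v))
      + \<sigma> (x + u) * \<sigma> (x - u) * (\<sigma> (v + y) * \<sigma> (v - y))
      + \<sigma> (x + v) * \<sigma> (x - v) * (\<sigma> (y + u) * \<sigma> (y - u)) = 0"
begin

definition br :: "'a \<Rightarrow> 'a \<Rightarrow> 'b" where
  "br u v = \<sigma> (u + v) * \<sigma> (u - v)"

lemma odd_diff: "\<sigma> (u - v) = - \<sigma> (v - u)"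
  using odd[of "v - u"] by simp

lemma br_commute: "br u v = - br v u"
  by (simp add: br_def add.commute odd_diff[of u v])

lemma br_pluecker: "br t b * br y z = br y b * br t z - br z b * br t y"
proof -
  have "br t b * br y z + br t y * br z b + br t z * br b y = 0"
    using addition[of t b y z] by (simp add: br_def)
  then show ?thesis
    unfolding br_commute[of b y] by (simp add: algebra_simps)
qed

text \<open>Type C, with \<open>n\<close> factors and \<open>n + 1\<close> nodes. The induction step
  is \<open>br_pluecker\<close> divided by \<open>br (y i) z\<close>, so the weight \<open>f\<close>
  of \<open>lagrange_step\<close> is constantly 1.\<close>

lemma br_interpolation:
  fixes n :: nat
  assumes "\<And>i l. i \<le> n \<Longrightarrow> l \<le> n \<Longrightarrow> i \<noteq> l \<Longrightarrow> br (y i) (y l) \<noteq> 0"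
  shows "(\<Prod>j<n. br t (b j)) = (\<Sum>i\<le>n. (\<Prod>j<n. br (y i) (b j)) * (\<Prod>l\<in>{..n} - {i}. br t (y l) / br (y i) (y l)))"
  using assms
proof (induction n arbitrary: t)
  case 0
  then show ?case by simp
next
  case (Suc n)
  define z where "z = y (Suc n)"
  have nz: "br (y i) z \<noteq> 0" "br z (y i) \<noteq> 0" if "i \<le> n" for i
    using Suc.prems[of i "Suc n"] Suc.prems[of "Suc n" i] that by (auto simp: z_def)
  have "(\<Prod>j<n. br t (b j)) * br t (b n)
    = (\<Sum>i\<le>n. (\<Prod>j<n. br (y i) (b j)) * br (y i) (b n) * (\<Prod>l\<in>{..Suc n} - {i}. br t (y l) / br (y i) (y l)))
     + (\<Prod>j<n. br (y (Suc n)) (b j)) * br (y (Suc n)) (b n) * (\<Prod>l\<in>{..Suc n} - {Suc n}. br t (y l) / br (y (Suc n)) (y l))"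
  proof (rule lagrange_step[where f = "\<lambda>_ _. 1"])
    show "(\<Prod>j<n. br t (b j)) = (\<Sum>i\<le>n. (\<Prod>j<n. br (y i) (b j)) * 1 * (\<Prod>l\<in>{..n} - {i}. br t (y l) / br (y i) (y l)))" for t
      using Suc.IH[of t] Suc.prems by simp
  next
    fix i assume i: "i \<le> n"
    show "br (y (Suc n)) (y i) \<noteq> 0" using nz[OF i] by (simp add: z_def)
    show "1 * br t (b n) = br (y i) (b n) * (br t (y (Suc n)) / br (y i) (y (Suc n)))
      + 1 * br (y (Suc n)) (b n) * (br t (y i) / br (y (Suc n)) (y i))"
      using br_pluecker[of t "b n" "y i" z] nz[OF i] br_commute[of z "y i"] by (simp add: z_def field_simps)
  qed
  then show ?case by (simp add: mult.assoc)
qed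

text \<open>Type A, with as many factors as nodes. The extra factor in the \<open>i\<close>-th term
  has its zero where the zeros of that term in \<open>t\<close> get the same sum as the
  \<open>z j\<close>. The induction cancels \<open>\<sigma>\<close> of the preceding partial sum,
  which is why every partial sum is restricted.\<close>

lemma sigma_interpolation:
  fixes n :: nat
  assumes y: "\<And>i l. i \<le> n \<Longrightarrow> l \<le> n \<Longrightarrow> i \<noteq> l \<Longrightarrow> \<sigma> (y i - y l) \<noteq> 0"
    and S: "\<And>m. m \<le> n \<Longrightarrow> \<sigma> (\<Sum>l\<le>m. y l - z l) \<noteq> 0"
  shows "(\<Prod>j\<le>n. \<sigma> (t - z j)) * \<sigma> (\<Sum>l\<le>n. y l - z l) =
    (\<Sum>i\<le>n. (\<Prod>j\<le>n. \<sigma> (y i - z j)) * \<sigma> (t - y i + (\<Sum>l\<le>n. y l - z l)) * (\<Prod>l\<in>{..n} - {i}. \<sigma> (t - y l) / \<sigma> (y i - y l)))"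
  using y S
proof (induction n arbitrary: t)
  case 0
  then show ?case by (simp add: mult.commute)
next
  case (Suc n)
  define S where "S n = (\<Sum>l\<le>n. y l - z l)" for n
  define Y where "Y = y (Suc n)"
  define Z where "Z = z (Suc n)"
  define s where "s = S n"
  define s' where "s' = S (Suc n)"
  have s': "s' = s + Y - Z" by (simp add: s_def s'_def S_def Y_def Z_def)
  have s_nz: "\<sigma> s \<noteq> 0" using Suc.prems(2)[of n] by (simp add: s_def S_def)
  have nz: "\<sigma> (y i - Y) \<noteq> 0" "\<sigma> (Y - y i) \<noteq> 0" if "i \<le> n" for i
    using Suc.prems(1)[of i "Suc n"] Suc.prems(1)[of "Suc n" i] that by (auto simp: Y_def)
  have "(\<Prod>j\<le>n. \<sigma> (t - z j)) * \<sigma> s * (\<sigma> (t - Z) * \<sigma> s')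
    = (\<Sum>i\<le>n. (\<Prod>j\<le>n. \<sigma> (y i - z j)) * (\<sigma> (y i - Z) * \<sigma> (t - y i + s') * \<sigma> s) * (\<Prod>l\<in>{..Suc n} - {i}. \<sigma> (t - y l) / \<sigma> (y i - y l)))
     + (\<Prod>j\<le>n. \<sigma> (Y - z j)) * \<sigma> s * (\<sigma> (Y - Z) * \<sigma> (t - Y + s')) * (\<Prod>l\<in>{..Suc n} - {Suc n}. \<sigma> (t - y l) / \<sigma> (Y - y l))"
  proof (rule lagrange_step[where f = "\<lambda>t i. \<sigma> (t - y i + s)" and D = "\<lambda>u v. \<sigma> (u - v)"
        and p = "\<lambda>t. (\<Prod>j\<le>n. \<sigma> (t - z j)) * \<sigma> s" and y = y and n = n
        and c = "\<lambda>i. \<Prod>j\<le>n. \<sigma> (y i - z j)", folded Y_def])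
    show "(\<Prod>j\<le>n. \<sigma> (t - z j)) * \<sigma> s = (\<Sum>i\<le>n. (\<Prod>j\<le>n. \<sigma> (y i - z j)) * \<sigma> (t - y i + s) * (\<Prod>l\<in>{..n} - {i}. \<sigma> (t - y l) / \<sigma> (y i - y l)))" for t
      using Suc.IH[of t] Suc.prems by (simp add: s_def S_def)
  next
    fix i assume i: "i \<le> n"
    show "\<sigma> (Y - y i) \<noteq> 0" by (rule nz[OF i])
    have "\<sigma> (t - y i + s) * \<sigma> (t - Z) * (\<sigma> s' * \<sigma> (y i - Y))
      + \<sigma> (t - Y + s') * \<sigma> (t - y i) * (\<sigma> (Y - y i + s) * \<sigma> (Y - Z))
      + \<sigma> (t - y i + s') * \<sigma> (t - Y) * (\<sigma> s * \<sigma> (Z - y i)) = 0"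
    proof -
      \<comment> \<open>\<open>x\<close> and \<open>g\<close> are half the sum and half the
        difference of \<open>t - y i + s\<close> and \<open>t - Z\<close>; \<open>u\<close> and
        \<open>v\<close> are those of \<open>s'\<close> and \<open>y i - Y\<close>. With them
        \<open>addition\<close> takes the arguments displayed above.\<close>
      define x where "x = t + (s - y i - Z) / 2"
      define v where "v = (s - y i + 2 * Y - Z) / 2"
      define u where "u = (s + y i - Z) / 2"
      define g where "g = (s - y i + Z) / 2"
      have "x + g = t - y i + s" "x - g = t - Z" "u + v = s'" "u - v = y i - Y"
        "x + u = t - Y + s'" "x - u = t - y i" "v + g = Y - y i + s" "v - g = Y - Z"
        "x + v = t - y i + s'" "x - v = t - Y" "g + u = s" "g - u = Z - y i"
        by (simp_all add: x_def v_def u_def g_def s' field_simps)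
      then show ?thesis using addition[of x g u v] by (simp only:)
    qed
    then show "\<sigma> (t - y i + s) * (\<sigma> (t - Z) * \<sigma> s') = \<sigma> (y i - Z) * \<sigma> (t - y i + s') * \<sigma> s * (\<sigma> (t - Y) / \<sigma> (y i - Y))
      + \<sigma> (Y - y i + s) * (\<sigma> (Y - Z) * \<sigma> (t - Y + s')) * (\<sigma> (t - y i) / \<sigma> (Y - y i))"
      using nz[OF i] unfolding odd_diff[of Y "y i"] odd_diff[of Z "y i"]
      by (simp add: field_simps)
  qed
  also have "\<dots> = (\<Sum>i\<le>Suc n. (\<Prod>j\<le>Suc n. \<sigma> (y i - z j)) * \<sigma> (t - y i + s') *
      (\<Prod>l\<in>{..Suc n} - {i}. \<sigma> (t - y l) / \<sigma> (y i - y l))) * \<sigma> s"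
    unfolding sum.atMost_Suc[of _ n] prod.atMost_Suc[of _ n] Y_def Z_def distrib_right sum_distrib_right
    by (intro arg_cong2[of _ _ _ _ "(+)"] sum.cong refl) (simp_all only: mult_ac)
  also have "(\<Prod>j\<le>n. \<sigma> (t - z j)) * \<sigma> s * (\<sigma> (t - Z) * \<sigma> s') = (\<Prod>j\<le>Suc n. \<sigma> (t - z j)) * \<sigma> s' * \<sigma> s"
    by (simp add: Z_def mult_ac)
  finally show ?case using s_nz unfolding S_def[symmetric] s'_def[symmetric] by simp
qed

end

text \<open>For raising one coordinate of a multi-index: only the pairs containing \<open>m\<close>
  change, and those with \<open>m\<close> in first or in second place are gathered into one
  product.\<close>

lemma prod_pairs_update:
  fixes f f' :: "nat \<Rightarrow> nat \<Rightarrow> 'c :: comm_monoid_mult"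
  assumes m: "m \<in> {1..r}"
    and "\<And>i j. i \<in> {1..r} \<Longrightarrow> j \<in> {i<..r} \<Longrightarrow> i \<noteq> m \<Longrightarrow> j \<noteq> m \<Longrightarrow> f' i j = f i j"
    and "\<And>l. l \<in> {1..<m} \<Longrightarrow> f' l m = f l m * g l"
    and "\<And>l. l \<in> {m<..r} \<Longrightarrow> f' m l = f m l * g l"
  shows "(\<Prod>i=1..r. \<Prod>j\<in>{i<..r}. f' i j) = (\<Prod>i=1..r. \<Prod>j\<in>{i<..r}. f i j) * (\<Prod>l\<in>{1..r} - {m}. g l)"
proof -
  define h where "h i j = (if i = m then g j else if j = m then g i else 1)" for i j
  define I where "I = {1..<m} \<union> {m<..r}"
  have I: "{1..r} = insert m I" "m \<notin> I" "finite I" using m by (auto simp: I_def)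
  have "(\<Prod>i=1..r. \<Prod>j\<in>{i<..r}. f' i j) = (\<Prod>i=1..r. \<Prod>j\<in>{i<..r}. f i j * h i j)"
    by (intro prod.cong refl) (use assms in \<open>auto simp: h_def\<close>)
  also have "\<dots> = (\<Prod>i=1..r. \<Prod>j\<in>{i<..r}. f i j) * (\<Prod>i=1..r. \<Prod>j\<in>{i<..r}. h i j)"
    by (simp add: prod.distrib)
  also have "(\<Prod>i=1..r. \<Prod>j\<in>{i<..r}. h i j) =
      (\<Prod>i=1..r. if i = m then \<Prod>j\<in>{m<..r}. g j else if i < m then g i else 1)"
    using m by (intro prod.cong refl) (auto simp: h_def prod.delta)
  also have "\<dots> = (\<Prod>j\<in>{m<..r}. g j) * (\<Prod>i\<in>I. if i < m then g i else 1)"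
    unfolding I(1) using I(2,3) by (subst prod.insert) (auto intro!: arg_cong2[of _ _ _ _ "(*)"] prod.cong)
  also have "(\<Prod>i\<in>I. if i < m then g i else 1) = (\<Prod>i\<in>{1..<m}. g i)"
    unfolding I_def by (subst prod.union_disjoint) auto
  also have "(\<Prod>j\<in>{m<..r}. g j) * (\<Prod>i\<in>{1..<m}. g i) = (\<Prod>l\<in>I. g l)"
    unfolding I_def by (subst mult.commute, subst prod.union_disjoint[symmetric]) auto
  also have "I = {1..r} - {m}" using I(1,2) by simp
  finally show ?thesis .
qed

section \<open>Factorials in logarithmic form and the factors of the summand\<close>

context three_term
begin

lemma sigma_0 [simp]: "\<sigma> 0 = 0"
proof -
  have "\<sigma> 0 + \<sigma> 0 = 0" using odd[of 0] by (metis add.right_inverse minus_zero)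
  then show ?thesis by (simp flip: mult_2)
qed

text \<open>The elliptic shifted factorial of exp (2 u) in base exp (2 h), up to an
  exponential.\<close>

definition fac :: "'a \<Rightarrow> 'a \<Rightarrow> nat \<Rightarrow> 'b" where
  "fac u h n = (\<Prod>j<n. \<sigma> (u + of_nat j * h))"

lemma fac_0 [simp]: "fac u h 0 = 1" by (simp add: fac_def)

lemma fac_Suc: "fac u h (Suc n) = fac u h n * \<sigma> (u + of_nat n * h)" by (simp add: fac_def)

lemma fac_Suc_shift: "fac u h (Suc n) = \<sigma> u * fac (u + h) h n"
  unfolding fac_def by (subst prod.lessThan_Suc_shift) (simp add: algebra_simps)

lemma fac_shift: "fac (u + h) h n * \<sigma> u = fac u h n * \<sigma> (u + of_nat n * h)"
  using fac_Suc[of u h n] fac_Suc_shift[of u h n] by (simp add: mult.commute)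

lemma fac_nonzero: "(\<And>j. j < n \<Longrightarrow> \<sigma> (u + of_nat j * h) \<noteq> 0) \<Longrightarrow> fac u h n \<noteq> 0"
  by (simp add: fac_def)

text \<open>The node \<open>y0\<close> will be tied to |k| and the nodes \<open>X i\<close> to the
  coordinates of k. In both uses the term of \<open>y0\<close> belongs to keeping k and the term of
  \<open>X i\<close> to a step in direction \<open>i\<close>.\<close>

lemma interpolation_split:
  fixes r :: nat and y0 :: 'a and X :: "nat \<Rightarrow> 'a" and F :: "'a \<Rightarrow> 'b" and D :: "'a \<Rightarrow> 'a \<Rightarrow> 'b"
  defines "y \<equiv> \<lambda>i. if i = 0 then y0 else X i"
  shows "(\<Sum>i\<le>r. F (y i) * (\<Prod>l\<in>{..r} - {i}. D t (y l) / D (y i) (y l))) =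
    F y0 * (\<Prod>l=1..r. D t (X l) / D y0 (X l))
    + (\<Sum>i=1..r. F (X i) * (D t y0 / D (X i) y0) * (\<Prod>l\<in>{1..r} - {i}. D t (X l) / D (X i) (X l)))"
proof -
  let ?f = "\<lambda>i. F (y i) * (\<Prod>l\<in>{..r} - {i}. D t (y l) / D (y i) (y l))"
  have "{..r} = insert 0 {1..r}" by auto
  then have "(\<Sum>i\<le>r. ?f i) = ?f 0 + (\<Sum>i=1..r. ?f i)" by simp
  also have "?f 0 = F y0 * (\<Prod>l=1..r. D t (X l) / D y0 (X l))"
    by (intro arg_cong2[of _ _ _ _ "(*)"] prod.cong) (auto simp: y_def)
  also have "(\<Sum>i=1..r. ?f i) = (\<Sum>i=1..r. F (X i) * (D t y0 / D (X i) y0) * (\<Prod>l\<in>{1..r} - {i}. D t (X l) / D (X i) (X l)))"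
  proof (intro sum.cong refl)
    fix i assume i: "i \<in> {1..r}"
    then have "{..r} - {i} = insert 0 ({1..r} - {i})" by auto
    moreover have "(\<Prod>l\<in>{1..r} - {i}. D t (y l) / D (y i) (y l)) = (\<Prod>l\<in>{1..r} - {i}. D t (X l) / D (X i) (X l))"
      using i by (intro prod.cong) (auto simp: y_def)
    ultimately show "?f i = F (X i) * (D t y0 / D (X i) y0) * (\<Prod>l\<in>{1..r} - {i}. D t (X l) / D (X i) (X l))"
      using i by (simp add: y_def mult.assoc)
  qed
  finally show ?thesis .
qed

lemma br_interpolation':
  fixes r :: nat and X b :: "nat \<Rightarrow> 'a"
  assumes y0: "\<And>l. l \<in> {1..r} \<Longrightarrow> br y0 (X l) \<noteq> 0"
    and X: "\<And>i l. i \<in> {1..r} \<Longrightarrow> l \<in> {1..r} \<Longrightarrow> i \<noteq> l \<Longrightarrow> br (X i) (X l) \<noteq> 0"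
  shows "(\<Prod>j=1..r. br t (b j)) =
    (\<Prod>j=1..r. br y0 (b j)) * (\<Prod>l=1..r. br t (X l) / br y0 (X l))
    + (\<Sum>i=1..r. (\<Prod>j=1..r. br (X i) (b j)) * (br t y0 / br (X i) y0)
        * (\<Prod>l\<in>{1..r} - {i}. br t (X l) / br (X i) (X l)))"
proof -
  define y where "y i = (if i = 0 then y0 else X i)" for i :: nat
  have y0': "br (X l) y0 \<noteq> 0" if "l \<in> {1..r}" for l
    using y0[OF that] br_commute[of "X l" y0] by simp
  have y: "br (y i) (y l) \<noteq> 0" if "i \<le> r" "l \<le> r" "i \<noteq> l" for i l
    using y0[of l] y0'[of i] X[of i l] that by (auto simp: y_def)
  have shift: "(\<Prod>j<r. br u (b (Suc j))) = (\<Prod>j=1..r. br u (b j))" for u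
    by (simp add: prod.atLeast1_atMost_eq)
  have "(\<Prod>j=1..r. br t (b j)) = (\<Sum>i\<le>r. (\<Prod>j=1..r. br (y i) (b j)) * (\<Prod>l\<in>{..r} - {i}. br t (y l) / br (y i) (y l)))"
    using br_interpolation[where y = y and n = r and t = t and b = "\<lambda>j. b (Suc j)", OF y] unfolding shift .
  then show ?thesis
    unfolding y_def interpolation_split[where F = "\<lambda>u. \<Prod>j=1..r. br u (b j)" and D = br] .
qed

lemma sigma_interpolation':
  fixes r :: nat and y0 z0 :: 'a and X z :: "nat \<Rightarrow> 'a"
  defines "S \<equiv> \<lambda>m. y0 - z0 + (\<Sum>l=1..m. X l - z l)"
  assumes y0: "\<And>l. l \<in> {1..r} \<Longrightarrow> \<sigma> (y0 - X l) \<noteq> 0"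
    and X: "\<And>i l. i \<in> {1..r} \<Longrightarrow> l \<in> {1..r} \<Longrightarrow> i \<noteq> l \<Longrightarrow> \<sigma> (X i - X l) \<noteq> 0"
    and S: "\<And>m. m \<le> r \<Longrightarrow> \<sigma> (S m) \<noteq> 0"
  shows "\<sigma> (t - z0) * (\<Prod>j=1..r. \<sigma> (t - z j)) * \<sigma> (S r) =
    \<sigma> (y0 - z0) * (\<Prod>j=1..r. \<sigma> (y0 - z j)) * \<sigma> (t - y0 + S r) * (\<Prod>l=1..r. \<sigma> (t - X l) / \<sigma> (y0 - X l))
    + (\<Sum>i=1..r. \<sigma> (X i - z0) * (\<Prod>j=1..r. \<sigma> (X i - z j)) * \<sigma> (t - X i + S r) * (\<sigma> (t - y0) / \<sigma> (X i - y0))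
        * (\<Prod>l\<in>{1..r} - {i}. \<sigma> (t - X l) / \<sigma> (X i - X l)))"
proof -
  define y where "y i = (if i = 0 then y0 else X i)" for i :: nat
  define w where "w i = (if i = 0 then z0 else z i)" for i :: nat
  let ?F = "\<lambda>u. \<sigma> (u - z0) * (\<Prod>j=1..r. \<sigma> (u - z j)) * \<sigma> (t - u + S r)"
  have y0': "\<sigma> (X l - y0) \<noteq> 0" if "l \<in> {1..r}" for l
    using y0[OF that] odd_diff[of "X l" y0] by simp
  have y: "\<sigma> (y i - y l) \<noteq> 0" if "i \<le> r" "l \<le> r" "i \<noteq> l" for i l
    using y0[of l] y0'[of i] X[of i l] that by (auto simp: y_def)
  have split: "{..r} = insert 0 {1..r}" for r :: nat by auto
  have Sr: "(\<Sum>l\<le>m. y l - w l) = S m" for m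
    unfolding split by (subst sum.insert) (auto simp: y_def w_def S_def)
  have pw: "(\<Prod>j\<le>r. \<sigma> (u - w j)) = \<sigma> (u - z0) * (\<Prod>j=1..r. \<sigma> (u - z j))" for u
    unfolding split by (subst prod.insert) (auto simp: w_def)
  have "\<sigma> (t - z0) * (\<Prod>j=1..r. \<sigma> (t - z j)) * \<sigma> (S r) =
    (\<Sum>i\<le>r. ?F (y i) * (\<Prod>l\<in>{..r} - {i}. \<sigma> (t - y l) / \<sigma> (y i - y l)))"
    using sigma_interpolation[where y = y and n = r and t = t and z = w, OF y] S unfolding Sr pw by simp
  then show ?thesis
    unfolding y_def interpolation_split[where F = ?F and D = "\<lambda>u v. \<sigma> (u - v)"] .
qed

definition W :: "'a \<Rightarrow> nat \<Rightarrow> 'a \<Rightarrow> 'a \<Rightarrow> nat \<Rightarrow> nat \<Rightarrow> 'b" where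
  "W \<eta> N \<alpha> x k K = \<sigma> (\<alpha> + x + of_nat (2 * k + K) * \<eta>) / \<sigma> (\<alpha> + x) * fac (\<alpha> + x) \<eta> K * fac (\<alpha> - x + \<eta>) \<eta> (K - k)
    / (fac (x - \<alpha> + (of_nat k - of_nat K) * \<eta>) \<eta> k * fac (\<alpha> + x + of_nat (N + 2) * \<eta>) (2 * \<eta>) k
       * fac (\<alpha> + x + (1 - of_nat N) * \<eta>) (2 * \<eta>) k)"

text \<open>The three ways in which a coordinate passes from level \<open>N\<close> at
  \<open>\<alpha> + \<eta>\<close> to level \<open>Suc N\<close> at \<open>\<alpha>\<close>: nothing
  moves, another coordinate moves (only \<open>K\<close> grows), or this one moves (\<open>k\<close>
  and \<open>K\<close> grow). The brackets are the shares of \<open>mu\<close> and of the type C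
  coefficient that belong to this coordinate. Factorials change only at their ends, so cancellation
  of single values of \<open>\<sigma>\<close> remains.\<close>

lemma W_ratios:
  fixes x \<alpha> \<eta> :: 'a and k K N :: nat
  defines "X \<equiv> x + 2 * of_nat k * \<eta>"
  assumes P: "\<And>s::int. \<sigma> (\<alpha> + x + of_int s * \<eta>) \<noteq> 0" and M: "\<And>s::int. \<sigma> (\<alpha> - x + of_int s * \<eta>) \<noteq> 0"
    and k: "k \<le> K"
  shows "br (\<alpha> + \<eta>) x / br (\<alpha> - of_nat N * \<eta>) x * (br (\<alpha> - of_nat N * \<eta>) X / br (\<alpha> + of_nat (Suc K) * \<eta>) X) * W \<eta> N (\<alpha> + \<eta>) x k K
      = W \<eta> (Suc N) \<alpha> x k K * (\<sigma> (\<alpha> - of_nat N * \<eta> - X) / \<sigma> (\<alpha> - of_nat N * \<eta> - x) * (\<sigma> (\<alpha> + x + of_nat K * \<eta>) / \<sigma> (\<alpha> + X + of_nat K * \<eta>)))" (is ?stay)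
    and "br (\<alpha> + \<eta>) x / br (\<alpha> - of_nat N * \<eta>) x * br (\<alpha> - of_nat N * \<eta>) X * W \<eta> N (\<alpha> + \<eta>) x k K
      = W \<eta> (Suc N) \<alpha> x k (Suc K) * (\<sigma> (\<alpha> - of_nat N * \<eta> - X) / \<sigma> (\<alpha> - of_nat N * \<eta> - x))" (is ?other)
    and "br (\<alpha> + \<eta>) x / br (\<alpha> - of_nat N * \<eta>) x / br X (\<alpha> + of_nat (Suc K) * \<eta>) * W \<eta> N (\<alpha> + \<eta>) x k K
      = W \<eta> (Suc N) \<alpha> x (Suc k) (Suc K) * - (\<sigma> (X - \<alpha> - of_nat K * \<eta>) * \<sigma> (\<alpha> + X + of_nat (N + 3) * \<eta>)
          / (\<sigma> (\<alpha> + X + of_nat (K + 3) * \<eta>) * \<sigma> (\<alpha> - of_nat N * \<eta> - x)))" (is ?self)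
proof -
  define A where "A = \<sigma> (\<alpha> + x)"
  define B where "B = \<sigma> (\<alpha> + x + \<eta>)"
  define sX0 where "sX0 = \<sigma> (\<alpha> + X + of_nat K * \<eta>)"
  define sX1 where "sX1 = \<sigma> (\<alpha> + X + of_nat (Suc K) * \<eta>)"
  define sX3 where "sX3 = \<sigma> (\<alpha> + X + of_nat (K + 3) * \<eta>)"
  define sK where "sK = \<sigma> (\<alpha> + x + of_nat K * \<eta>)"
  define s3 where "s3 = \<sigma> (\<alpha> - x + \<eta> + of_nat (K - k) * \<eta>)"
  define s4 where "s4 = \<sigma> (\<alpha> - x + \<eta>)"
  define s6 where "s6 = \<sigma> (\<alpha> + of_nat (Suc K) * \<eta> - X)"
  define s7 where "s7 = \<sigma> (\<alpha> - of_nat N * \<eta> + X)"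
  define s8 where "s8 = \<sigma> (\<alpha> - of_nat N * \<eta> + x)"
  define s9 where "s9 = \<sigma> (\<alpha> - of_nat N * \<eta> - x)"
  define s10 where "s10 = \<sigma> (\<alpha> - of_nat N * \<eta> - X)"
  define s12 where "s12 = \<sigma> (X - \<alpha> - of_nat K * \<eta>)"
  define s13 where "s13 = \<sigma> (\<alpha> + X + of_nat (N + 3) * \<eta>)"
  define F1 where "F1 = fac (\<alpha> + x) \<eta> K"
  define F2 where "F2 = fac (\<alpha> - x + \<eta>) \<eta> (K - k)"
  define F3 where "F3 = fac (x - \<alpha> + (of_nat k - of_nat K) * \<eta>) \<eta> k"
  define F4 where "F4 = fac (\<alpha> + x + of_nat (N + 3) * \<eta>) (2 * \<eta>) k"
  define F5 where "F5 = fac (\<alpha> - of_nat N * \<eta> + x) (2 * \<eta>) k"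
  have P': "\<sigma> u \<noteq> 0" if "u = \<alpha> + x + of_int s * \<eta>" for u s using P that by simp
  have M': "\<sigma> u \<noteq> 0" if "u = \<alpha> - x + of_int s * \<eta>" for u s using M that by simp
  have M'': "\<sigma> u \<noteq> 0" if "u = - (\<alpha> - x + of_int s * \<eta>)" for u s
    unfolding that odd using M by simp
  have Kk: "of_nat (K - k) = (of_nat K - of_nat k :: 'a)" using k by (simp add: of_nat_diff)
  have nz: "A \<noteq> 0" "B \<noteq> 0" "sX0 \<noteq> 0" "sX1 \<noteq> 0" "sX3 \<noteq> 0" "s3 \<noteq> 0" "s4 \<noteq> 0" "s6 \<noteq> 0" "s7 \<noteq> 0" "s8 \<noteq> 0" "s9 \<noteq> 0" "s12 \<noteq> 0" "s13 \<noteq> 0"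
    unfolding A_def B_def sX0_def sX1_def sX3_def s3_def s4_def s6_def s7_def s8_def s9_def s12_def s13_def
    by (rule P'[of _ 0], simp,
      rule P'[of _ 1], simp,
      rule P'[of _ "2 * int k + int K"], simp add: X_def algebra_simps,
      rule P'[of _ "2 * int k + int K + 1"], simp add: X_def algebra_simps,
      rule P'[of _ "2 * int k + int K + 3"], simp add: X_def algebra_simps,
      rule M'[of _ "1 + int K - int k"], simp add: Kk algebra_simps,
      rule M'[of _ 1], simp,
      rule M'[of _ "1 + int K - 2 * int k"], simp add: X_def algebra_simps,
      rule P'[of _ "2 * int k - int N"], simp add: X_def algebra_simps,
      rule P'[of _ "- int N"], simp add: X_def algebra_simps,
      rule M'[of _ "- int N"], simp add: X_def algebra_simps,
      rule M''[of _ "int K - 2 * int k"], simp add: X_def algebra_simps,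
      rule P'[of _ "2 * int k + int N + 3"], simp add: X_def algebra_simps)
  have F_nz: "F3 \<noteq> 0" "F4 \<noteq> 0" "F5 \<noteq> 0"
    unfolding F3_def F4_def F5_def
    by (rule fac_nonzero, rule_tac s = "int K - int k - int j" in M'', simp add: algebra_simps,
       rule fac_nonzero, rule_tac s = "int N + 3 + 2 * int j" in P', simp add: algebra_simps,
       rule fac_nonzero, rule_tac s = "- int N + 2 * int j" in P', simp add: algebra_simps)
  \<comment> \<open>Raising \<open>\<alpha>\<close> by \<open>\<eta>\<close> and raising
    \<open>K\<close> by 1 act alike on this factorial, so the value serves both \<open>WN\<close>
    and \<open>W1\<close>.\<close>
  have F3': "fac (x - \<alpha> + (of_nat k - of_nat (Suc K)) * \<eta>) \<eta> k = F3 * s3 / s6"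
  proof -
    let ?u = "x - \<alpha> + (of_nat k - of_nat (Suc K)) * \<eta>"
    have 1: "\<sigma> ?u = - s3"
      unfolding s3_def odd[symmetric] by (rule arg_cong[of _ _ \<sigma>]) (simp add: Kk algebra_simps)
    have 2: "\<sigma> (?u + of_nat k * \<eta>) = - s6"
      unfolding s6_def odd[symmetric] by (rule arg_cong[of _ _ \<sigma>]) (simp add: X_def algebra_simps)
    have 3: "?u + \<eta> = x - \<alpha> + (of_nat k - of_nat K) * \<eta>" by (simp add: algebra_simps)
    show ?thesis using fac_shift[of ?u \<eta> k] nz unfolding 1 2 3 F3_def[symmetric] by (simp add: field_simps)
  qed
  have F5': "fac (\<alpha> + \<eta> + x + (1 - of_nat N) * \<eta>) (2 * \<eta>) k = F5 * s7 / s8"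
  proof -
    have 1: "\<alpha> + \<eta> + x + (1 - of_nat N) * \<eta> = \<alpha> - of_nat N * \<eta> + x + 2 * \<eta>" by (simp add: algebra_simps)
    have 2: "\<alpha> - of_nat N * \<eta> + x + of_nat k * (2 * \<eta>) = \<alpha> - of_nat N * \<eta> + X" by (simp add: X_def algebra_simps)
    show ?thesis using fac_shift[of "\<alpha> - of_nat N * \<eta> + x" "2 * \<eta>" k] nz
      unfolding 1 2 F5_def[symmetric] s7_def[symmetric] s8_def[symmetric] by (simp add: field_simps)
  qed
  have F1': "fac (\<alpha> + \<eta> + x) \<eta> K = F1 * sK / A"
    using fac_shift[of "\<alpha> + x" \<eta> K] nz
    unfolding F1_def[symmetric] sK_def[symmetric] A_def[symmetric] by (simp add: field_simps)
  have F2': "fac (\<alpha> + \<eta> - x + \<eta>) \<eta> (K - k) = F2 * s3 / s4"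
  proof -
    have 1: "\<alpha> + \<eta> - x + \<eta> = \<alpha> - x + \<eta> + \<eta>" by (simp add: algebra_simps)
    show ?thesis using fac_shift[of "\<alpha> - x + \<eta>" \<eta> "K - k"] nz
      unfolding 1 F2_def[symmetric] s3_def[symmetric] s4_def[symmetric] by (simp add: field_simps)
  qed
  have args: "\<alpha> + \<eta> + x + of_nat (2 * k + K) * \<eta> = \<alpha> + X + of_nat (Suc K) * \<eta>" "\<alpha> + \<eta> + x = \<alpha> + x + \<eta>"
    "x - (\<alpha> + \<eta>) + (of_nat k - of_nat K) * \<eta> = x - \<alpha> + (of_nat k - of_nat (Suc K)) * \<eta>"
    "\<alpha> + \<eta> + x + of_nat (N + 2) * \<eta> = \<alpha> + x + of_nat (N + 3) * \<eta>"
    by (simp_all add: X_def algebra_simps)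
  have WN: "W \<eta> N (\<alpha> + \<eta>) x k K = sX1 / B * (F1 * sK / A) * (F2 * s3 / s4) / ((F3 * s3 / s6) * F4 * (F5 * s7 / s8))"
    unfolding W_def F1' F2' F5' args(1,3,4) F3' F4_def[symmetric] unfolding args sX1_def[symmetric] B_def[symmetric] ..
  have args0: "\<alpha> + x + of_nat (2 * k + K) * \<eta> = \<alpha> + X + of_nat K * \<eta>"
    "\<alpha> + x + of_nat (2 * k + Suc K) * \<eta> = \<alpha> + X + of_nat (Suc K) * \<eta>"
    "\<alpha> + x + of_nat (2 * Suc k + Suc K) * \<eta> = \<alpha> + X + of_nat (K + 3) * \<eta>"
    "Suc N + 2 = N + 3" "\<alpha> + x + (1 - of_nat (Suc N)) * \<eta> = \<alpha> - of_nat N * \<eta> + x"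
    "of_nat (Suc k) - of_nat (Suc K) = (of_nat k - of_nat K :: 'a)"
    "x - \<alpha> + (of_nat k - of_nat K) * \<eta> + of_nat k * \<eta> = X - \<alpha> - of_nat K * \<eta>"
    "\<alpha> + x + of_nat (N + 3) * \<eta> + of_nat k * (2 * \<eta>) = \<alpha> + X + of_nat (N + 3) * \<eta>"
    "\<alpha> - of_nat N * \<eta> + x + of_nat k * (2 * \<eta>) = \<alpha> - of_nat N * \<eta> + X"
    by (simp_all add: X_def algebra_simps)
  have W0: "W \<eta> (Suc N) \<alpha> x k K = sX0 / A * F1 * F2 / (F3 * F4 * F5)"
    unfolding W_def args0 F1_def F2_def F3_def F4_def F5_def sX0_def A_def ..
  have W1: "W \<eta> (Suc N) \<alpha> x k (Suc K) = sX1 / A * (F1 * sK) * (F2 * s3) / ((F3 * s3 / s6) * F4 * F5)"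
    unfolding W_def args0 F3' Suc_diff_le[OF k] fac_Suc F1_def F2_def F4_def F5_def sX1_def A_def sK_def s3_def ..
  have W2: "W \<eta> (Suc N) \<alpha> x (Suc k) (Suc K) = sX3 / A * (F1 * sK) * F2 / ((F3 * s12) * (F4 * s13) * (F5 * s7))"
    unfolding W_def diff_Suc_Suc args0 fac_Suc F1_def F2_def F3_def F4_def F5_def sX3_def A_def sK_def s12_def s13_def s7_def ..
  have b1: "br (\<alpha> + \<eta>) x = B * s4"
    unfolding br_def B_def s4_def by (intro arg_cong2[of _ _ _ _ "(*)"] arg_cong[of _ _ \<sigma>]) (simp_all add: algebra_simps)
  have b2: "br (\<alpha> - of_nat N * \<eta>) x = s8 * s9" unfolding br_def s8_def s9_def ..
  have b3: "br (\<alpha> - of_nat N * \<eta>) X = s7 * s10" unfolding br_def s7_def s10_def ..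
  have b4: "br (\<alpha> + of_nat (Suc K) * \<eta>) X = sX1 * s6"
    unfolding br_def sX1_def s6_def by (intro arg_cong2[of _ _ _ _ "(*)"] arg_cong[of _ _ \<sigma>]) (simp_all add: algebra_simps)
  have b5: "br X (\<alpha> + of_nat (Suc K) * \<eta>) = - (sX1 * s6)" unfolding b4[symmetric] by (rule br_commute)
  note cancel = mult_minus_left mult_minus_right minus_divide_left[symmetric] minus_divide_right[symmetric]
    times_divide_eq_right times_divide_eq_left divide_divide_eq_left divide_divide_eq_right
    neg_equal_iff_equal frac_eq_eq mult_eq_0_iff nz F_nz de_Morgan_disj simp_thms
  show ?stay
    unfolding b1 b2 b3 b4 WN W0 s10_def[symmetric] s9_def[symmetric] sK_def[symmetric] sX0_def[symmetric]
    by (simp only: cancel) (simp only: mult_ac)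
  show ?other
    unfolding b1 b2 b3 WN W1 s10_def[symmetric] s9_def[symmetric]
    by (simp only: cancel) (simp only: mult_ac)
  show ?self
    unfolding b1 b2 b5 WN W2 s12_def[symmetric] s13_def[symmetric] s9_def[symmetric] sX3_def[symmetric]
    by (simp only: cancel) (simp only: mult_ac)
qed

definition U :: "'a \<Rightarrow> nat \<Rightarrow> 'a \<Rightarrow> nat \<Rightarrow> 'b" where
  "U \<eta> N \<alpha> K = fac (2 * \<alpha> + \<eta>) (2 * \<eta>) K * (fac (of_nat (Suc N) * \<eta>) \<eta> K * fac (- of_nat N * \<eta>) \<eta> K)"

text \<open>The two forms are for keeping \<open>K\<close> and for raising it. The first contains
  \<open>\<sigma> ((of_nat (Suc N) - of_nat K) * \<eta>)\<close>, which vanishes at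
  \<open>K = Suc N\<close>; this will allow the range of summation to be enlarged.\<close>

lemma U_ratios:
  fixes \<alpha> \<eta> :: 'a
  assumes \<eta>: "\<And>n. n > 0 \<Longrightarrow> \<sigma> (of_nat n * \<eta>) \<noteq> 0" and \<alpha>: "\<sigma> (2 * \<alpha> + \<eta>) \<noteq> 0"
  shows "U \<eta> N (\<alpha> + \<eta>) K = U \<eta> (Suc N) \<alpha> K * (\<sigma> (2 * \<alpha> + of_nat (2 * K + 1) * \<eta>) * \<sigma> ((of_nat (Suc N) - of_nat K) * \<eta>)
      / (\<sigma> (2 * \<alpha> + \<eta>) * \<sigma> (of_nat (Suc N + K) * \<eta>)))" (is ?stay)
    and "U \<eta> N (\<alpha> + \<eta>) K = U \<eta> (Suc N) \<alpha> (Suc K) * - (1 / (\<sigma> (2 * \<alpha> + \<eta>) * \<sigma> (of_nat (Suc N + K) * \<eta>) * \<sigma> (of_nat (Suc N + Suc K) * \<eta>)))" (is ?move)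
proof -
  define a where "a = \<sigma> (2 * \<alpha> + \<eta>)"
  define b where "b = \<sigma> (2 * \<alpha> + of_nat (2 * K + 1) * \<eta>)"
  define c where "c = \<sigma> (of_nat (Suc N) * \<eta>)"
  define d where "d = \<sigma> (of_nat (Suc N + K) * \<eta>)"
  define d' where "d' = \<sigma> (of_nat (Suc N + Suc K) * \<eta>)"
  define e where "e = \<sigma> ((of_nat (Suc N) - of_nat K) * \<eta>)"
  define F1 where "F1 = fac (2 * \<alpha> + \<eta>) (2 * \<eta>) K"
  define F2 where "F2 = fac (of_nat (Suc N) * \<eta>) \<eta> K"
  define F3 where "F3 = fac (- of_nat N * \<eta>) \<eta> K"
  have nz: "a \<noteq> 0" "c \<noteq> 0" "d \<noteq> 0" "d' \<noteq> 0" unfolding a_def c_def d_def d'_def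
    by (rule \<alpha>) (rule \<eta>, simp)+
  have 1: "fac (2 * (\<alpha> + \<eta>) + \<eta>) (2 * \<eta>) K * a = F1 * b"
    using fac_shift[of "2 * \<alpha> + \<eta>" "2 * \<eta>" K] unfolding a_def b_def F1_def
    by (simp add: algebra_simps)
  have 2: "fac (of_nat (Suc (Suc N)) * \<eta>) \<eta> K * c = F2 * d"
    using fac_shift[of "of_nat (Suc N) * \<eta>" \<eta> K] unfolding c_def d_def F2_def
    by (simp add: algebra_simps)
  have c': "\<sigma> (- of_nat (Suc N) * \<eta>) = - c"
    unfolding c_def odd[symmetric] by (rule arg_cong[of _ _ \<sigma>]) (simp add: algebra_simps)
  have 3: "F3 * c = fac (- of_nat (Suc N) * \<eta>) \<eta> K * e"
  proof -
    have 1: "- of_nat (Suc N) * \<eta> + \<eta> = - of_nat N * \<eta>" by (simp add: algebra_simps)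
    have 2: "\<sigma> (- of_nat (Suc N) * \<eta> + of_nat K * \<eta>) = - e"
      unfolding e_def odd[symmetric] by (rule arg_cong[of _ _ \<sigma>]) (simp add: algebra_simps)
    show ?thesis using fac_shift[of "- of_nat (Suc N) * \<eta>" \<eta> K] unfolding 1 2 c' F3_def by simp
  qed
  have e1: "fac (2 * (\<alpha> + \<eta>) + \<eta>) (2 * \<eta>) K = F1 * b / a" using 1 nz by (simp add: field_simps)
  have e2: "fac (of_nat (Suc (Suc N)) * \<eta>) \<eta> K = F2 * d / c" using 2 nz by (simp add: field_simps)
  have e3: "F3 = fac (- of_nat (Suc N) * \<eta>) \<eta> K * e / c" using 3 nz by (simp add: field_simps)
  show ?stay
    unfolding U_def e1 e2 F1_def[symmetric] F2_def[symmetric] F3_def[symmetric] e3 a_def[symmetric] b_def[symmetric] d_def[symmetric] e_def[symmetric]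
    using nz by (simp add: mult_ac)
  have f1: "fac (2 * \<alpha> + \<eta>) (2 * \<eta>) (Suc K) = a * (F1 * b / a)"
    unfolding fac_Suc_shift a_def[symmetric] e1[symmetric] by (simp add: algebra_simps)
  have f2: "fac (of_nat (Suc (Suc N)) * \<eta>) \<eta> (Suc K) = F2 * d / c * d'"
    unfolding fac_Suc e2 d'_def by (simp add: algebra_simps)
  have f3: "fac (- of_nat (Suc N) * \<eta>) \<eta> (Suc K) = - c * F3"
    unfolding fac_Suc_shift c' F3_def by (simp add: algebra_simps)
  show ?move
    unfolding U_def e1 f1 f2 f3 F1_def[symmetric] F2_def[symmetric] F3_def[symmetric] a_def[symmetric] d_def[symmetric] d'_def[symmetric]
    using nz by (simp add: mult_ac)
qed

end

section \<open>The sum in logarithmic variables\<close>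

lemma weight_update: "i \<in> {1..r} \<Longrightarrow> weight r (k(i := Suc (k i))) = Suc (weight r k)"
proof -
  assume i: "i \<in> {1..r}"
  have "(\<Sum>l\<in>{1..r} - {i}. (k(i := Suc (k i))) l) = (\<Sum>l\<in>{1..r} - {i}. k l)"
    by (intro sum.cong) auto
  then show ?thesis
    using sum.remove[OF _ i, of "k(i := Suc (k i))"] sum.remove[OF _ i, of k] by (simp add: weight_def)
qed

lemma le_weight: "i \<in> {1..r} \<Longrightarrow> k i \<le> weight r k"
  unfolding weight_def by (rule member_le_sum) auto

text \<open>In the application the assumption on \<open>\<eta>\<close> comes from q^n not being an
  integral power of p.\<close>

locale quadratic_sum = three_term \<sigma> for \<sigma> :: "'a :: field_char_0 \<Rightarrow> 'b :: field_char_0" +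
  fixes \<eta> :: 'a and r :: nat and \<xi> :: "nat \<Rightarrow> 'a"
  assumes \<eta>: "\<And>n. n > 0 \<Longrightarrow> \<sigma> (of_nat n * \<eta>) \<noteq> 0"
begin

definition pos :: "(nat \<Rightarrow> nat) \<Rightarrow> nat \<Rightarrow> 'a" where
  "pos k i = \<xi> i + 2 * of_nat (k i) * \<eta>"

definition V :: "(nat \<Rightarrow> nat) \<Rightarrow> 'b" where
  "V k = (\<Prod>i=1..r. \<Prod>j\<in>{i<..r}. \<sigma> (pos k i - pos k j) / \<sigma> (\<xi> i - \<xi> j) / fac (\<xi> i + \<xi> j) (2 * \<eta>) (k i + k j))
    / (\<Prod>i=1..r. \<Prod>j=1..r. fac (2 * \<eta> + \<xi> i - \<xi> j) (2 * \<eta>) (k i))"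

text \<open>The part of the \<open>k\<close>-th summand that does not involve the \<open>b\<^sub>j\<close>; the denominators with \<open>N\<close> and
  the last product of the statement are in \<open>W\<close>, apart from the \<open>b\<^sub>j\<close>.\<close>

definition C :: "nat \<Rightarrow> 'a \<Rightarrow> (nat \<Rightarrow> nat) \<Rightarrow> 'b" where
  "C N \<alpha> k = V k * U \<eta> N \<alpha> (weight r k) * (\<Prod>i=1..r. W \<eta> N \<alpha> (\<xi> i) (k i) (weight r k))"

text \<open>The ranges are those of the differences k_i - k_j and of the factors of the factorials
  of length k_i + k_j, for |k| at most \<open>N\<close>. The condition is free of
  \<open>\<alpha>\<close> and so is unaffected by the shifts in the induction.\<close>

definition separated :: "nat \<Rightarrow> bool" where
  "separated N \<longleftrightarrow> (\<forall>i\<in>{1..r}. \<forall>j\<in>{1..r}. i \<noteq> j \<longrightarrow>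
     (\<forall>s::int. \<bar>s\<bar> \<le> int N \<longrightarrow> \<sigma> (\<xi> i - \<xi> j + 2 * of_int s * \<eta>) \<noteq> 0) \<and>
     (\<forall>s<N. \<sigma> (\<xi> i + \<xi> j + 2 * of_nat s * \<eta>) \<noteq> 0))"

text \<open>All integer shifts are excluded, so that the condition is stable under replacing
  \<open>\<alpha>\<close> by \<open>\<alpha> + \<eta>\<close>, as the induction on the level
  requires.\<close>

definition generic :: "'a \<Rightarrow> bool" where
  "generic \<alpha> \<longleftrightarrow> (\<forall>s::int. \<sigma> (2 * \<alpha> + of_int s * \<eta>) \<noteq> 0 \<and>
     (\<forall>i\<in>{1..r}. \<sigma> (\<alpha> + \<xi> i + of_int s * \<eta>) \<noteq> 0 \<and> \<sigma> (\<alpha> - \<xi> i + of_int s * \<eta>) \<noteq> 0))"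

lemma generic_2: "generic \<alpha> \<Longrightarrow> u = 2 * \<alpha> + of_int s * \<eta> \<Longrightarrow> \<sigma> u \<noteq> 0"
  and generic_plus: "generic \<alpha> \<Longrightarrow> i \<in> {1..r} \<Longrightarrow> u = \<alpha> + \<xi> i + of_int s * \<eta> \<Longrightarrow> \<sigma> u \<noteq> 0"
  and generic_minus: "generic \<alpha> \<Longrightarrow> i \<in> {1..r} \<Longrightarrow> u = \<alpha> - \<xi> i + of_int s * \<eta> \<Longrightarrow> \<sigma> u \<noteq> 0"
  unfolding generic_def by blast+

lemma generic_shift:
  assumes "generic \<alpha>"
  shows "generic (\<alpha> + \<eta>)"
  unfolding generic_def
proof (intro allI ballI conjI)
  fix s :: int
  show "\<sigma> (2 * (\<alpha> + \<eta>) + of_int s * \<eta>) \<noteq> 0"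
    by (rule generic_2[OF assms, of _ "s + 2"]) (simp add: algebra_simps)
  fix i assume i: "i \<in> {1..r}"
  show "\<sigma> (\<alpha> + \<eta> + \<xi> i + of_int s * \<eta>) \<noteq> 0"
    by (rule generic_plus[OF assms i, of _ "s + 1"]) (simp add: algebra_simps)
  show "\<sigma> (\<alpha> + \<eta> - \<xi> i + of_int s * \<eta>) \<noteq> 0"
    by (rule generic_minus[OF assms i, of _ "s + 1"]) (simp add: algebra_simps)
qed

lemma separated_diff:
  assumes "separated N" "i \<in> {1..r}" "j \<in> {1..r}" "i \<noteq> j" "m \<le> N" "n \<le> N"
    "u = \<xi> i + 2 * of_nat m * \<eta> - (\<xi> j + 2 * of_nat n * \<eta>)"
  shows "\<sigma> u \<noteq> 0"
proof -
  have "u = \<xi> i - \<xi> j + 2 * of_int (int m - int n) * \<eta>" using assms(7) by (simp add: algebra_simps)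
  moreover have "\<bar>int m - int n\<bar> \<le> int N" using assms(5,6) by auto
  ultimately show ?thesis using assms(1-4) unfolding separated_def by blast
qed

lemma separated_br:
  assumes "separated (Suc N)" "k \<in> multi_indices r N" "i \<in> {1..r}" "j \<in> {1..r}" "i \<noteq> j"
  shows "br (pos k i) (pos k j) \<noteq> 0"
proof -
  have w: "weight r k \<le> N" using assms(2) by (simp add: multi_indices_def)
  have "k i + k j \<le> weight r k"
  proof -
    have "sum k {i, j} \<le> weight r k"
      unfolding weight_def by (rule sum_mono2) (use assms(3,4) in auto)
    then show ?thesis using assms(5) by simp
  qed
  then have s: "k i + k j < Suc N" using w by simp
  have "pos k i + pos k j = \<xi> i + \<xi> j + 2 * of_nat (k i + k j) * \<eta>"
    by (simp add: pos_def algebra_simps)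
  moreover have "\<forall>s<Suc N. \<sigma> (\<xi> i + \<xi> j + 2 * of_nat s * \<eta>) \<noteq> 0"
    using assms(1,3-5) unfolding separated_def by blast
  ultimately have "\<sigma> (pos k i + pos k j) \<noteq> 0" using s by (simp only: simp_thms)
  moreover have "\<sigma> (pos k i - pos k j) \<noteq> 0"
    by (rule separated_diff[OF assms(1,3-5), of "k i" "k j"]) (use s in \<open>auto simp: pos_def\<close>)
  ultimately show ?thesis by (simp add: br_def)
qed

text \<open>The Delta quotient puts \<open>\<sigma> (pos k i - pos k l)\<close> into the denominator
  and the factorial of x_i x_l puts \<open>\<sigma> (pos k i + pos k l)\<close> there; together they
  form the bracket by which type C interpolation divides.\<close>

lemma V_update:
  assumes i: "i \<in> {1..r}" and nz: "\<And>l. l \<in> {1..r} - {i} \<Longrightarrow> \<sigma> (pos k i - pos k l) \<noteq> 0"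
  shows "V (k(i := Suc (k i))) = V k * (\<Prod>l\<in>{1..r} - {i}. \<sigma> (pos k i + 2 * \<eta> - pos k l) / br (pos k i) (pos k l))
     / (\<Prod>j=1..r. \<sigma> (pos k i + 2 * \<eta> - \<xi> j))"
proof -
  let ?k = "k(i := Suc (k i))"
  let ?g = "\<lambda>l. \<sigma> (pos k i + 2 * \<eta> - pos k l) / br (pos k i) (pos k l)"
  have pos_i: "pos ?k i = pos k i + 2 * \<eta>" by (simp add: pos_def algebra_simps)
  have pos_l: "pos ?k l = pos k l" if "l \<noteq> i" for l using that by (simp add: pos_def)
  have facS: "fac (\<xi> a + \<xi> b) (2 * \<eta>) (Suc (k a + k b)) = fac (\<xi> a + \<xi> b) (2 * \<eta>) (k a + k b) * \<sigma> (pos k a + pos k b)" for a b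
    unfolding fac_Suc by (intro arg_cong2[of _ _ _ _ "(*)"] arg_cong[of _ _ \<sigma>] refl) (simp add: pos_def algebra_simps)
  have num: "(\<Prod>i'=1..r. \<Prod>j\<in>{i'<..r}. \<sigma> (pos ?k i' - pos ?k j) / \<sigma> (\<xi> i' - \<xi> j) / fac (\<xi> i' + \<xi> j) (2 * \<eta>) (?k i' + ?k j))
     = (\<Prod>i'=1..r. \<Prod>j\<in>{i'<..r}. \<sigma> (pos k i' - pos k j) / \<sigma> (\<xi> i' - \<xi> j) / fac (\<xi> i' + \<xi> j) (2 * \<eta>) (k i' + k j))
       * (\<Prod>l\<in>{1..r} - {i}. ?g l)"
  proof (rule prod_pairs_update[OF i])
    fix l assume l: "l \<in> {1..<i}"
    then have li: "l \<noteq> i" and nzl: "\<sigma> (pos k i - pos k l) \<noteq> 0" using nz i by auto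
    have "?k l + ?k i = Suc (k l + k i)" using li by simp
    then show "\<sigma> (pos ?k l - pos ?k i) / \<sigma> (\<xi> l - \<xi> i) / fac (\<xi> l + \<xi> i) (2 * \<eta>) (?k l + ?k i)
      = \<sigma> (pos k l - pos k i) / \<sigma> (\<xi> l - \<xi> i) / fac (\<xi> l + \<xi> i) (2 * \<eta>) (k l + k i) * ?g l"
      unfolding pos_i pos_l[OF li] br_def odd_diff[of "pos k l"] add.commute[of "pos k i" "pos k l"]
      using nzl by (simp only: facS) simp
  next
    fix l assume l: "l \<in> {i<..r}"
    then have li: "l \<noteq> i" and nzl: "\<sigma> (pos k i - pos k l) \<noteq> 0" using nz i by auto
    have "?k i + ?k l = Suc (k i + k l)" using li by simp
    then show "\<sigma> (pos ?k i - pos ?k l) / \<sigma> (\<xi> i - \<xi> l) / fac (\<xi> i + \<xi> l) (2 * \<eta>) (?k i + ?k l)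
      = \<sigma> (pos k i - pos k l) / \<sigma> (\<xi> i - \<xi> l) / fac (\<xi> i + \<xi> l) (2 * \<eta>) (k i + k l) * ?g l"
      unfolding pos_i pos_l[OF li] br_def
      using nzl by (simp only: facS) simp
  qed (auto simp: pos_l)
  have arg: "2 * \<eta> + \<xi> i - \<xi> j + of_nat (k i) * (2 * \<eta>) = pos k i + 2 * \<eta> - \<xi> j" for j
    by (simp add: pos_def algebra_simps)
  have "(\<Prod>i'=1..r. \<Prod>j=1..r. fac (2 * \<eta> + \<xi> i' - \<xi> j) (2 * \<eta>) (?k i'))
    = (\<Prod>j=1..r. fac (2 * \<eta> + \<xi> i - \<xi> j) (2 * \<eta>) (Suc (k i)))
      * (\<Prod>i'\<in>{1..r} - {i}. \<Prod>j=1..r. fac (2 * \<eta> + \<xi> i' - \<xi> j) (2 * \<eta>) (k i'))"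
    by (subst prod.remove[OF _ i]) (auto intro!: arg_cong2[of _ _ _ _ "(*)"] prod.cong)
  also have "\<dots> = (\<Prod>j=1..r. \<sigma> (pos k i + 2 * \<eta> - \<xi> j)) * ((\<Prod>j=1..r. fac (2 * \<eta> + \<xi> i - \<xi> j) (2 * \<eta>) (k i))
      * (\<Prod>i'\<in>{1..r} - {i}. \<Prod>j=1..r. fac (2 * \<eta> + \<xi> i' - \<xi> j) (2 * \<eta>) (k i')))"
    unfolding fac_Suc arg prod.distrib by (simp only: mult_ac)
  also have "(\<Prod>j=1..r. fac (2 * \<eta> + \<xi> i - \<xi> j) (2 * \<eta>) (k i))
      * (\<Prod>i'\<in>{1..r} - {i}. \<Prod>j=1..r. fac (2 * \<eta> + \<xi> i' - \<xi> j) (2 * \<eta>) (k i'))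
    = (\<Prod>i'=1..r. \<Prod>j=1..r. fac (2 * \<eta> + \<xi> i' - \<xi> j) (2 * \<eta>) (k i'))"
    by (rule prod.remove[OF _ i, symmetric]) simp
  finally have den: "(\<Prod>i'=1..r. \<Prod>j=1..r. fac (2 * \<eta> + \<xi> i' - \<xi> j) (2 * \<eta>) (?k i'))
    = (\<Prod>j=1..r. \<sigma> (pos k i + 2 * \<eta> - \<xi> j)) * (\<Prod>i'=1..r. \<Prod>j=1..r. fac (2 * \<eta> + \<xi> i' - \<xi> j) (2 * \<eta>) (k i'))" .
  show ?thesis unfolding V_def num den
    by (simp only: divide_inverse inverse_mult_distrib mult_ac)
qed

text \<open>The constant is forced by k = 0, whose coefficient is 1 at every level and whose share
  \<open>stay\<close> is 1 as well.\<close>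

definition mu :: "nat \<Rightarrow> 'a \<Rightarrow> 'b" where
  "mu N \<alpha> = (\<Prod>l=1..r. br (\<alpha> + \<eta>) (\<xi> l) / br (\<alpha> - of_nat N * \<eta>) (\<xi> l))"

text \<open>The coefficient of \<open>k\<close> at level \<open>N + 1\<close> comes from those of \<open>k\<close> and of the \<open>k - e\<^sub>i\<close> at level \<open>N\<close>;
  \<open>stay\<close> and \<open>move\<close> are the respective shares.\<close>

definition stay :: "nat \<Rightarrow> 'a \<Rightarrow> (nat \<Rightarrow> nat) \<Rightarrow> 'b" where
  "stay N \<alpha> k = (let K = weight r k in
    \<sigma> (2 * \<alpha> + of_nat (2 * K + 1) * \<eta>) * \<sigma> ((of_nat (Suc N) - of_nat K) * \<eta>)
      / (\<sigma> (2 * \<alpha> + \<eta>) * \<sigma> (of_nat (Suc N + K) * \<eta>))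
    * (\<Prod>l=1..r. \<sigma> (\<alpha> - of_nat N * \<eta> - pos k l) / \<sigma> (\<alpha> - of_nat N * \<eta> - \<xi> l)
        * (\<sigma> (\<alpha> + \<xi> l + of_nat K * \<eta>) / \<sigma> (\<alpha> + pos k l + of_nat K * \<eta>))))"

definition move :: "nat \<Rightarrow> 'a \<Rightarrow> (nat \<Rightarrow> nat) \<Rightarrow> nat \<Rightarrow> 'b" where
  "move N \<alpha> k i = (let K = weight r k in
    - ((\<Prod>j=1..r. \<sigma> (pos k i - \<xi> j)) / (\<Prod>l\<in>{1..r} - {i}. \<sigma> (pos k i - pos k l))
      * (\<Prod>l\<in>{1..r} - {i}. \<sigma> (\<alpha> - of_nat N * \<eta> - pos k l)) / (\<Prod>l=1..r. \<sigma> (\<alpha> - of_nat N * \<eta> - \<xi> l))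
      * (\<sigma> (2 * \<alpha> + (of_nat K - of_nat N) * \<eta>) / (\<sigma> (2 * \<alpha> + \<eta>) * \<sigma> (of_nat (Suc N + K) * \<eta>)))
      * (\<sigma> (pos k i - \<alpha> - of_nat (Suc K) * \<eta>) * \<sigma> (\<alpha> + pos k i + of_nat (Suc N) * \<eta>) / \<sigma> (\<alpha> + pos k i + of_nat K * \<eta>))))"

text \<open>As \<open>k\<close> is kept, \<open>V\<close> does not change. The factor depending on
  |k| follows \<open>U_ratios\<close>, and each coordinate follows the first identity of
  \<open>W_ratios\<close>.\<close>

lemma C_stay:
  assumes \<alpha>: "generic \<alpha>" and K: "K = weight r k"
  shows "mu N \<alpha> * (\<Prod>l=1..r. br (\<alpha> - of_nat N * \<eta>) (pos k l) / br (\<alpha> + of_nat (Suc K) * \<eta>) (pos k l)) * C N (\<alpha> + \<eta>) k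
    = C (Suc N) \<alpha> k * stay N \<alpha> k"
proof -
  have W: "br (\<alpha> + \<eta>) (\<xi> l) / br (\<alpha> - of_nat N * \<eta>) (\<xi> l) * (br (\<alpha> - of_nat N * \<eta>) (pos k l) / br (\<alpha> + of_nat (Suc K) * \<eta>) (pos k l))
        * W \<eta> N (\<alpha> + \<eta>) (\<xi> l) (k l) K
      = W \<eta> (Suc N) \<alpha> (\<xi> l) (k l) K * (\<sigma> (\<alpha> - of_nat N * \<eta> - pos k l) / \<sigma> (\<alpha> - of_nat N * \<eta> - \<xi> l)
        * (\<sigma> (\<alpha> + \<xi> l + of_nat K * \<eta>) / \<sigma> (\<alpha> + pos k l + of_nat K * \<eta>)))" if l: "l \<in> {1..r}" for l
    unfolding pos_def
    by (rule W_ratios(1)) (use \<alpha> l le_weight[OF l, of k] K in \<open>auto simp: generic_def\<close>)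
  have "mu N \<alpha> * (\<Prod>l=1..r. br (\<alpha> - of_nat N * \<eta>) (pos k l) / br (\<alpha> + of_nat (Suc K) * \<eta>) (pos k l))
      * (\<Prod>l=1..r. W \<eta> N (\<alpha> + \<eta>) (\<xi> l) (k l) K)
    = (\<Prod>l=1..r. W \<eta> (Suc N) \<alpha> (\<xi> l) (k l) K) * (\<Prod>l=1..r. \<sigma> (\<alpha> - of_nat N * \<eta> - pos k l) / \<sigma> (\<alpha> - of_nat N * \<eta> - \<xi> l)
        * (\<sigma> (\<alpha> + \<xi> l + of_nat K * \<eta>) / \<sigma> (\<alpha> + pos k l + of_nat K * \<eta>)))"
    unfolding mu_def prod.distrib[symmetric] by (rule prod.cong[OF refl]) (rule W)
  moreover have "U \<eta> N (\<alpha> + \<eta>) K = U \<eta> (Suc N) \<alpha> K * (\<sigma> (2 * \<alpha> + of_nat (2 * K + 1) * \<eta>) * \<sigma> ((of_nat (Suc N) - of_nat K) * \<eta>)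
      / (\<sigma> (2 * \<alpha> + \<eta>) * \<sigma> (of_nat (Suc N + K) * \<eta>)))"
    by (rule U_ratios(1), erule \<eta>, rule generic_2[OF \<alpha>, of _ 1], simp)
  moreover have "m * p * (v * (u * s) * w) = v * u * w' * (s * t)" if "m * p * w = w' * t" for m p v u s w w' t :: 'b
  proof -
    have "m * p * (v * (u * s) * w) = v * (u * s) * (m * p * w)" by (simp only: mult_ac)
    then show ?thesis unfolding that by (simp only: mult_ac)
  qed
  ultimately show ?thesis
    unfolding C_def stay_def Let_def K[symmetric] by (simp only:)
qed

text \<open>Coordinate \<open>i\<close> follows the third identity of \<open>W_ratios\<close>, the
  others the second. The mutual brackets of the nodes are absorbed by \<open>V_update\<close>.
  \<open>move\<close> is expressed through the raised index, because afterwards all contributions to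
  a fixed index are added.\<close>

lemma C_move:
  assumes \<alpha>: "generic \<alpha>" and sep: "separated (Suc N)" and k: "k \<in> multi_indices r N" and i: "i \<in> {1..r}"
    and K: "K = weight r k"
  shows "mu N \<alpha> * (br (\<alpha> - of_nat N * \<eta>) (\<alpha> + of_nat (Suc K) * \<eta>) / br (pos k i) (\<alpha> + of_nat (Suc K) * \<eta>)
      * (\<Prod>l\<in>{1..r} - {i}. br (\<alpha> - of_nat N * \<eta>) (pos k l) / br (pos k i) (pos k l))) * C N (\<alpha> + \<eta>) k
    = C (Suc N) \<alpha> (k(i := Suc (k i))) * move N \<alpha> (k(i := Suc (k i))) i"
proof -
  let ?k = "k(i := Suc (k i))" and ?I = "{1..r} - {i}"
  have kK: "k l \<le> K" if "l \<in> {1..r}" for l using le_weight[OF that, of k] K by simp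
  have KN: "K \<le> N" using k K by (simp add: multi_indices_def)
  define y where "y = \<alpha> - of_nat N * \<eta>"
  define X where "X = pos k i"
  define X' where "X' = pos k i + 2 * \<eta>"
  have pos_i: "pos ?k i = X'" by (simp add: pos_def X'_def algebra_simps)
  have pos_l: "pos ?k l = pos k l" if "l \<in> ?I" for l using that by (simp add: pos_def)
  define M where "M l = br (\<alpha> + \<eta>) (\<xi> l) / br y (\<xi> l)" for l
  define w where "w = \<sigma> (X - \<alpha> - of_nat K * \<eta>) * \<sigma> (\<alpha> + X + of_nat (N + 3) * \<eta>)
          / (\<sigma> (\<alpha> + X + of_nat (K + 3) * \<eta>) * \<sigma> (y - \<xi> i))"
  have W_i: "M i / br X (\<alpha> + of_nat (Suc K) * \<eta>) * W \<eta> N (\<alpha> + \<eta>) (\<xi> i) (k i) K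
      = W \<eta> (Suc N) \<alpha> (\<xi> i) (?k i) (Suc K) * - w"
    unfolding w_def M_def y_def X_def pos_def fun_upd_same
    by (rule W_ratios(3)) (use \<alpha> i kK in \<open>auto simp: generic_def\<close>)
  have W_l: "M l * br y (pos k l) * W \<eta> N (\<alpha> + \<eta>) (\<xi> l) (k l) K
      = W \<eta> (Suc N) \<alpha> (\<xi> l) (?k l) (Suc K) * (\<sigma> (y - pos k l) / \<sigma> (y - \<xi> l))" if l: "l \<in> ?I" for l
  proof -
    have "?k l = k l" using l by simp
    then show ?thesis unfolding M_def y_def pos_def
      by (simp only:) (rule W_ratios(2), use \<alpha> l kK in \<open>auto simp: generic_def\<close>)
  qed
  define MI where "MI = (\<Prod>l\<in>?I. M l)"
  define BI where "BI = (\<Prod>l\<in>?I. br y (pos k l))"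
  define WI where "WI = (\<Prod>l\<in>?I. W \<eta> N (\<alpha> + \<eta>) (\<xi> l) (k l) K)"
  define WI' where "WI' = (\<Prod>l\<in>?I. W \<eta> (Suc N) \<alpha> (\<xi> l) (?k l) (Suc K))"
  define P where "P = (\<Prod>l\<in>?I. \<sigma> (y - pos k l))"
  define R where "R = (\<Prod>l\<in>?I. \<sigma> (y - \<xi> l))"
  define D where "D = (\<Prod>l\<in>?I. br X (pos k l))"
  define Q where "Q = (\<Prod>l\<in>?I. \<sigma> (X' - pos k l))"
  define Z where "Z = (\<Prod>j=1..r. \<sigma> (X' - \<xi> j))"
  have W_I: "MI * BI * WI = WI' * (P / R)"
    unfolding MI_def BI_def WI_def WI'_def P_def R_def prod.distrib[symmetric] prod_dividef[symmetric]
    by (rule prod.cong[OF refl]) (rule W_l)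
  have brX: "br X (pos k l) \<noteq> 0" if "l \<in> ?I" for l
    unfolding X_def using separated_br[OF sep k i, of l] that by auto
  then have D_nz: "D \<noteq> 0" unfolding D_def by simp
  have Q_nz: "Q \<noteq> 0"
  proof -
    have "\<sigma> (X' - pos k l) \<noteq> 0" if l: "l \<in> ?I" for l
      by (rule separated_diff[OF sep i, of l "Suc (k i)" "k l"])
        (use l kK[of i] kK[of l] i KN in \<open>auto simp: X'_def pos_def algebra_simps\<close>)
    then show ?thesis unfolding Q_def by simp
  qed
  have Z_nz: "Z \<noteq> 0"
  proof -
    have "\<sigma> (X' - \<xi> j) \<noteq> 0" if j: "j \<in> {1..r}" for j
    proof (cases "j = i")
      case True
      then have "X' - \<xi> j = of_nat (2 * Suc (k i)) * \<eta>" by (simp add: X'_def pos_def algebra_simps)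
      then show ?thesis using \<eta>[of "2 * Suc (k i)"] by simp
    next
      case False
      then show ?thesis
        by (intro separated_diff[OF sep i j, of "Suc (k i)" 0])
          (use kK[of i] i KN in \<open>auto simp: X'_def pos_def algebra_simps\<close>)
    qed
    then show ?thesis unfolding Z_def by simp
  qed
  have "V ?k = V k * (Q / D) / Z"
    unfolding Q_def D_def Z_def X_def X'_def prod_dividef[symmetric]
    by (rule V_update[OF i]) (use brX in \<open>auto simp: br_def X_def\<close>)
  then have "V ?k * Z / Q = V k * (Q / D) / Z * Z / Q" by (simp only:)
  then have V: "V k / D = V ?k * Z / Q" using Q_nz Z_nz by simp
  define u where "u = \<sigma> (2 * \<alpha> + \<eta>)"
  define d where "d = \<sigma> (of_nat (Suc N + K) * \<eta>)"
  define d' where "d' = \<sigma> (of_nat (Suc N + Suc K) * \<eta>)"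
  have U: "U \<eta> N (\<alpha> + \<eta>) K = U \<eta> (Suc N) \<alpha> (Suc K) * - (1 / (u * d * d'))"
    unfolding u_def d_def d'_def by (rule U_ratios(2), erule \<eta>, rule generic_2[OF \<alpha>, of _ 1], simp)
  have d_nz: "d \<noteq> 0" unfolding d_def by (rule \<eta>) simp
  define v where "v = \<sigma> (2 * \<alpha> + (of_nat (Suc K) - of_nat N) * \<eta>)"
  \<comment> \<open>Of these two factors \<open>d\<close> cancels against the denominator in
    \<open>U\<close>, while \<open>v\<close> survives in \<open>move\<close>.\<close>
  have br_y: "br y (\<alpha> + of_nat (Suc K) * \<eta>) = - (v * d)"
  proof -
    have "y + (\<alpha> + of_nat (Suc K) * \<eta>) = 2 * \<alpha> + (of_nat (Suc K) - of_nat N) * \<eta>"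
      "y - (\<alpha> + of_nat (Suc K) * \<eta>) = - (of_nat (Suc N + K) * \<eta>)"
      by (simp_all add: y_def algebra_simps)
    then show ?thesis unfolding br_def v_def d_def by (simp only: odd mult_minus_right)
  qed
  have args: "X - \<alpha> - of_nat K * \<eta> = X' - \<alpha> - of_nat (Suc (Suc K)) * \<eta>"
    "\<alpha> + X + of_nat (N + 3) * \<eta> = \<alpha> + X' + of_nat (Suc N) * \<eta>"
    "\<alpha> + X + of_nat (K + 3) * \<eta> = \<alpha> + X' + of_nat (Suc K) * \<eta>"
    by (simp_all add: X_def X'_def algebra_simps)
  define f where "f = \<sigma> (X' - \<alpha> - of_nat (Suc (Suc K)) * \<eta>) * \<sigma> (\<alpha> + X' + of_nat (Suc N) * \<eta>) / \<sigma> (\<alpha> + X' + of_nat (Suc K) * \<eta>)"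
  have w: "w = f / \<sigma> (y - \<xi> i)" unfolding w_def f_def args by simp
  have move: "move N \<alpha> ?k i = - (Z / Q * P / (\<sigma> (y - \<xi> i) * R) * (v / (u * d')) * f)"
  proof -
    have 1: "(\<Prod>l\<in>?I. \<sigma> (X' - pos ?k l)) = Q" "(\<Prod>l\<in>?I. \<sigma> (y - pos ?k l)) = P"
      unfolding Q_def P_def by (rule prod.cong[OF refl], simp only: pos_l)+
    have 2: "(\<Prod>l=1..r. \<sigma> (y - \<xi> l)) = \<sigma> (y - \<xi> i) * R"
      unfolding R_def by (rule prod.remove[OF _ i]) simp
    show ?thesis
      unfolding move_def Let_def weight_update[OF i] K[symmetric] pos_i y_def[symmetric] 1 2
        Z_def u_def d'_def v_def f_def ..
  qed
  have mu: "mu N \<alpha> = M i * MI"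
    unfolding mu_def y_def[symmetric] M_def[symmetric] MI_def by (rule prod.remove[OF _ i]) simp
  have prodW: "(\<Prod>l=1..r. W \<eta> N (\<alpha> + \<eta>) (\<xi> l) (k l) K) = W \<eta> N (\<alpha> + \<eta>) (\<xi> i) (k i) K * WI"
    unfolding WI_def by (rule prod.remove[OF _ i]) simp
  have prodW': "(\<Prod>l=1..r. W \<eta> (Suc N) \<alpha> (\<xi> l) (?k l) (Suc K)) = W \<eta> (Suc N) \<alpha> (\<xi> i) (?k i) (Suc K) * WI'"
    unfolding WI'_def by (rule prod.remove[OF _ i]) simp
  define w_i where "w_i = W \<eta> N (\<alpha> + \<eta>) (\<xi> i) (k i) K"
  define w_i' where "w_i' = W \<eta> (Suc N) \<alpha> (\<xi> i) (?k i) (Suc K)"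
  define b where "b = br X (\<alpha> + of_nat (Suc K) * \<eta>)"
  define u1 where "u1 = U \<eta> (Suc N) \<alpha> (Suc K)"
  have "mu N \<alpha> * (br y (\<alpha> + of_nat (Suc K) * \<eta>) / b * (BI / D)) * C N (\<alpha> + \<eta>) k
     = (M i * MI) * (- (v * d) / b * (BI / D)) * (V k * (u1 * - (1 / (u * d * d'))) * (w_i * WI))"
    unfolding C_def K[symmetric] prodW U mu br_y w_i_def u1_def ..
  also have "\<dots> = (M i / b * w_i) * (MI * BI * WI) * (V k / D) * (u1 * (v * d / (u * d * d')))"
    by (simp add: divide_inverse mult_ac)
  also have "\<dots> = (w_i' * - (f / \<sigma> (y - \<xi> i))) * (WI' * (P / R)) * (V ?k * Z / Q) * (u1 * (v / (u * d')))"
    unfolding W_I V W_i[unfolded w, folded b_def w_i_def w_i'_def] using d_nz by simp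
  also have "\<dots> = (V ?k * u1 * (w_i' * WI')) * - (Z / Q * P / (\<sigma> (y - \<xi> i) * R) * (v / (u * d')) * f)"
    by (simp add: divide_inverse mult_ac)
  also have "\<dots> = C (Suc N) \<alpha> ?k * move N \<alpha> ?k i"
    unfolding C_def weight_update[OF i] K[symmetric] prodW' move u1_def w_i'_def ..
  finally show ?thesis
    unfolding b_def BI_def D_def prod_dividef X_def y_def .
qed

text \<open>Type A interpolation at \<open>t\<close> with nodes \<open>y0\<close> and
  \<open>pos k l\<close> and with zeros \<open>z0\<close> and \<open>\<xi> l\<close>, divided by its
  left-hand side \<open>u * d * R\<close>. Node \<open>y0\<close> contributes \<open>stay\<close>
  and node \<open>pos k i\<close> contributes \<open>move\<close>. Since
  \<open>pos k l - \<xi> l\<close> is \<open>2 * of_nat (k l) * \<eta>\<close>, the full sum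
  \<open>S r\<close> collapses to \<open>- (2 * \<alpha> + \<eta>)\<close>, whatever
  \<open>k\<close> is.\<close>

lemma stay_move_sum:
  assumes \<alpha>: "generic \<alpha>" and sep: "separated (Suc N)" and k: "k \<in> multi_indices r (Suc N)"
  shows "stay N \<alpha> k + (\<Sum>i=1..r. move N \<alpha> k i) = 1"
proof -
  define K where "K = weight r k"
  have kN: "k l \<le> Suc N" if "l \<in> {1..r}" for l
    using le_weight[OF that, of k] k by (simp add: multi_indices_def)
  define y0 where "y0 = - \<alpha> - of_nat K * \<eta>"
  define z0 where "z0 = \<alpha> + of_nat (Suc K) * \<eta>"
  define t where "t = \<alpha> - of_nat N * \<eta>"
  define S where "S m = y0 - z0 + (\<Sum>l=1..m. pos k l - \<xi> l)" for m
  \<comment> \<open>This form lets genericity of \<open>\<alpha>\<close> exclude a zero of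
    \<open>\<sigma>\<close> at every partial sum.\<close>
  have S: "S m = - (2 * \<alpha> + of_int (2 * int K + 1 - 2 * (\<Sum>l=1..m. int (k l))) * \<eta>)" for m
  proof -
    have "(\<Sum>l=1..m. pos k l - \<xi> l) = of_int (2 * (\<Sum>l=1..m. int (k l))) * \<eta>"
      by (simp add: pos_def sum_distrib_left sum_distrib_right)
    then show ?thesis by (simp add: S_def y0_def z0_def algebra_simps)
  qed
  have "(\<Sum>l=1..r. int (k l)) = int K" by (simp add: K_def weight_def)
  then have Sr: "S r = - (2 * \<alpha> + \<eta>)" unfolding S by (simp add: algebra_simps)
  have pos_plus: "\<sigma> (\<alpha> + pos k l + of_nat K * \<eta>) \<noteq> 0" if "l \<in> {1..r}" for l
    by (rule generic_plus[OF \<alpha> that, of _ "2 * int (k l) + int K"]) (simp add: pos_def algebra_simps)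
  have y0_X: "y0 - pos k l = - (\<alpha> + pos k l + of_nat K * \<eta>)" for l by (simp add: y0_def)
  define u where "u = \<sigma> (2 * \<alpha> + \<eta>)"
  define d where "d = \<sigma> (of_nat (Suc N + K) * \<eta>)"
  define v where "v = \<sigma> (2 * \<alpha> + (of_nat K - of_nat N) * \<eta>)"
  define R where "R = (\<Prod>l=1..r. \<sigma> (t - \<xi> l))"
  have u_nz: "u \<noteq> 0" unfolding u_def by (rule generic_2[OF \<alpha>, of _ 1]) simp
  have d_nz: "d \<noteq> 0" unfolding d_def by (rule \<eta>) simp
  have R_nz: "R \<noteq> 0"
  proof -
    have "\<sigma> (t - \<xi> l) \<noteq> 0" if "l \<in> {1..r}" for l
      by (rule generic_minus[OF \<alpha> that, of _ "- int N"]) (simp add: t_def)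
    then show ?thesis by (simp add: R_def)
  qed
  have s_tz: "\<sigma> (t - z0) = - d"
    unfolding d_def odd[symmetric] by (rule arg_cong[of _ _ \<sigma>]) (simp add: t_def z0_def algebra_simps)
  have s_S: "\<sigma> (S r) = - u" unfolding u_def odd[symmetric] Sr ..
  let ?F = "\<sigma> (y0 - z0) * (\<Prod>j=1..r. \<sigma> (y0 - \<xi> j)) * \<sigma> (t - y0 + S r) * (\<Prod>l=1..r. \<sigma> (t - pos k l) / \<sigma> (y0 - pos k l))"
  let ?T = "\<lambda>i. \<sigma> (pos k i - z0) * (\<Prod>j=1..r. \<sigma> (pos k i - \<xi> j)) * \<sigma> (t - pos k i + S r) * (\<sigma> (t - y0) / \<sigma> (pos k i - y0))
        * (\<Prod>l\<in>{1..r} - {i}. \<sigma> (t - pos k l) / \<sigma> (pos k i - pos k l))"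
  let ?Q = "(\<Prod>l=1..r. \<sigma> (t - pos k l) / \<sigma> (t - \<xi> l) * (\<sigma> (\<alpha> + \<xi> l + of_nat K * \<eta>) / \<sigma> (\<alpha> + pos k l + of_nat K * \<eta>)))"
  have interp: "\<sigma> (t - z0) * (\<Prod>j=1..r. \<sigma> (t - \<xi> j)) * \<sigma> (S r) =
    ?F
    + (\<Sum>i=1..r. ?T i)"
    unfolding S_def
  proof (rule sigma_interpolation')
    fix l assume l: "l \<in> {1..r}"
    show "\<sigma> (y0 - pos k l) \<noteq> 0" unfolding y0_X odd using pos_plus[OF l] by simp
  next
    fix i l assume "i \<in> {1..r}" "l \<in> {1..r}" "i \<noteq> l"
    then show "\<sigma> (pos k i - pos k l) \<noteq> 0"
      by (intro separated_diff[OF sep, of i l "k i" "k l"]) (use kN in \<open>auto simp: pos_def\<close>)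
  next
    fix m
    show "\<sigma> (y0 - z0 + (\<Sum>l=1..m. pos k l - \<xi> l)) \<noteq> 0"
      unfolding S_def[symmetric] S odd neg_equal_0_iff_equal by (rule generic_2[OF \<alpha> refl])
  qed
  have first: "?F
    = u * d * R * stay N \<alpha> k"
  proof -
    define a where "a = \<sigma> (2 * \<alpha> + of_nat (2 * K + 1) * \<eta>)"
    define e where "e = \<sigma> ((of_nat (Suc N) - of_nat K) * \<eta>)"
    have 1: "\<sigma> (y0 - z0) = - a"
      unfolding a_def odd[symmetric] by (rule arg_cong[of _ _ \<sigma>]) (simp add: y0_def z0_def algebra_simps)
    have 2: "\<sigma> (t - y0 + S r) = - e"
      unfolding e_def odd[symmetric] Sr by (rule arg_cong[of _ _ \<sigma>]) (simp add: y0_def t_def algebra_simps)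
    have 3: "y0 - \<xi> j = - (\<alpha> + \<xi> j + of_nat K * \<eta>)" for j by (simp add: y0_def)
    have "(\<Prod>l=1..r. \<sigma> (y0 - \<xi> l)) * (\<Prod>l=1..r. \<sigma> (t - pos k l) / \<sigma> (y0 - pos k l))
      = R * ?Q"
      unfolding R_def prod.distrib[symmetric]
    proof (rule prod.cong[OF refl])
      fix l assume "l \<in> {1..r}"
      then have "\<sigma> (t - \<xi> l) \<noteq> 0" using R_nz by (simp add: R_def)
      then show "\<sigma> (y0 - \<xi> l) * (\<sigma> (t - pos k l) / \<sigma> (y0 - pos k l))
        = \<sigma> (t - \<xi> l) * (\<sigma> (t - pos k l) / \<sigma> (t - \<xi> l) * (\<sigma> (\<alpha> + \<xi> l + of_nat K * \<eta>) / \<sigma> (\<alpha> + pos k l + of_nat K * \<eta>)))"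
        unfolding y0_X 3 odd by simp
    qed
    then have "?F
      = a * e * (R * ?Q)"
      unfolding 1 2 by (simp add: mult_ac)
    also have "\<dots> = u * d * R * stay N \<alpha> k"
      unfolding stay_def Let_def K_def[symmetric] a_def[symmetric] e_def[symmetric] u_def[symmetric] d_def[symmetric] t_def[symmetric]
      using u_nz d_nz by (simp add: mult_ac)
    finally show ?thesis .
  qed
  have "?T i = u * d * R * move N \<alpha> k i" if i: "i \<in> {1..r}" for i
  proof -
    define f where "f = \<sigma> (\<alpha> + pos k i + of_nat (Suc N) * \<eta>)"
    define g where "g = \<sigma> (pos k i - \<alpha> - of_nat (Suc K) * \<eta>)"
    define h where "h = \<sigma> (\<alpha> + pos k i + of_nat K * \<eta>)"
    have 1: "\<sigma> (pos k i - z0) = g"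
      unfolding g_def by (rule arg_cong[of _ _ \<sigma>]) (simp add: z0_def algebra_simps)
    have 2: "\<sigma> (t - pos k i + S r) = - f"
      unfolding f_def odd[symmetric] Sr by (rule arg_cong[of _ _ \<sigma>]) (simp add: t_def algebra_simps)
    have 3: "\<sigma> (t - y0) = v"
      unfolding v_def by (rule arg_cong[of _ _ \<sigma>]) (simp add: t_def y0_def algebra_simps)
    have 4: "\<sigma> (pos k i - y0) = h"
      unfolding h_def by (rule arg_cong[of _ _ \<sigma>]) (simp add: y0_def algebra_simps)
    show ?thesis
      unfolding 1 2 3 4 prod_dividef move_def Let_def K_def[symmetric] u_def[symmetric] d_def[symmetric]
        v_def[symmetric] t_def[symmetric] R_def[symmetric] f_def[symmetric] g_def[symmetric] h_def[symmetric]
      using u_nz d_nz R_nz by (simp add: mult_ac)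
  qed
  then have "(\<Sum>i=1..r. ?T i) = u * d * R * (\<Sum>i=1..r. move N \<alpha> k i)"
    by (simp add: sum_distrib_left)
  with interp have "u * d * R * 1 = u * d * R * (stay N \<alpha> k + (\<Sum>i=1..r. move N \<alpha> k i))"
    unfolding first s_tz s_S R_def[symmetric] distrib_left by (simp add: mult_ac)
  then have "1 = stay N \<alpha> k + (\<Sum>i=1..r. move N \<alpha> k i)"
    using u_nz d_nz R_nz mult_left_cancel[of "u * d * R" 1 "stay N \<alpha> k + (\<Sum>i=1..r. move N \<alpha> k i)"] by simp
  then show ?thesis by (rule sym)
qed

section \<open>The induction on N\<close>

definition P :: "nat \<Rightarrow> 'a \<Rightarrow> 'a \<Rightarrow> 'b" where
  "P N \<alpha> \<beta> = (\<Prod>s<N. br (\<alpha> + (1 - of_nat N + 2 * of_nat s) * \<eta>) \<beta>)"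

definition E :: "'a \<Rightarrow> 'a \<Rightarrow> nat \<Rightarrow> 'b" where
  "E u \<beta> n = (\<Prod>s<n. br (u + of_nat s * \<eta>) \<beta>)"

definition Phi :: "(nat \<Rightarrow> nat) \<Rightarrow> 'a \<Rightarrow> 'b" where
  "Phi k \<beta> = (\<Prod>i=1..r. \<Prod>s<k i. br (\<xi> i + 2 * of_nat s * \<eta>) \<beta>)"

text \<open>The sum multiplied by its common denominator in the b_j, the product of the
  \<open>E (\<alpha> + \<eta>) (\<beta> j) N\<close>. The factor \<open>E\<close> in the body is
  what the \<open>k\<close>-th denominator leaves of it.\<close>

definition G :: "nat \<Rightarrow> 'a \<Rightarrow> (nat \<Rightarrow> 'a) \<Rightarrow> 'b" where
  "G N \<alpha> \<beta> = (\<Sum>k\<in>multi_indices r N. C N \<alpha> k *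
     (\<Prod>j=1..r. Phi k (\<beta> j) * E (\<alpha> + of_nat (Suc (weight r k)) * \<eta>) (\<beta> j) (N - weight r k)))"

lemma P_Suc: "P (Suc N) \<alpha> \<beta> = br (\<alpha> - of_nat N * \<eta>) \<beta> * P N (\<alpha> + \<eta>) \<beta>"
proof -
  have "br (\<alpha> + (1 - of_nat (Suc N) + 2 * of_nat (Suc s)) * \<eta>) \<beta> = br (\<alpha> + \<eta> + (1 - of_nat N + 2 * of_nat s) * \<eta>) \<beta>" for s
    by (rule arg_cong[of _ _ "\<lambda>u. br u \<beta>"]) (simp add: algebra_simps)
  moreover have "br (\<alpha> + (1 - of_nat (Suc N) + 2 * of_nat 0) * \<eta>) \<beta> = br (\<alpha> - of_nat N * \<eta>) \<beta>"
    by (rule arg_cong[of _ _ "\<lambda>u. br u \<beta>"]) (simp add: algebra_simps)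
  ultimately show ?thesis
    unfolding P_def prod.lessThan_Suc_shift by (simp only:)
qed

lemma E_Suc: "E u \<beta> (Suc n) = br u \<beta> * E (u + \<eta>) \<beta> n"
proof -
  have "br (u + of_nat (Suc s) * \<eta>) \<beta> = br (u + \<eta> + of_nat s * \<eta>) \<beta>" for s
    by (rule arg_cong[of _ _ "\<lambda>u. br u \<beta>"]) (simp add: algebra_simps)
  then show ?thesis
    unfolding E_def prod.lessThan_Suc_shift by (simp only: of_nat_0 mult_zero_left add_0_right)
qed

lemma Phi_update:
  assumes i: "i \<in> {1..r}"
  shows "Phi (k(i := Suc (k i))) \<beta> = Phi k \<beta> * br (pos k i) \<beta>"
proof -
  let ?f = "\<lambda>k i. \<Prod>s<k i. br (\<xi> i + 2 * of_nat s * \<eta>) \<beta>"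
  have "Phi (k(i := Suc (k i))) \<beta> = ?f (k(i := Suc (k i))) i * (\<Prod>l\<in>{1..r} - {i}. ?f (k(i := Suc (k i))) l)"
    unfolding Phi_def by (rule prod.remove[OF _ i]) simp
  also have "(\<Prod>l\<in>{1..r} - {i}. ?f (k(i := Suc (k i))) l) = (\<Prod>l\<in>{1..r} - {i}. ?f k l)"
    by (rule prod.cong) auto
  also have "?f (k(i := Suc (k i))) i = br (pos k i) \<beta> * ?f k i"
    by (simp add: pos_def mult.commute)
  also have "br (pos k i) \<beta> * ?f k i * (\<Prod>l\<in>{1..r} - {i}. ?f k l) = br (pos k i) \<beta> * Phi k \<beta>"
    unfolding Phi_def mult.assoc by (subst prod.remove[OF _ i, symmetric]) simp_all
  finally show ?thesis by (simp only: mult.commute)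
qed

text \<open>For regrouping the steps in direction \<open>i\<close> by their targets.\<close>

lemma multi_indices_Suc_bij:
  assumes i: "i \<in> {1..r}"
  shows "bij_betw (\<lambda>k. k(i := Suc (k i))) (multi_indices r N) {k \<in> multi_indices r (Suc N). k i \<noteq> 0}"
proof (rule bij_betw_byWitness[where f' = "\<lambda>k. k(i := k i - 1)"])
  show "\<forall>k\<in>multi_indices r N. (k(i := Suc (k i)))(i := (k(i := Suc (k i))) i - 1) = k" by simp
  show "\<forall>k\<in>{k \<in> multi_indices r (Suc N). k i \<noteq> 0}. (k(i := k i - 1))(i := Suc ((k(i := k i - 1)) i)) = k"
    by (auto simp: fun_upd_idem)
  show "(\<lambda>k. k(i := Suc (k i))) ` multi_indices r N \<subseteq> {k \<in> multi_indices r (Suc N). k i \<noteq> 0}"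
    using i weight_update[OF i] by (auto simp: multi_indices_def PiE_iff extensional_def)
  show "(\<lambda>k. k(i := k i - 1)) ` {k \<in> multi_indices r (Suc N). k i \<noteq> 0} \<subseteq> multi_indices r N"
  proof
    fix k' assume "k' \<in> (\<lambda>k. k(i := k i - 1)) ` {k \<in> multi_indices r (Suc N). k i \<noteq> 0}"
    then obtain k where k: "k' = k(i := k i - 1)" "k \<in> multi_indices r (Suc N)" "k i \<noteq> 0" by auto
    have "k'(i := Suc (k' i)) = k" using k(1,3) by auto
    then have "Suc (weight r k') = weight r k" using weight_update[OF i, of k'] by simp
    then show "k' \<in> multi_indices r N"
      using i k(1,2) by (auto simp: multi_indices_def PiE_iff extensional_def)
  qed
qed

text \<open>The nodes are chosen to fit \<open>E\<close> and \<open>Phi\<close>: the bracket at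
  \<open>y0\<close> extends \<open>E\<close> by one factor at its beginning, and the bracket at
  \<open>pos k i\<close> extends the \<open>i\<close>-th product of \<open>Phi\<close> at its end.
  Regrouped by index, the contributions add up by \<open>stay_move_sum\<close>, once the boundary
  terms of the enlarged range are seen to vanish.\<close>

lemma G_Suc:
  assumes \<alpha>: "generic \<alpha>" and sep: "separated (Suc N)"
  shows "G (Suc N) \<alpha> \<beta> = mu N \<alpha> * (\<Prod>j=1..r. br (\<alpha> - of_nat N * \<eta>) (\<beta> j)) * G N (\<alpha> + \<eta>) \<beta>"
proof -
  define T where "T k = C (Suc N) \<alpha> k *
     (\<Prod>j=1..r. Phi k (\<beta> j) * E (\<alpha> + of_nat (Suc (weight r k)) * \<eta>) (\<beta> j) (Suc N - weight r k))" for k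
  define up where "up i k = k(i := Suc (k i))" for i :: nat and k :: "nat \<Rightarrow> nat"
  define y where "y = \<alpha> - of_nat N * \<eta>"
  have summand: "mu N \<alpha> * (\<Prod>j=1..r. br y (\<beta> j)) * (C N (\<alpha> + \<eta>) k *
      (\<Prod>j=1..r. Phi k (\<beta> j) * E (\<alpha> + \<eta> + of_nat (Suc (weight r k)) * \<eta>) (\<beta> j) (N - weight r k)))
    = T k * stay N \<alpha> k + (\<Sum>i=1..r. T (up i k) * move N \<alpha> (up i k) i)" if k: "k \<in> multi_indices r N" for k
  proof -
    define K where "K = weight r k"
    have KN: "K \<le> N" using k by (simp add: K_def multi_indices_def)
    define y0 where "y0 = \<alpha> + of_nat (Suc K) * \<eta>"
    define F where "F = (\<Prod>j=1..r. Phi k (\<beta> j) * E (y0 + \<eta>) (\<beta> j) (N - K))"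
    have y0: "\<alpha> + \<eta> + of_nat (Suc K) * \<eta> = y0 + \<eta>" "\<alpha> + of_nat (Suc (Suc K)) * \<eta> = y0 + \<eta>"
      by (simp_all add: y0_def algebra_simps)
    have kN: "k l \<le> K" if "l \<in> {1..r}" for l using le_weight[OF that, of k] by (simp add: K_def)
    have T0: "T k = C (Suc N) \<alpha> k * ((\<Prod>j=1..r. br y0 (\<beta> j)) * F)"
      unfolding T_def K_def[symmetric] Suc_diff_le[OF KN] y0_def[symmetric] E_Suc F_def prod.distrib
      by (simp only: mult_ac)
    have Ti: "T (up i k) = C (Suc N) \<alpha> (up i k) * ((\<Prod>j=1..r. br (pos k i) (\<beta> j)) * F)" if i: "i \<in> {1..r}" for i
      unfolding T_def up_def weight_update[OF i] K_def[symmetric] y0 Phi_update[OF i] F_def prod.distrib diff_Suc_Suc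
      by (simp only: mult_ac)
    have interp: "(\<Prod>j=1..r. br y (\<beta> j)) =
      (\<Prod>j=1..r. br y0 (\<beta> j)) * (\<Prod>l=1..r. br y (pos k l) / br y0 (pos k l))
      + (\<Sum>i=1..r. (\<Prod>j=1..r. br (pos k i) (\<beta> j)) * (br y y0 / br (pos k i) y0)
          * (\<Prod>l\<in>{1..r} - {i}. br y (pos k l) / br (pos k i) (pos k l)))"
    proof (rule br_interpolation')
      fix l assume l: "l \<in> {1..r}"
      have "\<sigma> (y0 + pos k l) \<noteq> 0"
        by (rule generic_plus[OF \<alpha> l, of _ "int K + 1 + 2 * int (k l)"]) (simp add: y0_def pos_def algebra_simps)
      moreover have "\<sigma> (y0 - pos k l) \<noteq> 0"
        by (rule generic_minus[OF \<alpha> l, of _ "int K + 1 - 2 * int (k l)"]) (simp add: y0_def pos_def algebra_simps)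
      ultimately show "br y0 (pos k l) \<noteq> 0" by (simp add: br_def)
    next
      fix i l assume "i \<in> {1..r}" "l \<in> {1..r}" "i \<noteq> l"
      then show "br (pos k i) (pos k l) \<noteq> 0" by (rule separated_br[OF sep k])
    qed
    have s: "mu N \<alpha> * (\<Prod>l=1..r. br y (pos k l) / br y0 (pos k l)) * C N (\<alpha> + \<eta>) k = C (Suc N) \<alpha> k * stay N \<alpha> k"
      unfolding y_def y0_def by (rule C_stay[OF \<alpha> K_def])
    have m: "mu N \<alpha> * (br y y0 / br (pos k i) y0 * (\<Prod>l\<in>{1..r} - {i}. br y (pos k l) / br (pos k i) (pos k l))) * C N (\<alpha> + \<eta>) k
      = C (Suc N) \<alpha> (up i k) * move N \<alpha> (up i k) i" if "i \<in> {1..r}" for i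
      unfolding y_def y0_def up_def by (rule C_move[OF \<alpha> sep k that K_def])
    have "mu N \<alpha> * (\<Prod>j=1..r. br y (\<beta> j)) * (C N (\<alpha> + \<eta>) k * F)
      = (mu N \<alpha> * (\<Prod>l=1..r. br y (pos k l) / br y0 (pos k l)) * C N (\<alpha> + \<eta>) k) * ((\<Prod>j=1..r. br y0 (\<beta> j)) * F)
      + (\<Sum>i=1..r. (mu N \<alpha> * (br y y0 / br (pos k i) y0 * (\<Prod>l\<in>{1..r} - {i}. br y (pos k l) / br (pos k i) (pos k l))) * C N (\<alpha> + \<eta>) k)
          * ((\<Prod>j=1..r. br (pos k i) (\<beta> j)) * F))"
      unfolding interp distrib_left distrib_right sum_distrib_left sum_distrib_right
      by (intro arg_cong2[of _ _ _ _ "(+)"] sum.cong refl) (simp_all only: mult_ac)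
    also have "\<dots> = T k * stay N \<alpha> k + (\<Sum>i=1..r. T (up i k) * move N \<alpha> (up i k) i)"
      unfolding s T0 by (intro arg_cong2[of _ _ _ _ "(+)"] sum.cong refl, simp only: mult_ac)
        (simp only: m Ti, simp only: mult_ac)
    finally show ?thesis unfolding K_def[symmetric] y0 F_def .
  qed
  have "mu N \<alpha> * (\<Prod>j=1..r. br y (\<beta> j)) * G N (\<alpha> + \<eta>) \<beta>
    = (\<Sum>k\<in>multi_indices r N. T k * stay N \<alpha> k + (\<Sum>i=1..r. T (up i k) * move N \<alpha> (up i k) i))"
    unfolding G_def sum_distrib_left by (intro sum.cong refl summand)
  also have "\<dots> = (\<Sum>k\<in>multi_indices r N. T k * stay N \<alpha> k)
      + (\<Sum>i=1..r. \<Sum>k\<in>multi_indices r N. T (up i k) * move N \<alpha> (up i k) i)"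
    unfolding sum.distrib by (subst sum.swap) (rule refl)
  also have "(\<Sum>k\<in>multi_indices r N. T k * stay N \<alpha> k) = (\<Sum>k\<in>multi_indices r (Suc N). T k * stay N \<alpha> k)"
  proof (rule sum.mono_neutral_left[OF finite_multi_indices])
    show "multi_indices r N \<subseteq> multi_indices r (Suc N)" by (auto simp: multi_indices_def)
    show "\<forall>k\<in>multi_indices r (Suc N) - multi_indices r N. T k * stay N \<alpha> k = 0"
    proof
      fix k assume "k \<in> multi_indices r (Suc N) - multi_indices r N"
      then have "weight r k = Suc N" by (auto simp: multi_indices_def)
      \<comment> \<open>Here \<open>stay\<close> contains \<open>\<sigma> 0\<close>, as its factor
        with \<open>of_nat (Suc N) - of_nat K\<close> shows.\<close>
      then have "stay N \<alpha> k = 0" by (simp add: stay_def)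
      then show "T k * stay N \<alpha> k = 0" by simp
    qed
  qed
  also have "(\<Sum>i=1..r. \<Sum>k\<in>multi_indices r N. T (up i k) * move N \<alpha> (up i k) i)
    = (\<Sum>i=1..r. \<Sum>k\<in>multi_indices r (Suc N). T k * move N \<alpha> k i)"
  proof (rule sum.cong[OF refl])
    fix i assume i: "i \<in> {1..r}"
    have "(\<Sum>k\<in>multi_indices r N. T (up i k) * move N \<alpha> (up i k) i) = (\<Sum>k\<in>{k \<in> multi_indices r (Suc N). k i \<noteq> 0}. T k * move N \<alpha> k i)"
      unfolding up_def by (rule sum.reindex_bij_betw[OF multi_indices_Suc_bij[OF i], of "\<lambda>k. T k * move N \<alpha> k i"])
    also have "\<dots> = (\<Sum>k\<in>multi_indices r (Suc N). T k * move N \<alpha> k i)"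
    proof (rule sum.mono_neutral_left[OF finite_multi_indices])
      show "\<forall>k\<in>multi_indices r (Suc N) - {k \<in> multi_indices r (Suc N). k i \<noteq> 0}. T k * move N \<alpha> k i = 0"
      proof
        fix k assume "k \<in> multi_indices r (Suc N) - {k \<in> multi_indices r (Suc N). k i \<noteq> 0}"
        then have "pos k i = \<xi> i" by (simp add: pos_def)
        \<comment> \<open>An index with \<open>k i = 0\<close> is not reached by a step in direction
          \<open>i\<close>; correspondingly the factor \<open>j = i\<close> of \<open>move\<close>
          is \<open>\<sigma> 0\<close>.\<close>
        then have "(\<Prod>j=1..r. \<sigma> (pos k i - \<xi> j)) = 0"
          using i by (intro prod_zero) (auto intro!: bexI[of _ i])
        then have "move N \<alpha> k i = 0" by (simp add: move_def Let_def)
        then show "T k * move N \<alpha> k i = 0" by simp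
      qed
    qed auto
    finally show "(\<Sum>k\<in>multi_indices r N. T (up i k) * move N \<alpha> (up i k) i) = (\<Sum>k\<in>multi_indices r (Suc N). T k * move N \<alpha> k i)" .
  qed
  also have "(\<Sum>k\<in>multi_indices r (Suc N). T k * stay N \<alpha> k) + (\<Sum>i=1..r. \<Sum>k\<in>multi_indices r (Suc N). T k * move N \<alpha> k i)
    = (\<Sum>k\<in>multi_indices r (Suc N). T k * (stay N \<alpha> k + (\<Sum>i=1..r. move N \<alpha> k i)))"
    unfolding distrib_left sum.distrib sum_distrib_left by (subst sum.swap) (rule refl)
  also have "\<dots> = (\<Sum>k\<in>multi_indices r (Suc N). T k)"
    by (intro sum.cong refl) (simp only: stay_move_sum[OF \<alpha> sep] mult_1_right)
  also have "\<dots> = G (Suc N) \<alpha> \<beta>" unfolding G_def T_def ..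
  finally show ?thesis unfolding y_def by (rule sym)
qed

lemma separated_Suc: "separated (Suc N) \<Longrightarrow> separated N"
  unfolding separated_def by fastforce

lemma multi_indices_0: "multi_indices r 0 = {\<lambda>i\<in>{1..r}. 0}"
proof -
  have "k = (\<lambda>i\<in>{1..r}. 0)" if "k \<in> multi_indices r 0" for k
  proof
    fix i
    show "k i = (\<lambda>i\<in>{1..r}. 0) i"
      using that by (cases "i \<in> {1..r}") (auto simp: multi_indices_def weight_def PiE_def extensional_def)
  qed
  moreover have "(\<lambda>i\<in>{1..r}. 0) \<in> multi_indices r 0" by (simp add: multi_indices_def weight_def)
  ultimately show ?thesis by blast
qed

lemma C_0:
  assumes "generic \<alpha>" "separated 0" "\<And>i. i \<in> {1..r} \<Longrightarrow> k i = 0"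
  shows "C N \<alpha> k = 1"
proof -
  have w: "weight r k = 0" using assms(3) by (simp add: weight_def)
  have p: "pos k i = \<xi> i" if "i \<in> {1..r}" for i using assms(3)[OF that] by (simp add: pos_def)
  have sep: "\<sigma> (\<xi> i - \<xi> j) \<noteq> 0" if "i \<in> {1..r}" "j \<in> {1..r}" "i \<noteq> j" for i j
    by (rule separated_diff[OF assms(2) that, of 0 0]) auto
  have "(\<Prod>i=1..r. \<Prod>j\<in>{i<..r}. \<sigma> (pos k i - pos k j) / \<sigma> (\<xi> i - \<xi> j) / fac (\<xi> i + \<xi> j) (2 * \<eta>) (k i + k j)) = 1"
    by (intro prod.neutral ballI) (use assms(3) in \<open>auto simp: p sep\<close>)
  then have V: "V k = 1" unfolding V_def by (simp add: assms(3))
  have "W \<eta> N \<alpha> (\<xi> i) (k i) 0 = 1" if "i \<in> {1..r}" for i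
    using assms(3)[OF that] generic_plus[OF assms(1) that, of _ 0] by (simp add: W_def)
  then show ?thesis unfolding C_def V w by (simp add: U_def)
qed

text \<open>Level \<open>Suc N\<close> at \<open>\<alpha>\<close> rests on level \<open>N\<close> at
  \<open>\<alpha> + \<eta>\<close>, so \<open>\<alpha>\<close> varies in the induction. The constant
  \<open>mu\<close> replaces the bracket of \<open>y\<close> and \<open>\<xi> l\<close>, the new
  factor of \<open>P\<close>, by that of \<open>\<alpha> + \<eta>\<close> and
  \<open>\<xi> l\<close>, the new factor of \<open>E\<close>.\<close>

theorem G_eq:
  assumes "generic \<alpha>" "separated N"
  shows "G N \<alpha> \<beta> * (\<Prod>l=1..r. P N \<alpha> (\<xi> l)) = (\<Prod>j=1..r. P N \<alpha> (\<beta> j)) * (\<Prod>l=1..r. E (\<alpha> + \<eta>) (\<xi> l) N)"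
  using assms
proof (induction N arbitrary: \<alpha>)
  case 0
  have "C 0 \<alpha> (\<lambda>i\<in>{1..r}. 0) = 1" by (rule C_0[OF 0]) simp
  then show ?case
    by (simp add: G_def multi_indices_0 weight_def Phi_def E_def P_def del: One_nat_def)
next
  case (Suc N)
  note \<alpha> = Suc.prems(1) and sep = Suc.prems(2)
  define y where "y = \<alpha> - of_nat N * \<eta>"
  define Y where "Y = (\<Prod>j=1..r. br y (\<beta> j))"
  have y_nz: "br y (\<xi> l) \<noteq> 0" if l: "l \<in> {1..r}" for l
  proof -
    have "\<sigma> (y + \<xi> l) \<noteq> 0"
      by (rule generic_plus[OF \<alpha> l, of _ "- int N"]) (simp add: y_def)
    moreover have "\<sigma> (y - \<xi> l) \<noteq> 0"
      by (rule generic_minus[OF \<alpha> l, of _ "- int N"]) (simp add: y_def)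
    ultimately show ?thesis by (simp add: br_def)
  qed
  have mu: "mu N \<alpha> * (\<Prod>l=1..r. br y (\<xi> l)) = (\<Prod>l=1..r. br (\<alpha> + \<eta>) (\<xi> l))"
    unfolding mu_def y_def[symmetric] prod.distrib[symmetric] by (rule prod.cong[OF refl]) (simp add: y_nz)
  have IH: "G N (\<alpha> + \<eta>) \<beta> * (\<Prod>l=1..r. P N (\<alpha> + \<eta>) (\<xi> l)) = (\<Prod>j=1..r. P N (\<alpha> + \<eta>) (\<beta> j)) * (\<Prod>l=1..r. E (\<alpha> + \<eta> + \<eta>) (\<xi> l) N)"
    by (rule Suc.IH[OF generic_shift[OF \<alpha>] separated_Suc[OF sep]])
  have "G (Suc N) \<alpha> \<beta> * (\<Prod>l=1..r. P (Suc N) \<alpha> (\<xi> l))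
    = Y * (mu N \<alpha> * (\<Prod>l=1..r. br y (\<xi> l))) * (G N (\<alpha> + \<eta>) \<beta> * (\<Prod>l=1..r. P N (\<alpha> + \<eta>) (\<xi> l)))"
    unfolding G_Suc[OF \<alpha> sep] P_Suc y_def[symmetric] Y_def[symmetric] prod.distrib by (simp only: mult_ac)
  also have "\<dots> = (\<Prod>j=1..r. P (Suc N) \<alpha> (\<beta> j)) * (\<Prod>l=1..r. E (\<alpha> + \<eta>) (\<xi> l) (Suc N))"
    unfolding mu IH P_Suc E_Suc y_def[symmetric] Y_def prod.distrib by (simp only: mult_ac)
  finally show ?case .
qed

end

section \<open>From brackets back to quotients of factorials, for both parities of N\<close>

lemma prod_lessThan_double:
  fixes g :: "nat \<Rightarrow> 'c :: comm_monoid_mult"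
  shows "(\<Prod>s<2 * m. g s) = (\<Prod>s<m. g (2 * s)) * (\<Prod>s<m. g (2 * s + 1))"
  by (induction m) (simp_all add: mult_ac)

lemma prod_lessThan_add:
  fixes g :: "nat \<Rightarrow> 'c :: comm_monoid_mult"
  shows "(\<Prod>s<m + n. g s) = (\<Prod>s<m. g s) * (\<Prod>s<n. g (m + s))"
  by (induction n) (simp_all add: mult_ac)

context quadratic_sum
begin

definition summand :: "nat \<Rightarrow> 'a \<Rightarrow> (nat \<Rightarrow> 'a) \<Rightarrow> (nat \<Rightarrow> nat) \<Rightarrow> 'b" where
  "summand N \<alpha> \<beta> k = C N \<alpha> k
    * (\<Prod>i=1..r. \<Prod>j=1..r. fac (\<xi> i + \<beta> j) (2 * \<eta>) (k i) * fac (\<xi> i - \<beta> j) (2 * \<eta>) (k i))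
    / (\<Prod>j=1..r. fac (\<alpha> - \<beta> j + \<eta>) \<eta> (weight r k) * fac (\<alpha> + \<beta> j + \<eta>) \<eta> (weight r k))"

text \<open>The constant \<open>c\<close> unites the two right-hand sides: it is
  \<open>\<eta>\<close> for N = 2m and 0 for N = 2m - 1. With \<open>c = \<eta>\<close> the
  parameters are b q / a and q / (a b) here, and a q^2 / b and a b q^2 in
  \<open>upper\<close>.\<close>

definition lower :: "'a \<Rightarrow> nat \<Rightarrow> 'a \<Rightarrow> 'a \<Rightarrow> 'b" where
  "lower c m \<alpha> \<beta> = fac (\<beta> - \<alpha> + c) (2 * \<eta>) m * fac (c - \<alpha> - \<beta>) (2 * \<eta>) m"

definition upper :: "'a \<Rightarrow> nat \<Rightarrow> 'a \<Rightarrow> 'a \<Rightarrow> 'b" where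
  "upper c m \<alpha> \<beta> = fac (\<alpha> - \<beta> + (c + \<eta>)) (2 * \<eta>) m * fac (\<alpha> + \<beta> + (c + \<eta>)) (2 * \<eta>) m"

definition closed_form :: "'a \<Rightarrow> nat \<Rightarrow> 'a \<Rightarrow> (nat \<Rightarrow> 'a) \<Rightarrow> 'b" where
  "closed_form c m \<alpha> \<beta> = (\<Prod>i=1..r. upper c m \<alpha> (\<xi> i) * lower c m \<alpha> (\<beta> i) / (lower c m \<alpha> (\<xi> i) * upper c m \<alpha> (\<beta> i)))"

lemma E_eq_fac: "E (\<alpha> + \<eta>) \<beta> n = fac (\<alpha> - \<beta> + \<eta>) \<eta> n * fac (\<alpha> + \<beta> + \<eta>) \<eta> n"
  unfolding E_def br_def fac_def prod.distrib[symmetric]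
proof (rule prod.cong[OF refl])
  fix s
  have "\<alpha> + \<eta> + of_nat s * \<eta> + \<beta> = \<alpha> + \<beta> + \<eta> + of_nat s * \<eta>" "\<alpha> + \<eta> + of_nat s * \<eta> - \<beta> = \<alpha> - \<beta> + \<eta> + of_nat s * \<eta>"
    by (simp_all add: algebra_simps)
  then show "\<sigma> (\<alpha> + \<eta> + of_nat s * \<eta> + \<beta>) * \<sigma> (\<alpha> + \<eta> + of_nat s * \<eta> - \<beta>)
    = \<sigma> (\<alpha> - \<beta> + \<eta> + of_nat s * \<eta>) * \<sigma> (\<alpha> + \<beta> + \<eta> + of_nat s * \<eta>)"
    by (simp only: mult.commute)
qed

lemma br_neg: "br (- u) \<beta> = br u \<beta>"
proof -
  have "br (- u) \<beta> = \<sigma> (- (u - \<beta>)) * \<sigma> (- (u + \<beta>))" by (simp add: br_def)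
  then show ?thesis unfolding odd by (simp add: br_def)
qed

lemma lower_eq: "lower c m \<alpha> \<beta> = (\<Prod>s<m. br (\<alpha> - c - 2 * of_nat s * \<eta>) \<beta>)"
proof -
  have "\<sigma> (\<beta> - \<alpha> + c + of_nat s * (2 * \<eta>)) * \<sigma> (c - \<alpha> - \<beta> + of_nat s * (2 * \<eta>)) = br (\<alpha> - c - 2 * of_nat s * \<eta>) \<beta>" for s
    unfolding br_neg[of "\<alpha> - c - 2 * of_nat s * \<eta>", symmetric] unfolding br_def
    by (intro arg_cong2[of _ _ _ _ "(*)"] arg_cong[of _ _ \<sigma>]) (simp_all add: algebra_simps)
  then show ?thesis unfolding lower_def fac_def prod.distrib[symmetric] by (simp only:)
qed

lemma upper_eq: "upper c m \<alpha> \<beta> = (\<Prod>s<m. br (\<alpha> + c + (2 * of_nat s + 1) * \<eta>) \<beta>)"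
proof -
  have "\<sigma> (\<alpha> - \<beta> + (c + \<eta>) + of_nat s * (2 * \<eta>)) * \<sigma> (\<alpha> + \<beta> + (c + \<eta>) + of_nat s * (2 * \<eta>)) = br (\<alpha> + c + (2 * of_nat s + 1) * \<eta>) \<beta>" for s
    unfolding br_def mult.commute[of "\<sigma> (\<alpha> + c + (2 * of_nat s + 1) * \<eta> + \<beta>)"]
    by (intro arg_cong2[of _ _ _ _ "(*)"] arg_cong[of _ _ \<sigma>]) (simp_all add: algebra_simps)
  then show ?thesis unfolding upper_def fac_def prod.distrib[symmetric] by (simp only:)
qed

text \<open>\<open>E\<close> runs through the shifts 1, ..., N of \<open>\<alpha>\<close> in units
  of \<open>\<eta>\<close>, and \<open>P\<close> through 1 - N, 3 - N, ..., N - 1. The positive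
  shifts of \<open>P\<close> occur in both and make up \<open>h\<close>; \<open>lower\<close> has
  the remaining shifts of \<open>P\<close>, and \<open>upper\<close> those of \<open>E\<close> with
  the other parity.\<close>

lemma PE_factors:
  assumes "(N = 2 * m \<and> c = \<eta>) \<or> (Suc N = 2 * m \<and> c = 0)"
  obtains h where "\<And>\<beta>. P N \<alpha> \<beta> = h \<beta> * lower c m \<alpha> \<beta>" "\<And>\<beta>. E (\<alpha> + \<eta>) \<beta> N = h \<beta> * upper c m \<alpha> \<beta>"
proof -
  define n where "n = N - m"
  have N: "N = m + n" using assms by (auto simp: n_def)
  have c: "c = (of_nat N - 2 * of_nat m + 1) * \<eta>"
  proof -
    have "of_nat N = (2 * of_nat m - 1 :: 'a)" if "Suc N = 2 * m"
      using arg_cong[OF that, of "of_nat :: nat \<Rightarrow> 'a"] by (simp add: algebra_simps)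
    then show ?thesis using assms by auto
  qed
  define h where "h \<beta> = (\<Prod>s<n. br (\<alpha> + (1 - of_nat N + 2 * of_nat (m + s)) * \<eta>) \<beta>)" for \<beta>
  have 1: "P N \<alpha> \<beta> = h \<beta> * lower c m \<alpha> \<beta>" for \<beta>
  proof -
    have "P N \<alpha> \<beta> = (\<Prod>s<m. br (\<alpha> + (1 - of_nat N + 2 * of_nat s) * \<eta>) \<beta>) * h \<beta>"
      unfolding P_def h_def unfolding N by (rule prod_lessThan_add)
    also have "(\<Prod>s<m. br (\<alpha> + (1 - of_nat N + 2 * of_nat s) * \<eta>) \<beta>) = lower c m \<alpha> \<beta>"
      unfolding lower_eq
    proof (rule prod.reindex_bij_witness[where i = "\<lambda>s. m - Suc s" and j = "\<lambda>s. m - Suc s"])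
      fix s assume "s \<in> {..<m}"
      then have e: "of_nat (m - Suc s) = (of_nat m - of_nat s - 1 :: 'a)" by (simp add: of_nat_diff)
      show "br (\<alpha> - c - 2 * of_nat (m - Suc s) * \<eta>) \<beta> = br (\<alpha> + (1 - of_nat N + 2 * of_nat s) * \<eta>) \<beta>"
        unfolding e c by (intro arg_cong[of _ _ "\<lambda>u. br u \<beta>"]) (simp add: algebra_simps)
    qed auto
    finally show ?thesis by (simp only: mult.commute)
  qed
  have 2: "E (\<alpha> + \<eta>) \<beta> N = h \<beta> * upper c m \<alpha> \<beta>" for \<beta>
  proof (cases "N = 2 * m")
    case True
    then have "n = m" using N by simp
    then show ?thesis
      unfolding E_def True prod_lessThan_double h_def upper_eq c
      by (intro arg_cong2[of _ _ _ _ "(*)"] prod.cong refl arg_cong[of _ _ "\<lambda>u. br u \<beta>"]) (simp_all add: algebra_simps)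
  next
    case False
    then have n: "m = Suc n" "N = Suc (2 * n)" using assms N by auto
    have "E (\<alpha> + \<eta>) \<beta> N = (\<Prod>s<n. br (\<alpha> + \<eta> + of_nat (2 * s + 1) * \<eta>) \<beta>) * (\<Prod>s<Suc n. br (\<alpha> + \<eta> + of_nat (2 * s) * \<eta>) \<beta>)"
      unfolding E_def n(2) prod.lessThan_Suc prod_lessThan_double by (simp only: mult_ac)
    also have "\<dots> = h \<beta> * upper c m \<alpha> \<beta>"
      unfolding h_def upper_eq c n
      by (intro arg_cong2[of _ _ _ _ "(*)"] prod.cong refl arg_cong[of _ _ "\<lambda>u. br u \<beta>"]) (simp_all add: algebra_simps)
    finally show ?thesis .
  qed
  show thesis by (rule that[OF 1 2])
qed

lemma br_generic:
  assumes \<alpha>: "generic \<alpha>" and l: "l \<in> {1..r}" and u: "u = \<alpha> + of_int s * \<eta>"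
  shows "br u (\<xi> l) \<noteq> 0"
proof -
  have "\<sigma> (u + \<xi> l) \<noteq> 0" by (rule generic_plus[OF \<alpha> l, of _ s]) (simp add: u)
  moreover have "\<sigma> (u - \<xi> l) \<noteq> 0" by (rule generic_minus[OF \<alpha> l, of _ s]) (simp add: u)
  ultimately show ?thesis by (simp add: br_def)
qed

text \<open>\<open>G_eq\<close> divided by the denominators cleared in \<open>G\<close>. The common
  factor \<open>h\<close> cancels; it is nonzero at \<open>\<beta> l\<close> by the condition on
  \<open>E\<close>, and at \<open>\<xi> l\<close> by genericity.\<close>

lemma sum_summand:
  assumes \<alpha>: "generic \<alpha>" and sep: "separated N"
    and nz: "\<And>j. j \<in> {1..r} \<Longrightarrow> E (\<alpha> + \<eta>) (\<beta> j) N \<noteq> 0"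
    and par: "(N = 2 * m \<and> c = \<eta>) \<or> (Suc N = 2 * m \<and> c = 0)"
  shows "(\<Sum>k\<in>multi_indices r N. summand N \<alpha> \<beta> k) = closed_form c m \<alpha> \<beta>"
proof -
  define D where "D = (\<Prod>j=1..r. E (\<alpha> + \<eta>) (\<beta> j) N)"
  have D_nz: "D \<noteq> 0" using nz by (simp add: D_def)
  have E_split: "E (\<alpha> + \<eta>) b N = E (\<alpha> + \<eta>) b K * E (\<alpha> + of_nat (Suc K) * \<eta>) b (N - K)" if "K \<le> N" for b K
  proof -
    have "E (\<alpha> + \<eta>) b (K + (N - K)) = E (\<alpha> + \<eta>) b K * E (\<alpha> + of_nat (Suc K) * \<eta>) b (N - K)"
      unfolding E_def prod_lessThan_add
      by (intro arg_cong2[of _ _ _ _ "(*)"] prod.cong refl arg_cong[of _ _ "\<lambda>u. br u b"]) (simp_all add: algebra_simps)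
    then show ?thesis using that by simp
  qed
  have summand: "summand N \<alpha> \<beta> k * D = C N \<alpha> k *
     (\<Prod>j=1..r. Phi k (\<beta> j) * E (\<alpha> + of_nat (Suc (weight r k)) * \<eta>) (\<beta> j) (N - weight r k))"
    if k: "k \<in> multi_indices r N" for k
  proof -
    define K where "K = weight r k"
    have KN: "K \<le> N" using k by (simp add: K_def multi_indices_def)
    define D1 where "D1 = (\<Prod>j=1..r. E (\<alpha> + \<eta>) (\<beta> j) K)"
    define D2 where "D2 = (\<Prod>j=1..r. E (\<alpha> + of_nat (Suc K) * \<eta>) (\<beta> j) (N - K))"
    have D: "D = D1 * D2" unfolding D_def D1_def D2_def E_split[OF KN] prod.distrib ..
    have "(\<Prod>i=1..r. \<Prod>j=1..r. fac (\<xi> i + \<beta> j) (2 * \<eta>) (k i) * fac (\<xi> i - \<beta> j) (2 * \<eta>) (k i))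
      = (\<Prod>i=1..r. \<Prod>j=1..r. \<Prod>s<k i. br (\<xi> i + 2 * of_nat s * \<eta>) (\<beta> j))"
      unfolding fac_def prod.distrib[symmetric] br_def
      by (intro prod.cong refl arg_cong2[of _ _ _ _ "(*)"] arg_cong[of _ _ \<sigma>]) (simp_all add: algebra_simps)
    also have "\<dots> = (\<Prod>j=1..r. Phi k (\<beta> j))" unfolding Phi_def by (rule prod.swap)
    finally have 1: "(\<Prod>i=1..r. \<Prod>j=1..r. fac (\<xi> i + \<beta> j) (2 * \<eta>) (k i) * fac (\<xi> i - \<beta> j) (2 * \<eta>) (k i)) = (\<Prod>j=1..r. Phi k (\<beta> j))" .
    have "summand N \<alpha> \<beta> k = C N \<alpha> k * (\<Prod>j=1..r. Phi k (\<beta> j)) / D1"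
      unfolding summand_def 1 D1_def K_def E_eq_fac ..
    then have "summand N \<alpha> \<beta> k * D = C N \<alpha> k * (\<Prod>j=1..r. Phi k (\<beta> j)) * D2"
      using D_nz unfolding D by simp
    then show ?thesis unfolding D2_def K_def prod.distrib by (simp only: mult.assoc)
  qed
  obtain h where h: "\<And>\<beta>. P N \<alpha> \<beta> = h \<beta> * lower c m \<alpha> \<beta>" "\<And>\<beta>. E (\<alpha> + \<eta>) \<beta> N = h \<beta> * upper c m \<alpha> \<beta>"
    by (rule PE_factors[OF par]) blast
  have P_nz: "P N \<alpha> (\<xi> l) \<noteq> 0" if l: "l \<in> {1..r}" for l
    unfolding P_def prod_zero_iff[OF finite_lessThan]
  proof safe
    fix s assume "br (\<alpha> + (1 - of_nat N + 2 * of_nat s) * \<eta>) (\<xi> l) = 0"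
    then show False
      using br_generic[OF \<alpha> l, of "\<alpha> + (1 - of_nat N + 2 * of_nat s) * \<eta>" "1 - int N + 2 * int s"] by simp
  qed
  have "(\<Sum>k\<in>multi_indices r N. summand N \<alpha> \<beta> k) * D = G N \<alpha> \<beta>"
    unfolding G_def sum_distrib_right by (rule sum.cong[OF refl]) (rule summand)
  then have "(\<Sum>k\<in>multi_indices r N. summand N \<alpha> \<beta> k) * (D * (\<Prod>l=1..r. P N \<alpha> (\<xi> l)))
     = (\<Prod>l=1..r. P N \<alpha> (\<beta> l)) * (\<Prod>l=1..r. E (\<alpha> + \<eta>) (\<xi> l) N)"
    using G_eq[OF \<alpha> sep, of \<beta>] by (simp only: mult.assoc[symmetric])
  moreover have DP: "D * (\<Prod>l=1..r. P N \<alpha> (\<xi> l)) \<noteq> 0" using D_nz P_nz by simp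
  ultimately have "(\<Sum>k\<in>multi_indices r N. summand N \<alpha> \<beta> k) =
     (\<Prod>l=1..r. P N \<alpha> (\<beta> l)) * (\<Prod>l=1..r. E (\<alpha> + \<eta>) (\<xi> l) N) / (D * (\<Prod>l=1..r. P N \<alpha> (\<xi> l)))"
    by (simp only: nonzero_eq_divide_eq[OF DP])
  also have "\<dots> = closed_form c m \<alpha> \<beta>"
    unfolding D_def closed_form_def prod.distrib[symmetric] prod_dividef[symmetric]
  proof (rule prod.cong[OF refl])
    fix l assume l: "l \<in> {1..r}"
    have "h (\<xi> l) \<noteq> 0" "h (\<beta> l) \<noteq> 0" using P_nz[OF l] nz[OF l] unfolding h by auto
    then show "P N \<alpha> (\<beta> l) * E (\<alpha> + \<eta>) (\<xi> l) N / (E (\<alpha> + \<eta>) (\<beta> l) N * P N \<alpha> (\<xi> l)) =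
      upper c m \<alpha> (\<xi> l) * lower c m \<alpha> (\<beta> l) / (lower c m \<alpha> (\<xi> l) * upper c m \<alpha> (\<beta> l))"
      unfolding h by (simp add: mult_ac)
  qed
  finally show ?thesis .
qed

end

section \<open>Multiplicative variables\<close>

definition exp2 :: "complex \<Rightarrow> complex" where "exp2 w = exp (2 * w)"

lemma exp2_add: "exp2 u * exp2 v = exp2 (u + v)"
  and exp2_diff: "exp2 u / exp2 v = exp2 (u - v)"
  and exp2_inverse: "1 / exp2 v = exp2 (- v)"
  and exp2_power: "exp2 u ^ n = exp2 (of_nat n * u)"
  and exp2_powi: "exp2 u powi i = exp2 (of_int i * u)"
proof -
  show "exp2 u * exp2 v = exp2 (u + v)" by (simp only: exp2_def exp_add distrib_left)
  show "exp2 u / exp2 v = exp2 (u - v)" by (simp only: exp2_def exp_diff right_diff_distrib)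
  show "1 / exp2 v = exp2 (- v)" by (simp only: exp2_def exp_minus mult_minus_right inverse_eq_divide)
  have "2 * (of_nat n * u) = of_nat n * (2 * u)" by simp
  then show "exp2 u ^ n = exp2 (of_nat n * u)" by (simp only: exp2_def exp_of_nat_mult)
  have "2 * (of_int i * u) = of_int i * (2 * u)" by simp
  then show "exp2 u powi i = exp2 (of_int i * u)" by (simp only: exp2_def exp_power_int)
qed

lemmas exp2_simps = exp2_add exp2_diff exp2_inverse exp2_power exp2_powi

lemma exp2_nonzero [simp]: "exp2 u \<noteq> 0" by (simp add: exp2_def)

lemma efac_Cons: "efac q p (a # b # as) k = efac q p [a] k * efac q p (b # as) k"
  by (simp add: efac_def)

definition triangular :: "complex \<Rightarrow> complex" where "triangular z = z * (z - 1) / 2"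

text \<open>At a natural number n this is the sum of u + j h over j < n, the exponent by which
  \<open>efac\<close> differs from \<open>fac\<close>. As a polynomial in a complex argument it can
  be expanded at K - k_i without truncated subtraction.\<close>

definition facexp :: "complex \<Rightarrow> complex \<Rightarrow> complex \<Rightarrow> complex" where
  "facexp u h z = z * u + triangular z * h"

text \<open>Passing from \<open>theta\<close> to \<open>odd_theta\<close> produces an exponential in each factor of the summand. The
  rows are the exponents of these factors, in the order of the statement.\<close>

lemma exponent_sum:
  fixes r :: nat and k \<xi> \<beta> :: "nat \<Rightarrow> complex" and \<alpha> \<eta> :: complex
  defines "K \<equiv> \<Sum>i=1..r. k i"
  shows "(\<Sum>i=1..r. \<Sum>j\<in>{i<..r}. 2 * \<eta> * (k i + k j)) + 2 * \<eta> * (K - (\<Sum>i=1..r. \<Sum>j\<in>{i<..r}. k i * k j))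
    + facexp (2 * \<alpha> + \<eta>) (2 * \<eta>) K
    + facexp (of_nat (Suc N) * \<eta>) \<eta> K + facexp (- of_nat N * \<eta>) \<eta> K
    - (\<Sum>i=1..r. facexp (\<alpha> + \<xi> i + of_nat (N + 2) * \<eta>) (2 * \<eta>) (k i) + facexp (\<alpha> + \<xi> i + (1 - of_nat N) * \<eta>) (2 * \<eta>) (k i))
    - (\<Sum>i=1..r. \<Sum>j\<in>{i<..r}. facexp (\<xi> i + \<xi> j) (2 * \<eta>) (k i + k j))
    + (\<Sum>i=1..r. \<Sum>j=1..r. facexp (\<xi> i + \<beta> j) (2 * \<eta>) (k i) + facexp (\<xi> i - \<beta> j) (2 * \<eta>) (k i))
    - (\<Sum>i=1..r. \<Sum>j=1..r. facexp (2 * \<eta> + \<xi> i - \<xi> j) (2 * \<eta>) (k i))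
    + (\<Sum>i=1..r. (2 * k i + K) * \<eta> + (facexp (\<alpha> + \<xi> i) \<eta> K + facexp (\<alpha> - \<xi> i + \<eta>) \<eta> (K - k i)
        - (facexp (\<alpha> - \<beta> i + \<eta>) \<eta> K + facexp (\<alpha> + \<beta> i + \<eta>) \<eta> K
           + facexp (\<xi> i - \<alpha> + (k i - K) * \<eta>) \<eta> (k i)))) = 0"
proof -
  \<comment> \<open>Each row becomes a polynomial in these sums together with \<open>K\<close>,
    \<open>r\<close>, \<open>N\<close>, \<open>\<alpha>\<close> and \<open>\<eta>\<close>; the
    \<open>\<beta> j\<close> cancel within the rows \<open>s7\<close> and \<open>s9\<close>. What
    remains is a polynomial identity.\<close>
  define A where "A = (\<Sum>i=1..r. \<xi> i)"
  define S where "S = (\<Sum>i=1..r. k i * k i)"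
  define L where "L = (\<Sum>i=1..r. k i * \<xi> i)"
  have [simp]: "(\<Sum>i=Suc 0..r. k i) = K" "(\<Sum>i=Suc 0..r. \<xi> i) = A" "(\<Sum>i=Suc 0..r. k i * k i) = S" "(\<Sum>i=Suc 0..r. k i * \<xi> i) = L"
    by (simp_all add: K_def A_def S_def L_def)
  have pair: "(\<Sum>i=1..r. \<Sum>j\<in>{i<..r}. s i j) = ((\<Sum>i=1..r. \<Sum>j=1..r. s i j) - (\<Sum>i=1..r. s i i)) / 2"
    if "\<And>i j. s i j = s j i" for s :: "nat \<Rightarrow> nat \<Rightarrow> complex"
  proof -
    have "(\<Sum>i=1..r. \<Sum>j=1..r. s i j) = (\<Sum>i=1..r. s i i + (\<Sum>j\<in>{1..<i}. s i j) + (\<Sum>j\<in>{i<..r}. s i j))"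
    proof (rule sum.cong[OF refl])
      fix i assume i: "i \<in> {1..r}"
      then have "{1..r} = insert i ({1..<i} \<union> {i<..r})" by auto
      then have "(\<Sum>j=1..r. s i j) = (\<Sum>j\<in>insert i ({1..<i} \<union> {i<..r}). s i j)" by (simp only:)
      also have "\<dots> = s i i + (\<Sum>j\<in>{1..<i}. s i j) + (\<Sum>j\<in>{i<..r}. s i j)"
      proof -
        have "(\<Sum>j\<in>{1..<i} \<union> {i<..r}. s i j) = (\<Sum>j\<in>{1..<i}. s i j) + (\<Sum>j\<in>{i<..r}. s i j)"
          by (rule sum.union_disjoint) auto
        then show ?thesis by (subst sum.insert) (auto simp: add.assoc)
      qed
      finally show "(\<Sum>j=1..r. s i j) = s i i + (\<Sum>j\<in>{1..<i}. s i j) + (\<Sum>j\<in>{i<..r}. s i j)" .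
    qed
    moreover have "(\<Sum>i=1..r. \<Sum>j\<in>{1..<i}. s i j) = (\<Sum>i=1..r. \<Sum>j\<in>{i<..r}. s i j)"
    proof -
      have "(\<Sum>i=1..r. \<Sum>j\<in>{1..<i}. s i j) = (\<Sum>(i, j)\<in>(SIGMA i:{1..r}. {1..<i}). s i j)"
        by (simp add: sum.Sigma)
      also have "\<dots> = (\<Sum>(i, j)\<in>(SIGMA i:{1..r}. {i<..r}). s i j)"
        by (rule sum.reindex_bij_witness[where i = prod.swap and j = prod.swap]) (auto simp: that)
      also have "\<dots> = (\<Sum>i=1..r. \<Sum>j\<in>{i<..r}. s i j)" by (simp add: sum.Sigma)
      finally show ?thesis .
    qed
    ultimately show ?thesis by (simp add: sum.distrib)
  qed
  have pair_add: "(\<Sum>i=1..r. \<Sum>j\<in>{i<..r}. f i + f j) = (of_nat r - 1) * (\<Sum>i=1..r. f i)" for f :: "nat \<Rightarrow> complex"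
  proof -
    have "(\<Sum>i=1..r. \<Sum>j\<in>{i<..r}. f i + f j) = ((\<Sum>i=1..r. \<Sum>j=1..r. f i + f j) - (\<Sum>i=1..r. f i + f i)) / 2"
      by (rule pair) (rule add.commute)
    also have "\<dots> = ((of_nat r * (\<Sum>i=1..r. f i) + of_nat r * (\<Sum>i=1..r. f i)) - ((\<Sum>i=1..r. f i) + (\<Sum>i=1..r. f i))) / 2"
      unfolding sum.distrib by (simp flip: sum_distrib_left)
    also have "\<dots> = (of_nat r - 1) * (\<Sum>i=1..r. f i)" by (simp add: field_simps)
    finally show ?thesis .
  qed
  have s1: "(\<Sum>i=1..r. \<Sum>j\<in>{i<..r}. 2 * \<eta> * (k i + k j)) = 2 * \<eta> * ((of_nat r - 1) * K)"
    unfolding sum_distrib_left[symmetric] pair_add K_def ..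
  have s2: "(\<Sum>i=1..r. \<Sum>j\<in>{i<..r}. k i * k j) = (K * K - S) / 2"
    by (subst pair) (simp_all add: mult.commute flip: sum_distrib_left sum_distrib_right)
  have t: "(\<Sum>i=1..r. triangular (k i)) = (S - K) / 2"
    by (simp add: triangular_def algebra_simps sum_subtractf flip: sum_divide_distrib)
  then have [simp]: "(\<Sum>i=Suc 0..r. triangular (k i)) = (S - K) / 2" by simp
  have s5: "(\<Sum>i=1..r. facexp (\<alpha> + \<xi> i + of_nat (N + 2) * \<eta>) (2 * \<eta>) (k i) + facexp (\<alpha> + \<xi> i + (1 - of_nat N) * \<eta>) (2 * \<eta>) (k i))
    = 2 * \<alpha> * K + 2 * L + 3 * \<eta> * K + 2 * \<eta> * (S - K)"
  proof -
    have "facexp (\<alpha> + \<xi> i + of_nat (N + 2) * \<eta>) (2 * \<eta>) (k i) + facexp (\<alpha> + \<xi> i + (1 - of_nat N) * \<eta>) (2 * \<eta>) (k i)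
      = 2 * \<alpha> * k i + 2 * (k i * \<xi> i) + 3 * \<eta> * k i + 4 * \<eta> * triangular (k i)" for i
      by (simp add: facexp_def algebra_simps)
    then show ?thesis by (simp only:) (simp add: sum.distrib flip: sum_distrib_left)
  qed
  have s6: "(\<Sum>i=1..r. \<Sum>j\<in>{i<..r}. facexp (\<xi> i + \<xi> j) (2 * \<eta>) (k i + k j))
    = of_nat r * L + K * A - 2 * L + \<eta> * (K * K - S) + (of_nat r - 1) * (\<eta> * (S - K))"
  proof -
    have e: "facexp (\<xi> i + \<xi> j) (2 * \<eta>) (k i + k j)
      = (k i * \<xi> i + k j * \<xi> j) + (k i * \<xi> j + k j * \<xi> i) + 2 * \<eta> * (triangular (k i) + triangular (k j)) + 2 * \<eta> * (k i * k j)" for i j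
      by (simp add: facexp_def triangular_def field_simps)
    have p1: "(\<Sum>i=1..r. \<Sum>j\<in>{i<..r}. k i * \<xi> i + k j * \<xi> j) = (of_nat r - 1) * L"
      unfolding L_def by (rule pair_add)
    have p2: "(\<Sum>i=1..r. \<Sum>j\<in>{i<..r}. k i * \<xi> j + k j * \<xi> i) = K * A - L"
    proof -
      have "(\<Sum>i=1..r. \<Sum>j\<in>{i<..r}. k i * \<xi> j + k j * \<xi> i)
        = ((\<Sum>i=1..r. \<Sum>j=1..r. k i * \<xi> j + k j * \<xi> i) - (\<Sum>i=1..r. k i * \<xi> i + k i * \<xi> i)) / 2"
        by (rule pair) (rule add.commute)
      also have "\<dots> = ((K * A + K * A) - (L + L)) / 2"
        unfolding sum.distrib sum_distrib_left[symmetric] sum_distrib_right[symmetric] K_def A_def L_def ..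
      also have "\<dots> = K * A - L" by (simp add: field_simps)
      finally show ?thesis .
    qed
    have p3: "(\<Sum>i=1..r. \<Sum>j\<in>{i<..r}. triangular (k i) + triangular (k j)) = (of_nat r - 1) * ((S - K) / 2)"
      unfolding t[symmetric] by (rule pair_add)
    have "(\<Sum>i=1..r. \<Sum>j\<in>{i<..r}. facexp (\<xi> i + \<xi> j) (2 * \<eta>) (k i + k j))
      = (\<Sum>i=1..r. \<Sum>j\<in>{i<..r}. k i * \<xi> i + k j * \<xi> j) + (\<Sum>i=1..r. \<Sum>j\<in>{i<..r}. k i * \<xi> j + k j * \<xi> i)
        + 2 * \<eta> * (\<Sum>i=1..r. \<Sum>j\<in>{i<..r}. triangular (k i) + triangular (k j)) + 2 * \<eta> * (\<Sum>i=1..r. \<Sum>j\<in>{i<..r}. k i * k j)"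
      unfolding e sum_distrib_left sum.distrib[symmetric] ..
    also have "\<dots> = of_nat r * L + K * A - 2 * L + \<eta> * (K * K - S) + (of_nat r - 1) * (\<eta> * (S - K))"
      unfolding p1 p2 p3 s2 by (simp add: field_simps)
    finally show ?thesis .
  qed
  have s7: "(\<Sum>i=1..r. \<Sum>j=1..r. facexp (\<xi> i + \<beta> j) (2 * \<eta>) (k i) + facexp (\<xi> i - \<beta> j) (2 * \<eta>) (k i))
    = of_nat r * (2 * L + 2 * \<eta> * (S - K))"
  proof -
    have "facexp (\<xi> i + \<beta> j) (2 * \<eta>) (k i) + facexp (\<xi> i - \<beta> j) (2 * \<eta>) (k i)
      = 2 * (k i * \<xi> i) + 4 * \<eta> * triangular (k i)" for i j
      by (simp add: facexp_def algebra_simps)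
    then show ?thesis by (simp only:) (simp add: sum.distrib flip: sum_distrib_left)
  qed
  have s8: "(\<Sum>i=1..r. \<Sum>j=1..r. facexp (2 * \<eta> + \<xi> i - \<xi> j) (2 * \<eta>) (k i))
    = of_nat r * (2 * \<eta> * K + L + \<eta> * (S - K)) - K * A"
  proof -
    have "facexp (2 * \<eta> + \<xi> i - \<xi> j) (2 * \<eta>) (k i)
      = 2 * \<eta> * k i + k i * \<xi> i + 2 * \<eta> * triangular (k i) - k i * \<xi> j" for i j
      by (simp add: facexp_def algebra_simps)
    then have "(\<Sum>i=1..r. \<Sum>j=1..r. facexp (2 * \<eta> + \<xi> i - \<xi> j) (2 * \<eta>) (k i))
      = (\<Sum>i=1..r. of_nat r * (2 * \<eta> * k i + k i * \<xi> i + 2 * \<eta> * triangular (k i)) - k i * A)"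
      by (simp only:) (simp add: sum_subtractf flip: sum_distrib_left)
    also have "\<dots> = of_nat r * (2 * \<eta> * K + L + \<eta> * (S - K)) - K * A"
      by (simp add: sum_subtractf sum.distrib flip: sum_distrib_left sum_distrib_right)
    finally show ?thesis .
  qed
  have s9: "(\<Sum>i=1..r. (2 * k i + K) * \<eta> + (facexp (\<alpha> + \<xi> i) \<eta> K + facexp (\<alpha> - \<xi> i + \<eta>) \<eta> (K - k i)
        - (facexp (\<alpha> - \<beta> i + \<eta>) \<eta> K + facexp (\<alpha> + \<beta> i + \<eta>) \<eta> K
           + facexp (\<xi> i - \<alpha> + (k i - K) * \<eta>) \<eta> (k i)))) = 2 * \<eta> * K - \<eta> * S"
  proof -
    have "(2 * k i + K) * \<eta> + (facexp (\<alpha> + \<xi> i) \<eta> K + facexp (\<alpha> - \<xi> i + \<eta>) \<eta> (K - k i)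
        - (facexp (\<alpha> - \<beta> i + \<eta>) \<eta> K + facexp (\<alpha> + \<beta> i + \<eta>) \<eta> K
           + facexp (\<xi> i - \<alpha> + (k i - K) * \<eta>) \<eta> (k i))) = 2 * \<eta> * k i - \<eta> * (k i * k i)" for i
      by (simp add: facexp_def triangular_def field_simps)
    then show ?thesis by (simp only:) (simp add: sum_subtractf flip: sum_distrib_left)
  qed
  show ?thesis
    unfolding s1 s2 s5 s6 s7 s8 s9 by (simp add: facexp_def triangular_def field_simps)
qed

section \<open>The summand in multiplicative and in logarithmic variables\<close>

locale theta_sum =
  fixes p \<eta> :: complex and r :: nat and \<xi> :: "nat \<Rightarrow> complex"
  assumes p: "norm p < 1"
    and \<eta>_nz: "\<And>n. n > 0 \<Longrightarrow> odd_theta p (of_nat n * \<eta>) \<noteq> 0"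
begin

sublocale quadratic_sum "odd_theta p" \<eta> r \<xi>
  by unfold_locales (rule odd_theta_minus[OF p], rule odd_theta_addition[OF p], erule \<eta>_nz)

lemma theta_exp2: "theta p (exp2 w) = exp w * odd_theta p w"
  unfolding exp2_def odd_theta_def mult.assoc[symmetric] exp_add[symmetric] by simp

lemma efac_exp2: "efac (exp2 h) p [exp2 u] n = exp (facexp u h (of_nat n)) * fac u h n"
proof (induction n)
  case 0
  then show ?case by (simp add: efac_def facexp_def triangular_def)
next
  case (Suc n)
  have "efac (exp2 h) p [exp2 u] (Suc n) = efac (exp2 h) p [exp2 u] n * theta p (exp2 u * exp2 h ^ n)"
    by (simp add: efac_def)
  also have "\<dots> = (exp (facexp u h (of_nat n)) * exp (u + of_nat n * h)) * fac u h (Suc n)"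
    unfolding Suc.IH exp2_power exp2_add theta_exp2 fac_Suc by (simp only: mult_ac)
  also have "exp (facexp u h (of_nat n)) * exp (u + of_nat n * h) = exp (facexp u h (of_nat (Suc n)))"
    unfolding exp_add[symmetric] by (rule arg_cong[of _ _ exp]) (simp add: facexp_def triangular_def field_simps)
  finally show ?case .
qed

lemma prod_exp_mult: "finite I \<Longrightarrow> (\<Prod>i\<in>I. exp (f i) * g i) = exp (\<Sum>i\<in>I. f i) * (\<Prod>i\<in>I. g i :: complex)"
  by (simp add: prod.distrib exp_sum)

lemma exp_divide: "exp u * f / (exp v * g) = exp (u - v) * (f / g :: complex)"
  by (simp add: exp_diff)

lemma exp_mult: "exp u * f * (exp v * g) = exp (u + v) * (f * g :: complex)"
  by (simp add: exp_add)

text \<open>Each factor of the summand is an exponential times an expression in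
  \<open>odd_theta\<close>, with the names \<open>e1\<close>, ... for the exponents and
  \<open>t1\<close>, ... for the expressions. The exponents cancel by \<open>exponent_sum\<close>,
  and the expressions regroup into \<open>V\<close>, \<open>U\<close>, \<open>W\<close> and the
  factors with \<open>\<beta>\<close>.\<close>

lemma term_eq_summand:
  fixes x b :: "nat \<Rightarrow> complex" and k :: "nat \<Rightarrow> nat"
  assumes q: "q = exp2 \<eta>" and a: "a = exp2 \<alpha>"
    and x: "\<And>i. i \<in> {1..r} \<Longrightarrow> x i = exp2 (\<xi> i)" and b: "\<And>i. i \<in> {1..r} \<Longrightarrow> b i = exp2 (\<beta> i)"
  shows "Delta p r (\<lambda>i. x i * q ^ (2 * k i)) / Delta p r x
      * q powi (int (weight r k) - int (e2 r k))
      * (efac (q ^ 2) p [a ^ 2 * q] (weight r k)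
         * efac q p [q ^ (N + 1), q powi (- int N)] (weight r k)
         / (\<Prod>i=1..r. efac (q ^ 2) p [a * x i * q ^ (N + 2), a * x i * q powi (1 - int N)] (k i)))
      * (\<Prod>i=1..r. \<Prod>j\<in>{i<..r}. 1 / efac (q ^ 2) p [x i * x j] (k i + k j))
      * (\<Prod>i=1..r. \<Prod>j=1..r.
           efac (q ^ 2) p [b j * x i, x i / b j] (k i) / efac (q ^ 2) p [q ^ 2 * x i / x j] (k i))
      * (\<Prod>i=1..r.
           theta p (a * x i * q ^ (2 * k i + weight r k)) / theta p (a * x i)
           * (efac q p [a * x i] (weight r k) * efac q p [a * q / x i] (weight r k - k i)
              / (efac q p [a * q / b i, a * b i * q] (weight r k)
                 * efac q p [q powi (int (k i) - int (weight r k)) * x i / a] (k i))))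
    = summand N \<alpha> \<beta> k"
proof -
  let ?\<sigma> = "odd_theta p"
  define K where "K = weight r k"
  define kk where "kk i = (of_nat (k i) :: complex)" for i
  define KK where "KK = (\<Sum>i=1..r. kk i)"
  have KK: "of_nat K = KK" by (simp add: K_def KK_def kk_def weight_def)
  have kK: "k i \<le> K" if "i \<in> {1..r}" for i using le_weight[OF that, of k] by (simp add: K_def)
  have q2: "q ^ 2 = exp2 (2 * \<eta>)" by (simp add: q exp2_power)
  have j_mem: "j \<in> {1..r}" if "i \<in> {1..r}" "j \<in> {i<..r}" for i j using that by auto
  define e1 where "e1 = (\<Sum>i=1..r. \<Sum>j\<in>{i<..r}. 2 * \<eta> * (kk i + kk j))"
  define t1 where "t1 = (\<Prod>i=1..r. \<Prod>j\<in>{i<..r}. ?\<sigma> (pos k i - pos k j) / ?\<sigma> (\<xi> i - \<xi> j))"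
  have B1: "Delta p r (\<lambda>i. x i * q ^ (2 * k i)) / Delta p r x = exp e1 * t1"
  proof -
    have "Delta p r (\<lambda>i. x i * q ^ (2 * k i)) / Delta p r x =
      (\<Prod>i=1..r. \<Prod>j\<in>{i<..r}. x j * q ^ (2 * k j) * theta p (x i * q ^ (2 * k i) / (x j * q ^ (2 * k j))) / (x j * theta p (x i / x j)))"
      unfolding Delta_def prod_dividef ..
    also have "\<dots> = (\<Prod>i=1..r. \<Prod>j\<in>{i<..r}. exp (2 * \<eta> * (kk i + kk j)) * (?\<sigma> (pos k i - pos k j) / ?\<sigma> (\<xi> i - \<xi> j)))"
    proof (intro prod.cong refl)
      fix i j assume i: "i \<in> {1..r}" and j: "j \<in> {i<..r}"
      have xi: "x l * q ^ (2 * k l) = exp2 (pos k l)" if "l \<in> {1..r}" for l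
        unfolding x[OF that] q exp2_power exp2_add pos_def by (simp add: algebra_simps)
      have "exp2 u * theta p (exp2 (v - u)) = exp (u + v) * ?\<sigma> (v - u)" for u v
        unfolding theta_exp2 unfolding exp2_def mult.assoc[symmetric] exp_add[symmetric] by (simp add: algebra_simps)
      then have 1: "exp2 (pos k j) * theta p (exp2 (pos k i) / exp2 (pos k j)) = exp (pos k j + pos k i) * ?\<sigma> (pos k i - pos k j)"
        "exp2 (\<xi> j) * theta p (exp2 (\<xi> i) / exp2 (\<xi> j)) = exp (\<xi> j + \<xi> i) * ?\<sigma> (\<xi> i - \<xi> j)"
        unfolding exp2_diff by blast+
      have 2: "pos k j + pos k i - (\<xi> j + \<xi> i) = 2 * \<eta> * (kk i + kk j)"
        by (simp add: pos_def kk_def algebra_simps)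
      show "x j * q ^ (2 * k j) * theta p (x i * q ^ (2 * k i) / (x j * q ^ (2 * k j))) / (x j * theta p (x i / x j))
        = exp (2 * \<eta> * (kk i + kk j)) * (?\<sigma> (pos k i - pos k j) / ?\<sigma> (\<xi> i - \<xi> j))"
        unfolding xi[OF i] xi[OF j_mem[OF i j]]
        unfolding x[OF i] x[OF j_mem[OF i j]] 1 exp_divide 2 ..
    qed
    also have "\<dots> = exp e1 * t1"
      unfolding e1_def t1_def by (simp only: prod_exp_mult finite_greaterThanAtMost finite_atLeastAtMost)
    finally show ?thesis .
  qed
  define e2' where "e2' = 2 * \<eta> * (KK - (\<Sum>i=1..r. \<Sum>j\<in>{i<..r}. kk i * kk j))"
  have B2: "q powi (int K - int (e2 r k)) = exp e2'"
  proof -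
    have "(of_int (int K - int (e2 r k)) :: complex) = KK - (\<Sum>i=1..r. \<Sum>j\<in>{i<..r}. kk i * kk j)"
      unfolding of_int_diff of_int_of_nat_eq KK e2_def kk_def by simp
    then show ?thesis unfolding q exp2_powi unfolding e2'_def exp2_def by (simp only: mult_ac)
  qed
  define e3 where "e3 = facexp (2 * \<alpha> + \<eta>) (2 * \<eta>) KK"
  define t3 where "t3 = fac (2 * \<alpha> + \<eta>) (2 * \<eta>) K"
  have B3: "efac (q ^ 2) p [a ^ 2 * q] K = exp e3 * t3"
  proof -
    have "a ^ 2 * q = exp2 (2 * \<alpha> + \<eta>)" by (simp add: a q exp2_power exp2_add)
    then show ?thesis unfolding q2 e3_def t3_def KK[symmetric] by (simp only: efac_exp2)
  qed
  define e4 where "e4 = facexp (of_nat (Suc N) * \<eta>) \<eta> KK + facexp (- of_nat N * \<eta>) \<eta> KK"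
  define t4 where "t4 = fac (of_nat (Suc N) * \<eta>) \<eta> K * fac (- of_nat N * \<eta>) \<eta> K"
  have B4: "efac q p [q ^ (N + 1), q powi (- int N)] K = exp e4 * t4"
  proof -
    have 1: "q ^ (N + 1) = exp2 (of_nat (Suc N) * \<eta>)" unfolding q exp2_power by simp
    have 2: "q powi (- int N) = exp2 (- of_nat N * \<eta>)" unfolding q exp2_powi by simp
    show ?thesis
      unfolding efac_Cons 1 2 unfolding q efac_exp2 KK exp_mult e4_def t4_def ..
  qed
  let ?e5 = "\<lambda>i. facexp (\<alpha> + \<xi> i + of_nat (N + 2) * \<eta>) (2 * \<eta>) (kk i) + facexp (\<alpha> + \<xi> i + (1 - of_nat N) * \<eta>) (2 * \<eta>) (kk i)"
  let ?t5 = "\<lambda>i. fac (\<alpha> + \<xi> i + of_nat (N + 2) * \<eta>) (2 * \<eta>) (k i) * fac (\<alpha> + \<xi> i + (1 - of_nat N) * \<eta>) (2 * \<eta>) (k i)"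
  define e5 where "e5 = (\<Sum>i=1..r. ?e5 i)"
  define t5 where "t5 = (\<Prod>i=1..r. ?t5 i)"
  let ?L5 = "\<lambda>i. efac (q ^ 2) p [a * x i * q ^ (N + 2), a * x i * q powi (1 - int N)] (k i)"
  have B5: "(\<Prod>i=1..r. ?L5 i) = exp e5 * t5"
  proof -
    have "?L5 i = exp (?e5 i) * ?t5 i" if i: "i \<in> {1..r}" for i
    proof -
      have 1: "a * x i * q ^ (N + 2) = exp2 (\<alpha> + \<xi> i + of_nat (N + 2) * \<eta>)"
        unfolding a x[OF i] q exp2_simps ..
      have 2: "a * x i * q powi (1 - int N) = exp2 (\<alpha> + \<xi> i + (1 - of_nat N) * \<eta>)"
        unfolding a x[OF i] q exp2_simps by simp
      show ?thesis
        unfolding efac_Cons 1 2 q2 efac_exp2 kk_def exp_mult ..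
    qed
    then have "(\<Prod>i=1..r. ?L5 i) = (\<Prod>i=1..r. exp (?e5 i) * ?t5 i)" by (intro prod.cong refl)
    then show ?thesis unfolding e5_def t5_def by (simp only: prod_exp_mult finite_atLeastAtMost)
  qed
  define e6 where "e6 = (\<Sum>i=1..r. \<Sum>j\<in>{i<..r}. facexp (\<xi> i + \<xi> j) (2 * \<eta>) (kk i + kk j))"
  define t6 where "t6 = (\<Prod>i=1..r. \<Prod>j\<in>{i<..r}. fac (\<xi> i + \<xi> j) (2 * \<eta>) (k i + k j))"
  have B6: "(\<Prod>i=1..r. \<Prod>j\<in>{i<..r}. 1 / efac (q ^ 2) p [x i * x j] (k i + k j)) = 1 / (exp e6 * t6)"
  proof -
    have "(\<Prod>i=1..r. \<Prod>j\<in>{i<..r}. efac (q ^ 2) p [x i * x j] (k i + k j))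
      = (\<Prod>i=1..r. \<Prod>j\<in>{i<..r}. exp (facexp (\<xi> i + \<xi> j) (2 * \<eta>) (kk i + kk j)) * fac (\<xi> i + \<xi> j) (2 * \<eta>) (k i + k j))"
    proof (intro prod.cong refl)
      fix i j assume i: "i \<in> {1..r}" and j: "j \<in> {i<..r}"
      show "efac (q ^ 2) p [x i * x j] (k i + k j)
        = exp (facexp (\<xi> i + \<xi> j) (2 * \<eta>) (kk i + kk j)) * fac (\<xi> i + \<xi> j) (2 * \<eta>) (k i + k j)"
        unfolding x[OF i] x[OF j_mem[OF i j]] exp2_add q2 efac_exp2 of_nat_add kk_def ..
    qed
    also have "\<dots> = exp e6 * t6"
      unfolding e6_def t6_def by (simp only: prod_exp_mult finite_greaterThanAtMost finite_atLeastAtMost)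
    finally show ?thesis unfolding prod_dividef by simp
  qed
  let ?e7 = "\<lambda>i j. facexp (\<xi> i + \<beta> j) (2 * \<eta>) (kk i) + facexp (\<xi> i - \<beta> j) (2 * \<eta>) (kk i)"
  let ?t7 = "\<lambda>i j. fac (\<xi> i + \<beta> j) (2 * \<eta>) (k i) * fac (\<xi> i - \<beta> j) (2 * \<eta>) (k i)"
  let ?e8 = "\<lambda>i j. facexp (2 * \<eta> + \<xi> i - \<xi> j) (2 * \<eta>) (kk i)"
  let ?t8 = "\<lambda>i j. fac (2 * \<eta> + \<xi> i - \<xi> j) (2 * \<eta>) (k i)"
  define e7 where "e7 = (\<Sum>i=1..r. \<Sum>j=1..r. ?e7 i j)"
  define t7 where "t7 = (\<Prod>i=1..r. \<Prod>j=1..r. ?t7 i j)"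
  define e8 where "e8 = (\<Sum>i=1..r. \<Sum>j=1..r. ?e8 i j)"
  define t8 where "t8 = (\<Prod>i=1..r. \<Prod>j=1..r. ?t8 i j)"
  let ?L7 = "\<lambda>i j. efac (q ^ 2) p [b j * x i, x i / b j] (k i)"
  let ?L8 = "\<lambda>i j. efac (q ^ 2) p [q ^ 2 * x i / x j] (k i)"
  have B7: "(\<Prod>i=1..r. \<Prod>j=1..r. ?L7 i j / ?L8 i j) = (exp e7 * t7) / (exp e8 * t8)"
  proof -
    have 1: "?L7 i j = exp (?e7 i j) * ?t7 i j" "?L8 i j = exp (?e8 i j) * ?t8 i j"
      if i: "i \<in> {1..r}" and j: "j \<in> {1..r}" for i j
    proof -
      have 1: "b j * x i = exp2 (\<xi> i + \<beta> j)" unfolding b[OF j] x[OF i] exp2_add by (simp add: add.commute)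
      have 2: "x i / b j = exp2 (\<xi> i - \<beta> j)" unfolding b[OF j] x[OF i] exp2_diff ..
      have 3: "q ^ 2 * x i / x j = exp2 (2 * \<eta> + \<xi> i - \<xi> j)" unfolding q2 x[OF i] x[OF j] exp2_simps ..
      show "?L7 i j = exp (?e7 i j) * ?t7 i j" unfolding efac_Cons 1 2 q2 efac_exp2 kk_def exp_mult ..
      show "?L8 i j = exp (?e8 i j) * ?t8 i j" unfolding 3 unfolding q2 efac_exp2 kk_def ..
    qed
    have "(\<Prod>i=1..r. \<Prod>j=1..r. ?L7 i j / ?L8 i j)
      = (\<Prod>i=1..r. \<Prod>j=1..r. (exp (?e7 i j) * ?t7 i j) / (exp (?e8 i j) * ?t8 i j))"
      by (intro prod.cong refl arg_cong2[of _ _ _ _ "(/)"] 1)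
    then show ?thesis
      unfolding e7_def t7_def e8_def t8_def by (simp only: prod_dividef prod_exp_mult finite_atLeastAtMost)
  qed
  let ?e9 = "\<lambda>i. facexp (\<alpha> + \<xi> i) \<eta> KK + facexp (\<alpha> - \<xi> i + \<eta>) \<eta> (KK - kk i)
        - (facexp (\<alpha> - \<beta> i + \<eta>) \<eta> KK + facexp (\<alpha> + \<beta> i + \<eta>) \<eta> KK + facexp (\<xi> i - \<alpha> + (kk i - KK) * \<eta>) \<eta> (kk i))"
  let ?t9 = "\<lambda>i. fac (\<alpha> + \<xi> i) \<eta> K * fac (\<alpha> - \<xi> i + \<eta>) \<eta> (K - k i)
        / ((fac (\<alpha> - \<beta> i + \<eta>) \<eta> K * fac (\<alpha> + \<beta> i + \<eta>) \<eta> K) * fac (\<xi> i - \<alpha> + (of_nat (k i) - of_nat K) * \<eta>) \<eta> (k i))"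
  let ?s = "\<lambda>i. ?\<sigma> (\<alpha> + \<xi> i + of_nat (2 * k i + K) * \<eta>) / ?\<sigma> (\<alpha> + \<xi> i)"
  define e9 where "e9 = (\<Sum>i=1..r. (2 * kk i + KK) * \<eta> + ?e9 i)"
  define t9 where "t9 = (\<Prod>i=1..r. ?s i * ?t9 i)"
  let ?\<theta> = "\<lambda>i. theta p (a * x i * q ^ (2 * k i + K)) / theta p (a * x i)"
  let ?L9 = "\<lambda>i. efac q p [a * x i] K * efac q p [a * q / x i] (K - k i)
      / (efac q p [a * q / b i, a * b i * q] K * efac q p [q powi (int (k i) - int K) * x i / a] (k i))"
  have B9: "(\<Prod>i=1..r. ?\<theta> i * ?L9 i) = exp e9 * t9"
  proof -
    have "?\<theta> i * ?L9 i = exp ((2 * kk i + KK) * \<eta> + ?e9 i) * (?s i * ?t9 i)" if i: "i \<in> {1..r}" for i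
    proof -
      have 1: "a * x i * q ^ (2 * k i + K) = exp2 (\<alpha> + \<xi> i + of_nat (2 * k i + K) * \<eta>)" "a * x i = exp2 (\<alpha> + \<xi> i)"
        unfolding a x[OF i] q exp2_simps by (rule refl)+
      have 2: "a * q / x i = exp2 (\<alpha> - \<xi> i + \<eta>)" "a * q / b i = exp2 (\<alpha> - \<beta> i + \<eta>)" "a * b i * q = exp2 (\<alpha> + \<beta> i + \<eta>)"
        unfolding a x[OF i] b[OF i] q exp2_simps by (rule arg_cong[of _ _ exp2], simp add: algebra_simps)+
      have 3: "q powi (int (k i) - int K) * x i / a = exp2 (\<xi> i - \<alpha> + (of_nat (k i) - of_nat K) * \<eta>)"
        unfolding a x[OF i] q exp2_simps by (rule arg_cong[of _ _ exp2]) (simp add: algebra_simps)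
      have 4: "of_nat (K - k i) = KK - kk i" using kK[OF i] by (simp add: of_nat_diff KK kk_def)
      have 5: "\<alpha> + \<xi> i + of_nat (2 * k i + K) * \<eta> - (\<alpha> + \<xi> i) = (2 * kk i + KK) * \<eta>"
        by (simp add: KK kk_def)
      have "?\<theta> i = exp ((2 * kk i + KK) * \<eta>) * ?s i"
        unfolding 1(1) unfolding 1(2) theta_exp2 exp_divide 5 ..
      moreover have "?L9 i = exp (?e9 i) * ?t9 i"
        unfolding efac_Cons 1(2) 2 3 unfolding q efac_exp2 4 KK kk_def[symmetric] exp_mult exp_divide ..
      ultimately show ?thesis by (simp only: exp_mult)
    qed
    then have "(\<Prod>i=1..r. ?\<theta> i * ?L9 i) = (\<Prod>i=1..r. exp ((2 * kk i + KK) * \<eta> + ?e9 i) * (?s i * ?t9 i))"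
      by (intro prod.cong refl)
    then show ?thesis unfolding e9_def t9_def by (simp only: prod_exp_mult finite_atLeastAtMost)
  qed
  have "e1 + e2' + e3 + e4 - e5 - e6 + e7 - e8 + e9 = 0"
    using exponent_sum[where \<eta> = \<eta> and r = r and k = kk and \<alpha> = \<alpha> and N = N and \<xi> = \<xi> and \<beta> = \<beta>]
    unfolding e1_def e2'_def e3_def e4_def e5_def e6_def e7_def e8_def e9_def KK_def by (simp only: add.assoc)
  then have e0: "exp e1 * exp e2' * exp e3 * exp e4 / exp e5 / exp e6 * exp e7 / exp e8 * exp e9 = 1"
    by (simp only: exp_add[symmetric] exp_diff[symmetric] exp_zero)
  have t1678: "t1 / t6 / t8 = V k"
    unfolding V_def t1_def t6_def t8_def prod_dividef ..
  have t34: "t3 * t4 = U \<eta> N \<alpha> K" unfolding U_def t3_def t4_def ..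
  define tb where "tb = (\<Prod>i=1..r. fac (\<alpha> - \<beta> i + \<eta>) \<eta> K * fac (\<alpha> + \<beta> i + \<eta>) \<eta> K)"
  have t95: "t9 / t5 = (\<Prod>i=1..r. W \<eta> N \<alpha> (\<xi> i) (k i) K) / tb"
    unfolding t9_def t5_def tb_def prod_dividef[symmetric] W_def
    by (rule prod.cong[OF refl]) (simp only: divide_inverse inverse_mult_distrib mult_ac)
  have "(exp e1 * t1) * exp e2' * ((exp e3 * t3) * (exp e4 * t4) / (exp e5 * t5)) * (1 / (exp e6 * t6))
      * ((exp e7 * t7) / (exp e8 * t8)) * (exp e9 * t9)
    = (exp e1 * exp e2' * exp e3 * exp e4 / exp e5 / exp e6 * exp e7 / exp e8 * exp e9)
      * ((t1 / t6 / t8) * (t3 * t4) * (t9 / t5) * t7)"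
    by (simp only: divide_inverse inverse_mult_distrib mult_ac mult_1_left)
  also have "\<dots> = summand N \<alpha> \<beta> k"
    unfolding e0 t1678 t34 t95 summand_def C_def K_def[symmetric] tb_def t7_def
    by (simp only: divide_inverse mult_ac mult_1_left)
  finally show ?thesis
    unfolding K_def[symmetric] B1 B2 B3 B4 B5 B6 B7 B9 .
qed

section \<open>Removal of genericity by continuity in the logarithm of a\<close>

lemma isCont_sum_prod:
  fixes f :: "'i \<Rightarrow> complex \<Rightarrow> complex"
  shows "(\<And>i. i \<in> I \<Longrightarrow> isCont (f i) a) \<Longrightarrow> isCont (\<lambda>t. \<Sum>i\<in>I. f i t) a"
    and "(\<And>i. i \<in> I \<Longrightarrow> isCont (f i) a) \<Longrightarrow> isCont (\<lambda>t. \<Prod>i\<in>I. f i t) a"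
  unfolding isCont_def by (rule tendsto_sum, simp) (rule tendsto_prod, simp)

lemma isCont_odd_theta_comp:
  fixes f :: "complex \<Rightarrow> complex"
  shows "isCont f a \<Longrightarrow> isCont (\<lambda>t. odd_theta p (f t)) a"
  by (rule isCont_o2[OF _ isCont_odd_theta[OF p]])

lemma isCont_fac:
  fixes f :: "complex \<Rightarrow> complex"
  shows "isCont f a \<Longrightarrow> isCont (\<lambda>t. fac (f t) h n) a"
  unfolding fac_def by (intro isCont_sum_prod isCont_odd_theta_comp isCont_add) auto

text \<open>These are the denominators of \<open>summand\<close> that vary with
  \<open>\<alpha>\<close>; those in \<open>V\<close> are constant.\<close>

definition regular :: "nat \<Rightarrow> complex \<Rightarrow> (nat \<Rightarrow> complex) \<Rightarrow> (nat \<Rightarrow> nat) \<Rightarrow> bool" where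
  "regular N \<alpha> \<beta> k \<longleftrightarrow> (\<forall>i\<in>{1..r}. odd_theta p (\<alpha> + \<xi> i) \<noteq> 0
    \<and> fac (\<xi> i - \<alpha> + (of_nat (k i) - of_nat (weight r k)) * \<eta>) \<eta> (k i) \<noteq> 0
    \<and> fac (\<alpha> + \<xi> i + of_nat (N + 2) * \<eta>) (2 * \<eta>) (k i) \<noteq> 0
    \<and> fac (\<alpha> + \<xi> i + (1 - of_nat N) * \<eta>) (2 * \<eta>) (k i) \<noteq> 0
    \<and> fac (\<alpha> - \<beta> i + \<eta>) \<eta> (weight r k) \<noteq> 0 \<and> fac (\<alpha> + \<beta> i + \<eta>) \<eta> (weight r k) \<noteq> 0)"

lemma isCont_summand: "regular N \<alpha> \<beta> k \<Longrightarrow> isCont (\<lambda>\<alpha>. summand N \<alpha> \<beta> k) \<alpha>"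
  unfolding summand_def C_def U_def W_def
  by (intro isCont_mult isCont_divide isCont_sum_prod isCont_fac isCont_odd_theta_comp isCont_add isCont_diff
      isCont_minus continuous_ident continuous_const)
    (auto simp: regular_def)

lemma isCont_closed_form:
  assumes "\<And>i. i \<in> {1..r} \<Longrightarrow> lower c m \<alpha> (\<xi> i) \<noteq> 0" "\<And>i. i \<in> {1..r} \<Longrightarrow> upper c m \<alpha> (\<beta> i) \<noteq> 0"
  shows "isCont (\<lambda>\<alpha>. closed_form c m \<alpha> \<beta>) \<alpha>"
proof -
  have "isCont (\<lambda>\<alpha>. lower c m \<alpha> z) \<alpha>" "isCont (\<lambda>\<alpha>. upper c m \<alpha> z) \<alpha>" for z
    unfolding lower_def upper_def
    by (intro isCont_mult isCont_fac isCont_add isCont_diff continuous_ident continuous_const)+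
  then show ?thesis
    unfolding closed_form_def
    by (intro isCont_mult isCont_divide isCont_sum_prod) (use assms in auto)
qed

text \<open>Each failure is a zero of \<open>odd_theta\<close> at an affine function of
  \<open>\<alpha>\<close> with slope 1 or 2, and there are countably many such functions.\<close>

lemma countable_bad:
  "countable {\<alpha>. \<not> (generic \<alpha> \<and> (\<forall>j\<in>{1..r}. E (\<alpha> + \<eta>) (\<beta> j) N \<noteq> 0))}"
proof (rule countable_subset)
  let ?Z = "\<lambda>u c. {\<alpha>. odd_theta p (u * \<alpha> + c) = 0}"
  let ?B = "(\<Union>s::int. ?Z 2 (of_int s * \<eta>) \<union> (\<Union>i\<in>{1..r}. ?Z 1 (\<xi> i + of_int s * \<eta>) \<union> ?Z 1 (of_int s * \<eta> - \<xi> i)))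
    \<union> (\<Union>j\<in>{1..r}. \<Union>s::nat. ?Z 1 (\<eta> + of_nat s * \<eta> + \<beta> j) \<union> ?Z 1 (\<eta> + of_nat s * \<eta> - \<beta> j))"
  have "countable (?Z u c)" if "u \<noteq> 0" for u c
  proof (rule countable_subset)
    show "?Z u c \<subseteq> (\<lambda>w. (w - c) / u) ` {w. odd_theta p w = 0}"
    proof
      fix \<alpha> assume "\<alpha> \<in> ?Z u c"
      then show "\<alpha> \<in> (\<lambda>w. (w - c) / u) ` {w. odd_theta p w = 0}"
        using that by (intro image_eqI[of _ _ "u * \<alpha> + c"]) auto
    qed
    show "countable ((\<lambda>w. (w - c) / u) ` {w. odd_theta p w = 0})"
      by (intro countable_image countable_odd_theta_zeros p)
  qed
  note Z = this[of 1, OF one_neq_zero] this[of 2, OF zero_neq_numeral[symmetric]]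
  show "countable ?B"
    by (intro countable_Un countable_UN Z) (auto intro: countable_finite)
  show "{\<alpha>. \<not> (generic \<alpha> \<and> (\<forall>j\<in>{1..r}. E (\<alpha> + \<eta>) (\<beta> j) N \<noteq> 0))} \<subseteq> ?B"
  proof
    fix \<alpha> assume bad: "\<alpha> \<in> {\<alpha>. \<not> (generic \<alpha> \<and> (\<forall>j\<in>{1..r}. E (\<alpha> + \<eta>) (\<beta> j) N \<noteq> 0))}"
    show "\<alpha> \<in> ?B"
    proof (rule ccontr)
      assume n: "\<alpha> \<notin> ?B"
      have 1: "odd_theta p (2 * \<alpha> + of_int s * \<eta>) \<noteq> 0" for s :: int using n by blast
      have 2: "odd_theta p (\<alpha> + \<xi> i + of_int s * \<eta>) \<noteq> 0" "odd_theta p (\<alpha> - \<xi> i + of_int s * \<eta>) \<noteq> 0" if "i \<in> {1..r}" for s :: int and i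
      proof -
        have "odd_theta p (1 * \<alpha> + (\<xi> i + of_int s * \<eta>)) \<noteq> 0" "odd_theta p (1 * \<alpha> + (of_int s * \<eta> - \<xi> i)) \<noteq> 0"
          using n that by blast+
        then show "odd_theta p (\<alpha> + \<xi> i + of_int s * \<eta>) \<noteq> 0" "odd_theta p (\<alpha> - \<xi> i + of_int s * \<eta>) \<noteq> 0"
          by (simp_all add: algebra_simps)
      qed
      have 3: "E (\<alpha> + \<eta>) (\<beta> j) N \<noteq> 0" if "j \<in> {1..r}" for j
      proof -
        have "odd_theta p (1 * \<alpha> + (\<eta> + of_nat s * \<eta> + \<beta> j)) \<noteq> 0" "odd_theta p (1 * \<alpha> + (\<eta> + of_nat s * \<eta> - \<beta> j)) \<noteq> 0" for s :: nat
          using n that by blast+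
        then have "br (\<alpha> + \<eta> + of_nat s * \<eta>) (\<beta> j) \<noteq> 0" for s :: nat
          by (simp add: br_def add_diff_eq add.assoc)
        then show ?thesis by (simp add: E_def)
      qed
      show False using bad 1 2 3 unfolding generic_def by blast
    qed
  qed
qed

theorem sum_summand_all:
  assumes sep: "separated N"
    and "\<And>k. k \<in> multi_indices r N \<Longrightarrow> regular N \<alpha> \<beta> k"
    and "\<And>i. i \<in> {1..r} \<Longrightarrow> lower c m \<alpha> (\<xi> i) \<noteq> 0" "\<And>i. i \<in> {1..r} \<Longrightarrow> upper c m \<alpha> (\<beta> i) \<noteq> 0"
    and par: "(N = 2 * m \<and> c = \<eta>) \<or> (Suc N = 2 * m \<and> c = 0)"
  shows "(\<Sum>k\<in>multi_indices r N. summand N \<alpha> \<beta> k) = closed_form c m \<alpha> \<beta>"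
proof -
  define S where "S = {\<alpha>. generic \<alpha> \<and> (\<forall>j\<in>{1..r}. E (\<alpha> + \<eta>) (\<beta> j) N \<noteq> 0)}"
  have "\<alpha> islimpt S"
    unfolding islimpt_approachable
  proof (intro allI impI)
    fix e :: real assume "e > 0"
    \<comment> \<open>A ball is uncountable, so good values other than \<open>\<alpha>\<close>
      itself lie arbitrarily close to it.\<close>
    then have "uncountable (ball \<alpha> e - (- S \<union> {\<alpha>}))"
      using countable_bad[of \<beta> N] by (intro uncountable_minus_countable uncountable_ball) (auto simp: S_def Compl_eq)
    then have "ball \<alpha> e - (- S \<union> {\<alpha>}) \<noteq> {}" by (metis countable_empty)
    then show "\<exists>y\<in>S. y \<noteq> \<alpha> \<and> dist y \<alpha> < e" by (auto simp: dist_commute)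
  qed
  then have nontriv: "at \<alpha> within S \<noteq> bot" by (simp add: trivial_limit_within)
  have "isCont (\<lambda>\<alpha>. \<Sum>k\<in>multi_indices r N. summand N \<alpha> \<beta> k) \<alpha>"
    by (intro isCont_sum_prod isCont_summand assms)
  then have L: "((\<lambda>\<alpha>. \<Sum>k\<in>multi_indices r N. summand N \<alpha> \<beta> k) \<longlongrightarrow> (\<Sum>k\<in>multi_indices r N. summand N \<alpha> \<beta> k)) (at \<alpha> within S)"
    unfolding isCont_def by (rule tendsto_within_subset) simp
  have "isCont (\<lambda>\<alpha>. closed_form c m \<alpha> \<beta>) \<alpha>"
    by (intro isCont_closed_form assms)
  then have R: "((\<lambda>\<alpha>. closed_form c m \<alpha> \<beta>) \<longlongrightarrow> closed_form c m \<alpha> \<beta>) (at \<alpha> within S)"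
    unfolding isCont_def by (rule tendsto_within_subset) simp
  have "eventually (\<lambda>\<alpha>. closed_form c m \<alpha> \<beta> = (\<Sum>k\<in>multi_indices r N. summand N \<alpha> \<beta> k)) (at \<alpha> within S)"
    unfolding eventually_at_topological
    by (intro exI[of _ UNIV]) (auto simp: S_def intro!: sum_summand[OF _ sep _ par, symmetric])
  from Lim_transform_eventually[OF R this] show ?thesis
    by (rule tendsto_unique[OF nontriv L])
qed

lemma efac_exp2_nonzero: "efac (exp2 h) p [exp2 u] n \<noteq> 0 \<longleftrightarrow> fac u h n \<noteq> 0"
  by (simp add: efac_exp2)

lemma denominator_nonzero:
  "efac (exp2 (2 * \<eta>)) p [exp2 (c - \<alpha> - u), exp2 (u - \<alpha> + c), exp2 (\<alpha> - v + (c + \<eta>)), exp2 (\<alpha> + v + (c + \<eta>))] m \<noteq> 0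
    \<longleftrightarrow> lower c m \<alpha> u \<noteq> 0 \<and> upper c m \<alpha> v \<noteq> 0"
  unfolding efac_Cons
    mult_eq_0_iff de_Morgan_disj efac_exp2_nonzero lower_def upper_def by blast

text \<open>\<open>facexp\<close> is affine in its first argument, and the four arguments in the
  numerator have the same sum, \<open>4 * c + 2 * \<eta>\<close>, as those in the denominator, so
  the exponentials cancel.\<close>

lemma factor_eq:
  "efac (exp2 (2 * \<eta>)) p [exp2 (\<alpha> + u + (c + \<eta>)), exp2 (\<alpha> - u + (c + \<eta>)), exp2 (v - \<alpha> + c), exp2 (c - \<alpha> - v)] m
   / efac (exp2 (2 * \<eta>)) p [exp2 (c - \<alpha> - u), exp2 (u - \<alpha> + c), exp2 (\<alpha> - v + (c + \<eta>)), exp2 (\<alpha> + v + (c + \<eta>))] m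
   = upper c m \<alpha> u * lower c m \<alpha> v / (lower c m \<alpha> u * upper c m \<alpha> v)"
proof -
  let ?f = "\<lambda>u. fac u (2 * \<eta>) m" and ?e = "\<lambda>u. facexp u (2 * \<eta>) (of_nat m)"
  have "efac (exp2 (2 * \<eta>)) p [exp2 u1, exp2 u2, exp2 u3, exp2 u4] m = exp (?e u1 + (?e u2 + (?e u3 + ?e u4))) * (?f u1 * (?f u2 * (?f u3 * ?f u4)))"
    for u1 u2 u3 u4 unfolding efac_Cons efac_exp2 exp_mult ..
  moreover have "?e (\<alpha> + u + (c + \<eta>)) + (?e (\<alpha> - u + (c + \<eta>)) + (?e (v - \<alpha> + c) + ?e (c - \<alpha> - v)))
     - (?e (c - \<alpha> - u) + (?e (u - \<alpha> + c) + (?e (\<alpha> - v + (c + \<eta>)) + ?e (\<alpha> + v + (c + \<eta>))))) = 0"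
    by (simp add: facexp_def algebra_simps)
  ultimately show ?thesis
    unfolding upper_def lower_def by (simp only: exp_divide exp_zero mult_1_left) (simp only: mult_ac)
qed

end

section \<open>Return to the multiplicative statement\<close>

lemma exp2_half_Ln: "z \<noteq> 0 \<Longrightarrow> exp2 (Ln z / 2) = z"
  by (simp add: exp2_def)

theorem corollary4p8:
  fixes p q a :: complex and b x :: "nat \<Rightarrow> complex" and r N :: nat
  assumes pq: "admissible_nome_base p q"
    and r: "r \<ge> 1"
    and a: "a \<noteq> 0"
    and b: "\<And>i. i \<in> {1..r} \<Longrightarrow> b i \<noteq> 0"
    and x: "\<And>i. i \<in> {1..r} \<Longrightarrow> x i \<noteq> 0"
    \<comment> \<open>no denominator on the left-hand side vanishes\<close>
    and den_Delta: "Delta p r x \<noteq> 0"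
    and den_N: "\<And>k i. k \<in> multi_indices r N \<Longrightarrow> i \<in> {1..r} \<Longrightarrow>
      efac (q ^ 2) p [a * x i * q ^ (N + 2), a * x i * q powi (1 - int N)] (k i) \<noteq> 0"
    and den_xx: "\<And>k i j. k \<in> multi_indices r N \<Longrightarrow> i \<in> {1..r} \<Longrightarrow> j \<in> {i<..r} \<Longrightarrow>
      efac (q ^ 2) p [x i * x j] (k i + k j) \<noteq> 0"
    and den_quot: "\<And>k i j. k \<in> multi_indices r N \<Longrightarrow> i \<in> {1..r} \<Longrightarrow> j \<in> {1..r} \<Longrightarrow>
      efac (q ^ 2) p [q ^ 2 * x i / x j] (k i) \<noteq> 0"
    and den_theta: "\<And>i. i \<in> {1..r} \<Longrightarrow> theta p (a * x i) \<noteq> 0"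
    and den_b: "\<And>k i. k \<in> multi_indices r N \<Longrightarrow> i \<in> {1..r} \<Longrightarrow>
      efac q p [a * q / b i, a * b i * q] (weight r k) \<noteq> 0"
    and den_x: "\<And>k i. k \<in> multi_indices r N \<Longrightarrow> i \<in> {1..r} \<Longrightarrow>
      efac q p [q powi (int (k i) - int (weight r k)) * x i / a] (k i) \<noteq> 0"
    \<comment> \<open>no denominator on the right-hand side vanishes\<close>
    and den_even: "\<And>m i. N = 2 * m \<Longrightarrow> i \<in> {1..r} \<Longrightarrow>
      efac (q ^ 2) p [q / (a * x i), x i * q / a, a * q ^ 2 / b i, a * b i * q ^ 2] m \<noteq> 0"
    and den_odd: "\<And>m i. int N = 2 * int m - 1 \<Longrightarrow> i \<in> {1..r} \<Longrightarrow>
      efac (q ^ 2) p [1 / (a * x i), x i / a, a * q / b i, a * b i * q] m \<noteq> 0"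
  defines "L \<equiv> (\<Sum>k\<in>multi_indices r N.
      Delta p r (\<lambda>i. x i * q ^ (2 * k i)) / Delta p r x
      * q powi (int (weight r k) - int (e2 r k))
      * (efac (q ^ 2) p [a ^ 2 * q] (weight r k)
         * efac q p [q ^ (N + 1), q powi (- int N)] (weight r k)
         / (\<Prod>i=1..r. efac (q ^ 2) p [a * x i * q ^ (N + 2), a * x i * q powi (1 - int N)] (k i)))
      * (\<Prod>i=1..r. \<Prod>j\<in>{i<..r}. 1 / efac (q ^ 2) p [x i * x j] (k i + k j))
      * (\<Prod>i=1..r. \<Prod>j=1..r.
           efac (q ^ 2) p [b j * x i, x i / b j] (k i) / efac (q ^ 2) p [q ^ 2 * x i / x j] (k i))
      * (\<Prod>i=1..r.
           theta p (a * x i * q ^ (2 * k i + weight r k)) / theta p (a * x i)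
           * (efac q p [a * x i] (weight r k) * efac q p [a * q / x i] (weight r k - k i)
              / (efac q p [a * q / b i, a * b i * q] (weight r k)
                 * efac q p [q powi (int (k i) - int (weight r k)) * x i / a] (k i)))))"
  shows "(\<forall>m. N = 2 * m \<longrightarrow>
            L = (\<Prod>i=1..r.
              efac (q ^ 2) p [a * x i * q ^ 2, a * q ^ 2 / x i, b i * q / a, q / (a * b i)] m
              / efac (q ^ 2) p [q / (a * x i), x i * q / a, a * q ^ 2 / b i, a * b i * q ^ 2] m))
       \<and> (\<forall>m. int N = 2 * int m - 1 \<longrightarrow>
            L = (\<Prod>i=1..r.
              efac (q ^ 2) p [a * x i * q, a * q / x i, b i / a, 1 / (a * b i)] m
              / efac (q ^ 2) p [1 / (a * x i), x i / a, a * q / b i, a * b i * q] m))"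
proof -
  define \<eta> where "\<eta> = Ln q / 2"
  define \<alpha> where "\<alpha> = Ln a / 2"
  define \<xi> where "\<xi> i = Ln (x i) / 2" for i
  define \<beta> where "\<beta> i = Ln (b i) / 2" for i
  have p: "norm p < 1" and q0: "q \<noteq> 0" and adm: "\<And>k n. k > 0 \<Longrightarrow> q ^ k \<noteq> p powi n"
    using pq unfolding admissible_nome_base_def by blast+
  have q: "q = exp2 \<eta>" using q0 by (simp add: \<eta>_def exp2_half_Ln)
  have a': "a = exp2 \<alpha>" using a by (simp add: \<alpha>_def exp2_half_Ln)
  have x': "x i = exp2 (\<xi> i)" if "i \<in> {1..r}" for i using x[OF that] by (simp add: \<xi>_def exp2_half_Ln)
  have b': "b i = exp2 (\<beta> i)" if "i \<in> {1..r}" for i using b[OF that] by (simp add: \<beta>_def exp2_half_Ln)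
  interpret theta_sum p \<eta> r \<xi>
  proof
    show "norm p < 1" by (rule p)
    fix n :: nat assume n: "n > 0"
    show "odd_theta p (of_nat n * \<eta>) \<noteq> 0"
    proof
      assume "odd_theta p (of_nat n * \<eta>) = 0"
      then have "theta p (q ^ n) = 0" unfolding q exp2_power by (simp add: odd_theta_eq_0_iff exp2_def)
      then show False using theta_zero_imp[OF p, of "q ^ n"] q0 adm[OF n] by auto
    qed
  qed
  have q2: "q ^ 2 = exp2 (2 * \<eta>)" unfolding q exp2_power by simp
  have theta_nz: "odd_theta p u \<noteq> 0" if "theta p (exp2 u) \<noteq> 0" for u using that by (simp add: theta_exp2)
  \<comment> \<open>The multi-index with a single entry N, at place \<open>i\<close>: there the
    factorials in the hypotheses reach length N, so each of their factors with index below N is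
    nonzero.\<close>
  define single where "single i = (\<lambda>l\<in>{1..r}. if l = i then N else 0)" for i
  have single: "single i \<in> multi_indices r N" "single i i = N" if "i \<in> {1..r}" for i
    using that by (auto simp: single_def multi_indices_def weight_def)
  have single_0: "single i j = 0" if "j \<in> {1..r}" "j \<noteq> i" for i j using that by (simp add: single_def)
  have fac_nz: "odd_theta p (u + of_nat s * h) \<noteq> 0" if "fac u h n \<noteq> 0" "s < n" for u h s n
    using that by (simp add: fac_def)
  have diff0: "odd_theta p (\<xi> i - \<xi> j) \<noteq> 0" if i: "i \<in> {1..r}" and j: "j \<in> {i<..r}" for i j
  proof (rule theta_nz)
    have j': "j \<in> {1..r}" using i j by auto
    have "\<forall>i\<in>{1..r}. \<forall>j\<in>{i<..r}. x j * theta p (x i / x j) \<noteq> 0"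
      using den_Delta by (simp add: Delta_def del: One_nat_def)
    then have "x j * theta p (x i / x j) \<noteq> 0" using i j by blast
    then show "theta p (exp2 (\<xi> i - \<xi> j)) \<noteq> 0" unfolding x'[OF i] x'[OF j'] exp2_diff by auto
  qed
  have diff_pos: "odd_theta p (\<xi> i - \<xi> j + 2 * of_nat (Suc s) * \<eta>) \<noteq> 0" if i: "i \<in> {1..r}" and j: "j \<in> {1..r}" and s: "s < N" for i j s
  proof -
    have 1: "q ^ 2 * x i / x j = exp2 (2 * \<eta> + \<xi> i - \<xi> j)" unfolding q2 x'[OF i] x'[OF j] exp2_simps ..
    have "fac (2 * \<eta> + \<xi> i - \<xi> j) (2 * \<eta>) N \<noteq> 0"
      using den_quot[OF single(1)[OF i] i j] unfolding 1 single(2)[OF i] unfolding q2 efac_exp2_nonzero .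
    from fac_nz[OF this s] show ?thesis by (simp add: algebra_simps)
  qed
  have plus: "odd_theta p (\<xi> i + \<xi> j + 2 * of_nat s * \<eta>) \<noteq> 0" if i: "i \<in> {1..r}" and j: "j \<in> {i<..r}" and s: "s < N" for i j s
  proof -
    have j': "j \<in> {1..r}" "j \<noteq> i" using i j by auto
    have "fac (\<xi> i + \<xi> j) (2 * \<eta>) N \<noteq> 0"
      using den_xx[OF single(1)[OF i] i j] unfolding single(2)[OF i] single_0[OF j'] q2 x'[OF i] x'[OF j'(1)] exp2_add
        add_0_right efac_exp2_nonzero .
    from fac_nz[OF this s] show ?thesis by (simp add: algebra_simps)
  qed
  have sep: "separated N"
    unfolding separated_def
  proof (intro ballI impI conjI allI)
    fix i j and s :: int assume i: "i \<in> {1..r}" and j: "j \<in> {1..r}" and ij: "i \<noteq> j" and s: "\<bar>s\<bar> \<le> int N"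
    \<comment> \<open>Shift 0 comes from the denominator \<open>Delta p r x\<close>, positive shifts
      from the factorials of \<open>q ^ 2 * x i / x j\<close>, and negative ones from these by
      oddness after exchanging \<open>i\<close> and \<open>j\<close>.\<close>
    consider "s = 0" | "s > 0" | "s < 0" by linarith
    then show "odd_theta p (\<xi> i - \<xi> j + 2 * of_int s * \<eta>) \<noteq> 0"
    proof cases
      case 1
      show ?thesis
      proof (cases "i < j")
        case True
        then show ?thesis using diff0[of i j] i j 1 by simp
      next
        case False
        then show ?thesis using diff0[of j i] i j ij 1 unfolding odd_diff[of "\<xi> j" "\<xi> i"] by simp
      qed
    next
      case 2
      then have "s = int (Suc (nat (s - 1)))" "nat (s - 1) < N" using s by auto
      then show ?thesis using diff_pos[OF i j, of "nat (s - 1)"] by (metis of_int_of_nat_eq)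
    next
      case 3
      then have t: "s = - int (Suc (nat (- s - 1)))" "nat (- s - 1) < N" using s by auto
      have "\<xi> i - \<xi> j + 2 * of_int s * \<eta> = - (\<xi> j - \<xi> i + 2 * of_nat (Suc (nat (- s - 1))) * \<eta>)"
        by (subst t(1)) (simp add: algebra_simps)
      then show ?thesis using diff_pos[OF j i t(2)] odd by (metis neg_equal_0_iff_equal)
    qed
  next
    fix i j s :: nat assume i: "i \<in> {1..r}" and j: "j \<in> {1..r}" and ij: "i \<noteq> j" and s: "s < N"
    show "odd_theta p (\<xi> i + \<xi> j + 2 * of_nat s * \<eta>) \<noteq> 0"
    proof (cases "i < j")
      case True
      then show ?thesis using plus[of i j s] i j s by simp
    next
      case False
      then show ?thesis using plus[of j i s] i j ij s by (simp add: add.commute)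
    qed
  qed
  have L: "L = (\<Sum>k\<in>multi_indices r N. summand N \<alpha> \<beta> k)"
    unfolding L_def by (rule sum.cong[OF refl]) (rule term_eq_summand[OF q a' x' b'])
  \<comment> \<open>Both parities are treated at once through \<open>c\<close>. The hypotheses on
    the left-hand denominators give \<open>regular\<close>, while those on the right-hand
    denominators enter as \<open>nz\<close>.\<close>
  have sum_eq: "L = closed_form c m \<alpha> \<beta>"
    if par: "(N = 2 * m \<and> c = \<eta>) \<or> (Suc N = 2 * m \<and> c = 0)"
      and nz: "\<And>i. i \<in> {1..r} \<Longrightarrow> lower c m \<alpha> (\<xi> i) \<noteq> 0 \<and> upper c m \<alpha> (\<beta> i) \<noteq> 0" for c m
    unfolding L
  proof (rule sum_summand_all[OF sep _ _ _ par])
    fix k assume k: "k \<in> multi_indices r N"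
    show "regular N \<alpha> \<beta> k"
      unfolding regular_def
    proof (intro ballI conjI)
      fix i assume i: "i \<in> {1..r}"
      show "odd_theta p (\<alpha> + \<xi> i) \<noteq> 0"
        using den_theta[OF i] unfolding a' x'[OF i] exp2_add by (rule theta_nz)
      have 0: "q powi (int (k i) - int (weight r k)) * x i / a = exp2 (\<xi> i - \<alpha> + (of_nat (k i) - of_nat (weight r k)) * \<eta>)"
        unfolding a' x'[OF i] q exp2_simps by (rule arg_cong[of _ _ exp2]) (simp add: algebra_simps)
      show "fac (\<xi> i - \<alpha> + (of_nat (k i) - of_nat (weight r k)) * \<eta>) \<eta> (k i) \<noteq> 0"
        using den_x[OF k i] unfolding 0 unfolding q efac_exp2_nonzero .
      have 1: "a * x i * q ^ (N + 2) = exp2 (\<alpha> + \<xi> i + of_nat (N + 2) * \<eta>)"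
        unfolding a' x'[OF i] q exp2_simps ..
      have 2: "a * x i * q powi (1 - int N) = exp2 (\<alpha> + \<xi> i + (1 - of_nat N) * \<eta>)"
        unfolding a' x'[OF i] q exp2_simps by simp
      show "fac (\<alpha> + \<xi> i + of_nat (N + 2) * \<eta>) (2 * \<eta>) (k i) \<noteq> 0" "fac (\<alpha> + \<xi> i + (1 - of_nat N) * \<eta>) (2 * \<eta>) (k i) \<noteq> 0"
        using den_N[OF k i] unfolding efac_Cons 1 2 q2 mult_eq_0_iff de_Morgan_disj efac_exp2_nonzero
        by blast+
      have 3: "a * q / b i = exp2 (\<alpha> - \<beta> i + \<eta>)" "a * b i * q = exp2 (\<alpha> + \<beta> i + \<eta>)"
        unfolding a' b'[OF i] q exp2_simps by (rule arg_cong[of _ _ exp2], simp add: algebra_simps)+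
      show "fac (\<alpha> - \<beta> i + \<eta>) \<eta> (weight r k) \<noteq> 0" "fac (\<alpha> + \<beta> i + \<eta>) \<eta> (weight r k) \<noteq> 0"
        using den_b[OF k i] unfolding efac_Cons 3 unfolding q mult_eq_0_iff de_Morgan_disj efac_exp2_nonzero
        by blast+
    qed
  qed (use nz in auto)
  have even: "L = (\<Prod>i=1..r. efac (q ^ 2) p [a * x i * q ^ 2, a * q ^ 2 / x i, b i * q / a, q / (a * b i)] m
      / efac (q ^ 2) p [q / (a * x i), x i * q / a, a * q ^ 2 / b i, a * b i * q ^ 2] m)" if N: "N = 2 * m" for m
  proof -
    have args: "q / (a * x i) = exp2 (\<eta> - \<alpha> - \<xi> i)" "x i * q / a = exp2 (\<xi> i - \<alpha> + \<eta>)"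
      "a * q ^ 2 / b i = exp2 (\<alpha> - \<beta> i + (\<eta> + \<eta>))" "a * b i * q ^ 2 = exp2 (\<alpha> + \<beta> i + (\<eta> + \<eta>))"
      "a * x i * q ^ 2 = exp2 (\<alpha> + \<xi> i + (\<eta> + \<eta>))" "a * q ^ 2 / x i = exp2 (\<alpha> - \<xi> i + (\<eta> + \<eta>))"
      "b i * q / a = exp2 (\<beta> i - \<alpha> + \<eta>)" "q / (a * b i) = exp2 (\<eta> - \<alpha> - \<beta> i)" if i: "i \<in> {1..r}" for i
      unfolding a' x'[OF i] b'[OF i] q exp2_simps by (rule arg_cong[of _ _ exp2], simp add: algebra_simps)+
    have L': "L = closed_form \<eta> m \<alpha> \<beta>"
    proof (rule sum_eq)
      fix i assume i: "i \<in> {1..r}"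
      show "lower \<eta> m \<alpha> (\<xi> i) \<noteq> 0 \<and> upper \<eta> m \<alpha> (\<beta> i) \<noteq> 0"
        using den_even[OF N i] unfolding args[OF i] unfolding q2 denominator_nonzero .
    qed (use N in simp)
    show ?thesis
      unfolding L' closed_form_def factor_eq[symmetric] by (rule prod.cong[OF refl]) (simp only: args, simp only: q2)
  qed
  have odd: "L = (\<Prod>i=1..r. efac (q ^ 2) p [a * x i * q, a * q / x i, b i / a, 1 / (a * b i)] m
      / efac (q ^ 2) p [1 / (a * x i), x i / a, a * q / b i, a * b i * q] m)" if N: "int N = 2 * int m - 1" for m
  proof -
    \<comment> \<open>The zeros are kept so that the arguments match
      \<open>denominator_nonzero\<close> and \<open>factor_eq\<close> at
      \<open>c = 0\<close>.\<close>
    have args: "1 / (a * x i) = exp2 (0 - \<alpha> - \<xi> i)" "x i / a = exp2 (\<xi> i - \<alpha> + 0)"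
      "a * q / b i = exp2 (\<alpha> - \<beta> i + (0 + \<eta>))" "a * b i * q = exp2 (\<alpha> + \<beta> i + (0 + \<eta>))"
      "a * x i * q = exp2 (\<alpha> + \<xi> i + (0 + \<eta>))" "a * q / x i = exp2 (\<alpha> - \<xi> i + (0 + \<eta>))"
      "b i / a = exp2 (\<beta> i - \<alpha> + 0)" "1 / (a * b i) = exp2 (0 - \<alpha> - \<beta> i)" if i: "i \<in> {1..r}" for i
      unfolding a' x'[OF i] b'[OF i] q exp2_simps by (rule arg_cong[of _ _ exp2], simp add: algebra_simps)+
    have L': "L = closed_form 0 m \<alpha> \<beta>"
    proof (rule sum_eq)
      fix i assume i: "i \<in> {1..r}"
      show "lower 0 m \<alpha> (\<xi> i) \<noteq> 0 \<and> upper 0 m \<alpha> (\<beta> i) \<noteq> 0"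
        using den_odd[OF N i] unfolding args[OF i] unfolding q2 denominator_nonzero .
    qed (use N in simp)
    show ?thesis
      unfolding L' closed_form_def factor_eq[symmetric] by (rule prod.cong[OF refl]) (simp only: args, simp only: q2)
  qed
  show ?thesis using even odd by blast
qed

end
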